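(* Let $g:[0,2\pi]\to\mathbb{R}$ be continuous, strictly concave, three times continuously differentiable in neighborhoods of the points $\frac{2\pi s}{m}$ for all $s\in\{1,\dots,m-1\}$, and such that $g(x)=g(2\pi-x)$. Let $U_1,\dots,U_n$ be independent points on $S^1$ with a common continuous probability density $p(x)$ such that $\int_0^{2\pi}\prod_{l=0}^{m-1}p\left(x+\frac{2\pi l}{m}\right)dx>0$. Let $$f(U_1,\dots,U_m)=\sum_{0\le i<j\le m-1}g(|\beta_j-\beta_i|),$$ where $\beta_0=0$ and, for $i=1,\dots,m-1$, $\beta_i\in[0,2\pi)$ is the counterclockwise angle from $OU_1$ to $OU_{i+1}$, and let $H_n=\max_{1\le i_1<\dots<i_m\le n}f(U_{i_1},\dots,U_{i_m})$. Then for every $t>0$ $$\lim_{n\to\infty}\mathbb{P}\left\{n^{\frac{2m}{m-1}}\left(\frac12\sum_{s=1}^{m-1}m\,g\left(\frac{2\pi s}{m}\right)-H_n\right)\le t\right\}=1-\exp\left(-\frac{t^{\frac{m-1}{2}}K}{m}\right),$$ where $$K=\frac{(2\pi)^{\frac{m-1}{2}}\left[\int_0^{2\pi}\prod_{l=0}^{m-1}p\left(x+\frac{2\pi l}{m}\right)dx\right]}{\sqrt{\det(-G)}\,\Gamma\left(\frac{m+1}{2}\right)}$$ and $G=(g_{i,j})_{i,j=1}^{m-1}$ is the symmetric matrix with $g_{i,j}=-g''\left(\frac{2\pi|i-j|}{m}\right)$ for $i\ne j$ and $g_{i,i}=\sum_{s=1}^{m-1}g''\left(\frac{2\pi s}{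m}\right)$.
   Context: $S^1$ is the unit circle with center $O$; points are identified with polar angles modulo $2\pi$, and a density $p$ on $S^1$ is regarded as a $2\pi$-periodic non-negative function on $\mathbb{R}$ with $\int_0^{2\pi}p(x)\,dx=1$. *)

theory Defs
  imports "HOL-Probability.Probability" "Jordan_Normal_Form.Determinant"
begin

definition strictly_concave_on :: "real set \<Rightarrow> (real \<Rightarrow> real) \<Rightarrow> bool" where
  "strictly_concave_on S g \<longleftrightarrow> convex S \<and>
     (\<forall>x\<in>S. \<forall>y\<in>S. \<forall>u. x \<noteq> y \<longrightarrow> 0 < u \<longrightarrow> u < 1 \<longrightarrow>
        (1 - u) * g x + u * g y < g ((1 - u) * x + u * y))"

(* Meant for open S: deriv is the two-sided derivative. *)
definition k_times_cont_diff_on :: "nat \<Rightarrow> (real \<Rightarrow> real) \<Rightarrow> real set \<Rightarrow> bool" where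
  "k_times_cont_diff_on k g S \<longleftrightarrow>
     (\<forall>j<k. (deriv ^^ j) g differentiable_on S) \<and> continuous_on S ((deriv ^^ k) g)"

definition C3_near :: "(real \<Rightarrow> real) \<Rightarrow> real \<Rightarrow> bool" where
  "C3_near g a \<longleftrightarrow> (\<exists>S. open S \<and> a \<in> S \<and> k_times_cont_diff_on 3 g S)"

(* The circle is the unit circle of the complex plane; the density refers to the polar angle,
  and only its values on one period are integrated. *)
definition circle_distributed :: "'a measure \<Rightarrow> ('a \<Rightarrow> complex) \<Rightarrow> (real \<Rightarrow> real) \<Rightarrow> bool" where
  "circle_distributed M X p \<longleftrightarrow>
     X \<in> borel_measurable M \<and> (\<forall>\<omega>\<in>space M. X \<omega> \<in> sphere 0 1) \<and>
     distributed M lborel (\<lambda>\<omega>. Arg2pi (X \<omega>))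
       (\<lambda>x. ennreal (p x * indicator {0..<2*pi} x))"

(* Counterclockwise angle in [0, 2pi) from O u to O v. *)
definition ccw_angle :: "complex \<Rightarrow> complex \<Rightarrow> real" where
  "ccw_angle u v = Arg2pi (v / u)"

(* The kernel f(U_1, ..., U_m), with the arguments as a list of length m:
  zs ! i is U_(i+1), so that beta_i = ccw_angle (zs ! 0) (zs ! i),
  which is 0 for i = 0. *)
definition angle_kernel :: "(real \<Rightarrow> real) \<Rightarrow> complex list \<Rightarrow> real" where
  "angle_kernel g zs =
     (let \<beta> = (\<lambda>i. if i = 0 then 0 else ccw_angle (zs ! 0) (zs ! i))
      in \<Sum>j<length zs. \<Sum>i<j. g \<bar>\<beta> j - \<beta> i\<bar>)"

(* For n < m there is no index tuple and the value is unspecified. *)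
definition U_max :: "(real \<Rightarrow> real) \<Rightarrow> nat \<Rightarrow> nat \<Rightarrow> (nat \<Rightarrow> complex) \<Rightarrow> real" where
  "U_max g m n u =
     Max {angle_kernel g (map u js) | js. length js = m \<and> sorted_wrt (<) js \<and> set js \<subseteq> {1..n}}"

definition G_mat :: "(real \<Rightarrow> real) \<Rightarrow> nat \<Rightarrow> real mat" where
  "G_mat g m = Matrix.mat (m - 1) (m - 1) (\<lambda>(i, j).
     if i = j then \<Sum>s=1..m-1. (deriv ^^ 2) g (2 * pi * real s / real m)
     else - (deriv ^^ 2) g (2 * pi * \<bar>real i - real j\<bar> / real m))"

definition polygon_density_integral :: "(real \<Rightarrow> real) \<Rightarrow> nat \<Rightarrow> real" where
  "polygon_density_integral p m =
     integral {0..2*pi} (\<lambda>x. \<Prod>l=0..m-1. p (x + 2 * pi * real l / real m))"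

(* Strict concavity does not exclude g'' = 0 at the points 2*pi*s/m, so
  det (-G) = 0 can occur (for instance m = 2, g x = -(x - pi)^4).
  Real division would then give K = 0; the constant is therefore taken in
  [0, infinity], with value infinity in this case. *)
definition K_const :: "(real \<Rightarrow> real) \<Rightarrow> (real \<Rightarrow> real) \<Rightarrow> nat \<Rightarrow> ennreal" where
  "K_const g p m =
     ennreal ((2 * pi) powr ((real m - 1) / 2) * polygon_density_integral p m) /
     ennreal (sqrt (Determinant.det (- G_mat g m)) * Gamma ((real m + 1) / 2))"

(* exp (-x) for x in [0, infinity], with exp (-infinity) = 0. *)
definition exp_minus :: "ennreal \<Rightarrow> real" where
  "exp_minus x = (if x = \<infinity> then 0 else exp (- enn2real x))"

end

(* By strict concavity and Jensen's inequality the kernel is maximal exactly at regular m-gons, and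
  near such a configuration the deficit is half the quadratic form Q of -G in the deviations of the
  other angles from one base angle, up to o(|deviation|^2). Hence a given m-tuple has deficit at
  most z with probability asymptotic to (m-1)! times the integral of the product of densities times the volume
  of the ellipsoid {Q <= 2 z}, which produces K. With z = t n^(-2m/(m-1)) the expected number of
  such m-tuples converges, and since overlapping tuples are negligible, the number of them is
  asymptotically Poisson.

  If det(-G) = 0, the ellipsoid has infinite volume. One then counts only tuples whose deviations
  are at most R sqrt z; the limiting Poisson parameter tends to infinity with R. *)
theory Submission
  imports Defs
begin

section \<open>Volumes of ellipsoids and the periodic measure\<close>

text \<open>With \<open>z = s^2\<close> the deviations are of order s, so one tuple has deficit at
  most z with probability of order \<open>s^(m-1)\<close>; the exponent \<open>2m/(m-1)\<close> is
  the one for which \<open>n^m * s^(m-1)\<close> stays constant. The factor 1/m is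
  \<open>(m-1)!/m!\<close>: the orders in which the other points fill the vertices, over the m! of
  the binomial coefficient. The linear terms of the deficit cancel because g is symmetric about pi,
  which leaves a sum of nonnegative gaps between g and its tangents. Overlaps need no moment
  computation: a second tuple sharing a point with the first forces one further independent point
  within O(s) of finitely many positions, which costs a factor n*s -> 0. If det(-G) = 0, a small
  deficit is not known to confine the deviations to a multiple of sqrt z, so the truncated count
  gives only a lower bound; this suffices because the claimed limit is then 1. The truncation also
  supplies the integrable majorant for dominated convergence in both cases.\<close>

text \<open>Fubini, one coordinate at a time. The weight \<open>k\<close> carries Jacobian and
  density together, so the same statement serves for the circle measure rescaled around a base point
  and for dilations of Lebesgue measure.\<close>

lemma nn_integral_PiM_substitution:
  fixes T :: "'i \<Rightarrow> real \<Rightarrow> real" and k :: "'i \<Rightarrow> real \<Rightarrow> ennreal"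
  assumes "finite I"
    and N: "\<And>i. sigma_finite_measure (N i)" "\<And>i. sets (N i) = sets borel"
    and T [measurable]: "\<And>i. T i \<in> borel_measurable borel"
    and k [measurable]: "\<And>i. k i \<in> borel_measurable borel"
    and one: "\<And>i f. i \<in> I \<Longrightarrow> f \<in> borel_measurable borel \<Longrightarrow>
      (\<integral>\<^sup>+x. f x \<partial>N i) = (\<integral>\<^sup>+y. f (T i y) * k i y \<partial>lborel)"
    and f: "f \<in> borel_measurable (PiM I (\<lambda>_. borel))"
  shows "(\<integral>\<^sup>+x. f x \<partial>PiM I N) = (\<integral>\<^sup>+y. f (\<lambda>i\<in>I. T i (y i)) * (\<Prod>i\<in>I. k i (y i)) \<partial>PiM I (\<lambda>_. lborel))"
  using assms(1) one f
proof (induction I arbitrary: f rule: finite_induct)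
  case empty
  then show ?case by (simp add: PiM_empty nn_integral_count_space_finite restrict_def)
next
  case (insert j I)
  interpret N: product_sigma_finite N by (simp add: product_sigma_finite_def N)
  interpret L: product_sigma_finite "\<lambda>_. lborel :: real measure" by standard
  note f [measurable] = insert.prems(2)
  have setsPi: "sets (PiM J N) = sets (PiM J (\<lambda>_. borel))" for J
    by (rule sets_PiM_cong) (auto simp: N(2))
  have setsPiL: "sets (PiM J (\<lambda>_. lborel)) = sets (PiM J (\<lambda>_. borel :: real measure))" for J :: "'i set"
    by (rule sets_PiM_cong) auto
  note [measurable_cong] = setsPi setsPiL N(2)
  have upd [measurable]: "(\<lambda>x. x(j := y)) \<in> PiM I (\<lambda>_. borel) \<rightarrow>\<^sub>M PiM (insert j I) (\<lambda>_. borel :: real measure)" for y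
    by (rule measurable_fun_upd[where J = I]) auto
  have upd2 [measurable]: "(\<lambda>z. (fst z)(j := snd z)) \<in> PiM I (\<lambda>_. borel) \<Otimes>\<^sub>M borel \<rightarrow>\<^sub>M PiM (insert j I) (\<lambda>_. borel :: real measure)"
    by (rule measurable_fun_upd[where J = I]) auto
  have compT: "(\<lambda>x. T i (x i)) \<in> borel_measurable (PiM J (\<lambda>_. borel))" if "i \<in> J" for i J
    using measurable_compose[OF measurable_component_singleton[OF that, of "\<lambda>_. borel"] T[of i]] by simp
  have compk: "(\<lambda>x. k i (x i)) \<in> borel_measurable (PiM J (\<lambda>_. borel))" if "i \<in> J" for i J
    using measurable_compose[OF measurable_component_singleton[OF that, of "\<lambda>_. borel"] k[of i]] by simp
  have mT [measurable]: "(\<lambda>x. \<lambda>i\<in>I. T i (x i)) \<in> PiM I (\<lambda>_. borel) \<rightarrow>\<^sub>M PiM I (\<lambda>_. borel)"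
    by (intro measurable_restrict compT)
  have mT' [measurable]: "(\<lambda>x. \<lambda>i\<in>insert j I. T i (x i)) \<in> PiM (insert j I) (\<lambda>_. borel) \<rightarrow>\<^sub>M PiM (insert j I) (\<lambda>_. borel)"
    by (intro measurable_restrict compT)
  have mk [measurable]: "(\<lambda>x. \<Prod>i\<in>J. k i (x i)) \<in> borel_measurable (PiM J (\<lambda>_. borel))" for J
    by (intro borel_measurable_prod_ennreal compk)
  have "(\<integral>\<^sup>+x. f x \<partial>PiM (insert j I) N) = (\<integral>\<^sup>+x. \<integral>\<^sup>+y. f (x(j := y)) \<partial>N j \<partial>PiM I N)"
    by (rule N.product_nn_integral_insert[OF insert.hyps]) measurable
  also have "\<dots> = (\<integral>\<^sup>+x. \<integral>\<^sup>+y. f (x(j := T j y)) * k j y \<partial>lborel \<partial>PiM I N)"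
  proof (rule nn_integral_cong)
    fix x assume "x \<in> space (PiM I N)"
    then have x: "x \<in> space (PiM I (\<lambda>_. borel))" using sets_eq_imp_space_eq[OF setsPi] by blast
    have "(\<lambda>y. f (x(j := y))) \<in> borel_measurable borel"
      by (rule measurable_compose[OF measurable_component_update[OF x insert.hyps(2)] f])
    from insert.prems(1)[OF _ this, of j]
    show "(\<integral>\<^sup>+y. f (x(j := y)) \<partial>N j) = (\<integral>\<^sup>+y. f (x(j := T j y)) * k j y \<partial>lborel)" by simp
  qed
  also have "\<dots> = (\<integral>\<^sup>+x. (\<integral>\<^sup>+y. f ((\<lambda>i\<in>I. T i (x i))(j := T j y)) * k j y \<partial>lborel) * (\<Prod>i\<in>I. k i (x i)) \<partial>PiM I (\<lambda>_. lborel))"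
  proof (rule insert.IH)
    show "(\<lambda>x. \<integral>\<^sup>+y. f (x(j := T j y)) * k j y \<partial>lborel) \<in> borel_measurable (PiM I (\<lambda>_. borel))"
      by (rule lborel.borel_measurable_nn_integral) (simp add: case_prod_beta, measurable)
  qed (use insert.prems in auto)
  also have "\<dots> = (\<integral>\<^sup>+x. \<integral>\<^sup>+y. f (\<lambda>i\<in>insert j I. T i ((x(j := y)) i)) * (\<Prod>i\<in>insert j I. k i ((x(j := y)) i)) \<partial>lborel \<partial>PiM I (\<lambda>_. lborel))"
  proof (rule nn_integral_cong)
    fix x assume "x \<in> space (PiM I (\<lambda>_. lborel :: real measure))"
    then have x: "x \<in> space (PiM I (\<lambda>_. borel))" by (simp add: space_PiM)
    have *: "(\<lambda>i\<in>I. T i (x i))(j := T j y) = (\<lambda>i\<in>insert j I. T i ((x(j := y)) i))" for y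
      using insert.hyps by (auto simp: fun_eq_iff)
    have p: "(\<Prod>i\<in>insert j I. k i ((x(j := y)) i)) = k j y * (\<Prod>i\<in>I. k i (x i))" for y
    proof -
      have "(\<Prod>i\<in>I. k i ((x(j := y)) i)) = (\<Prod>i\<in>I. k i (x i))"
        by (rule prod.cong) (use insert.hyps in auto)
      then show ?thesis using insert.hyps by simp
    qed
    have xT: "(\<lambda>i\<in>I. T i (x i)) \<in> space (PiM I (\<lambda>_. borel))" by (simp add: space_PiM)
    have [measurable]: "(\<lambda>y. f ((\<lambda>i\<in>I. T i (x i))(j := T j y))) \<in> borel_measurable borel"
      by (rule measurable_compose[OF T[of j] measurable_compose[OF measurable_component_update[OF xT insert.hyps(2)] f]])
    have "(\<integral>\<^sup>+y. f ((\<lambda>i\<in>I. T i (x i))(j := T j y)) * k j y \<partial>lborel) * (\<Prod>i\<in>I. k i (x i)) =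
      (\<integral>\<^sup>+y. f ((\<lambda>i\<in>I. T i (x i))(j := T j y)) * k j y * (\<Prod>i\<in>I. k i (x i)) \<partial>lborel)"
      by (rule nn_integral_multc[symmetric]) measurable
    then show "(\<integral>\<^sup>+y. f ((\<lambda>i\<in>I. T i (x i))(j := T j y)) * k j y \<partial>lborel) * (\<Prod>i\<in>I. k i (x i)) =
      (\<integral>\<^sup>+y. f (\<lambda>i\<in>insert j I. T i ((x(j := y)) i)) * (\<Prod>i\<in>insert j I. k i ((x(j := y)) i)) \<partial>lborel)"
      unfolding * p by (simp add: mult.assoc)
  qed
  also have "\<dots> = (\<integral>\<^sup>+y. f (\<lambda>i\<in>insert j I. T i (y i)) * (\<Prod>i\<in>insert j I. k i (y i)) \<partial>PiM (insert j I) (\<lambda>_. lborel))"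
    by (rule L.product_nn_integral_insert[symmetric, OF insert.hyps]) measurable
  finally show ?case .
qed

lemma nn_integral_lborel_scale:
  fixes f :: "real \<Rightarrow> ennreal"
  assumes "f \<in> borel_measurable borel" "c > 0"
  shows "(\<integral>\<^sup>+x. f x \<partial>lborel) = (\<integral>\<^sup>+y. f (t + c * y) * ennreal c \<partial>lborel)"
  using nn_integral_real_affine[OF assms(1), of c t] assms
  by (simp add: nn_integral_cmult mult.commute)

section \<open>Quadratic forms, Schur complements and volumes of ellipsoids\<close>

definition quad_form :: "nat \<Rightarrow> (nat \<Rightarrow> nat \<Rightarrow> real) \<Rightarrow> (nat \<Rightarrow> real) \<Rightarrow> real" where
  "quad_form k A x = (\<Sum>i<k. \<Sum>j<k. A i j * x i * x j)"

definition bilinear_form :: "nat \<Rightarrow> (nat \<Rightarrow> nat \<Rightarrow> real) \<Rightarrow> (nat \<Rightarrow> real) \<Rightarrow> (nat \<Rightarrow> real) \<Rightarrow> real" where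
  "bilinear_form k A x y = (\<Sum>i<k. \<Sum>j<k. A i j * x i * y j)"

lemma quad_form_cong: "(\<And>i. i < k \<Longrightarrow> x i = y i) \<Longrightarrow> quad_form k A x = quad_form k A y"
  unfolding quad_form_def by (intro sum.cong) auto

lemma measurable_quad_form [measurable]:
  "(\<lambda>x. quad_form k A x) \<in> borel_measurable (PiM {..<k} (\<lambda>_. borel))"
  unfolding quad_form_def by measurable

text \<open>Completing the square in the last variable; the remaining matrix is the Schur complement
  of \<open>A k k\<close>.\<close>

lemma quad_form_Suc:
  assumes sym: "\<And>i j. i \<le> k \<Longrightarrow> j \<le> k \<Longrightarrow> A i j = A j i" and a: "A k k \<noteq> 0"
  shows "quad_form (Suc k) A x = A k k * (x k + (\<Sum>i<k. A i k * x i) / A k k)\<^sup>2 +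
    quad_form k (\<lambda>i j. A i j - A i k * A j k / A k k) x"
proof -
  let ?s = "\<Sum>i<k. A i k * x i"
  have "quad_form (Suc k) A x = quad_form k A x + (\<Sum>i<k. A i k * x i * x k) + (\<Sum>j<k. A k j * x k * x j) + A k k * (x k)\<^sup>2"
    by (simp add: quad_form_def sum.distrib power2_eq_square)
  also have "(\<Sum>j<k. A k j * x k * x j) = ?s * x k"
    using sym by (auto simp: sum_distrib_right intro!: sum.cong)
  also have "(\<Sum>i<k. A i k * x i * x k) = ?s * x k" by (simp add: sum_distrib_right)
  finally have 1: "quad_form (Suc k) A x = quad_form k A x + 2 * ?s * x k + A k k * (x k)\<^sup>2" by simp
  have "(\<Sum>i<k. \<Sum>j<k. A i k * A j k / A k k * x i * x j) = (?s * ?s) / A k k"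
    unfolding sum_product by (simp add: sum_divide_distrib mult_ac)
  then have 2: "quad_form k (\<lambda>i j. A i j - A i k * A j k / A k k) x = quad_form k A x - (?s * ?s) / A k k"
    by (simp add: quad_form_def left_diff_distrib sum_subtractf)
  show ?thesis unfolding 1 2 using a by (simp add: power2_eq_square field_simps)
qed

text \<open>Right multiplication by a unit lower triangular block matrix clears the last row in
  front of the corner entry, so the determinant factors. This is the determinant side of completing
  the square.\<close>

lemma det_Schur_last:
  assumes a: "A k k \<noteq> (0::real)"
  shows "Determinant.det (Matrix.mat (Suc k) (Suc k) (\<lambda>(i, j). A i j)) =
    A k k * Determinant.det (Matrix.mat k k (\<lambda>(i, j). A i j - A i k * A k j / A k k))"
proof -
  let ?A = "Matrix.mat (Suc k) (Suc k) (\<lambda>(i, j). A i j)"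
  let ?S = "Matrix.mat k k (\<lambda>(i, j). A i j - A i k * A k j / A k k)"
  let ?R = "Matrix.mat 1 k (\<lambda>(i, j). - A k j / A k k)"
  let ?L = "four_block_mat (1\<^sub>m k) (0\<^sub>m k 1) ?R (1\<^sub>m 1)"
  let ?B = "Matrix.mat k 1 (\<lambda>(i, j). A i k)"
  let ?D = "Matrix.mat 1 1 (\<lambda>(i, j). A k k)"
  have A_block: "?A = four_block_mat (Matrix.mat k k (\<lambda>(i, j). A i j)) ?B (Matrix.mat 1 k (\<lambda>(i, j). A k j)) ?D"
    by (rule eq_matI) (auto simp: less_Suc_eq)
  have prod: "?A * ?L = four_block_mat ?S ?B (0\<^sub>m 1 k) ?D"
    unfolding A_block
    by (subst mult_four_block_mat[of _ k k _ 1 _ 1 _ _ k _ 1])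
       (use a in \<open>auto intro!: arg_cong4[of _ _ _ _ _ _ _ _ four_block_mat] eq_matI simp: scalar_prod_def\<close>)
  have "Determinant.det ?L = 1"
    by (subst det_four_block_mat_upper_right_zero[of _ k _ 1]) auto
  moreover have "Determinant.det (?A * ?L) = Determinant.det ?A * Determinant.det ?L"
    by (rule det_mult[of _ "Suc k"]) auto
  moreover have "Determinant.det (four_block_mat ?S ?B (0\<^sub>m 1 k) ?D) = Determinant.det ?S * Determinant.det ?D"
    by (rule det_four_block_mat_lower_left_zero[of _ k _ 1]) auto
  moreover have "Determinant.det ?D = A k k"
    by (subst det_single) auto
  ultimately show ?thesis using prod by (simp add: mult.commute)
qed

text \<open>A positive definite form is turned into the sum of squares by completing squares, starting
  with the last variable; the Jacobian is read off from the Schur complements.\<close>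
lemma nn_integral_quad_form:
  fixes \<phi> :: "real \<Rightarrow> ennreal"
  assumes \<phi> [measurable]: "\<phi> \<in> borel_measurable borel"
    and sym: "\<And>i j. i < k \<Longrightarrow> j < k \<Longrightarrow> A i j = A j i"
    and pos: "\<And>x. (\<exists>i<k. x i \<noteq> 0) \<Longrightarrow> quad_form k A x > 0"
  shows "Determinant.det (Matrix.mat k k (\<lambda>(i, j). A i j)) > 0 \<and>
    ennreal (sqrt (Determinant.det (Matrix.mat k k (\<lambda>(i, j). A i j)))) *
      (\<integral>\<^sup>+x. \<phi> (quad_form k A x) \<partial>PiM {..<k} (\<lambda>_. lborel)) =
    (\<integral>\<^sup>+x. \<phi> (\<Sum>i<k. (x i)\<^sup>2) \<partial>PiM {..<k} (\<lambda>_. lborel))"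
  using assms
proof (induction k arbitrary: A \<phi>)
  case 0
  then show ?case by (simp add: quad_form_def)
next
  case (Suc k)
  interpret L: product_sigma_finite "\<lambda>_::nat. lborel :: real measure" by standard
  note [measurable] = Suc.prems(1)
  define a where "a = A k k"
  define S where "S = (\<lambda>i j. A i j - A i k * A j k / a)"
  have "quad_form (Suc k) A (\<lambda>i. if i = k then 1 else 0) = a"
    by (simp add: quad_form_def a_def)
  then have a: "a > 0" using Suc.prems(3)[of "\<lambda>i. if i = k then 1 else 0"] by auto
  define b where "b x = (\<Sum>i<k. A i k * x i) / a" for x :: "nat \<Rightarrow> real"
  have split: "quad_form (Suc k) A x = a * (x k + b x)\<^sup>2 + quad_form k S x" for x
    unfolding S_def b_def a_def by (rule quad_form_Suc) (use Suc.prems(2) a in \<open>auto simp: a_def\<close>)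
  have b_upd: "b (x(k := y)) = b x" for x y unfolding b_def by simp
  have S_upd: "quad_form k S (x(k := y)) = quad_form k S x" for x y by (rule quad_form_cong) auto
  have Ssym: "S i j = S j i" if "i < k" "j < k" for i j
    using Suc.prems(2)[of i j] that by (simp add: S_def mult.commute)
  have Spos: "quad_form k S x > 0" if "\<exists>i<k. x i \<noteq> 0" for x
  proof -
    \<comment> \<open>With this last coordinate the square vanishes, so the Schur complement
      inherits positivity.\<close>
    have "quad_form (Suc k) A (x(k := - b x)) > 0"
      using that by (intro Suc.prems(3)) auto
    then show ?thesis by (simp add: split b_upd S_upd)
  qed
  let ?d = "Determinant.det (Matrix.mat k k (\<lambda>(i, j). S i j))"
  have det: "Determinant.det (Matrix.mat (Suc k) (Suc k) (\<lambda>(i, j). A i j)) = a * ?d"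
  proof -
    have "Matrix.mat k k (\<lambda>(i, j). A i j - A i k * A k j / A k k) = Matrix.mat k k (\<lambda>(i, j). S i j)"
      using Suc.prems(2) by (auto intro!: eq_matI simp: S_def a_def)
    then show ?thesis using det_Schur_last[of A k] a by (simp add: a_def)
  qed
  have dpos: "?d > 0" using Suc.IH[OF Suc.prems(1) Ssym Spos] by simp
  have setsPiL [measurable_cong]: "sets (PiM J (\<lambda>_. lborel)) = sets (PiM J (\<lambda>_. borel :: real measure))" for J :: "nat set"
    by (rule sets_PiM_cong) auto
  have qm [measurable]: "quad_form k S \<in> borel_measurable (PiM {..<k} (\<lambda>_. borel))" by measurable
  have sm [measurable]: "(\<lambda>x. \<Sum>i<k. (x i :: real)\<^sup>2) \<in> borel_measurable (PiM {..<k} (\<lambda>_. borel))" by measurable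
  have ins: "{..<Suc k} = insert k {..<k}" by auto
  have "(\<integral>\<^sup>+x. \<phi> (quad_form (Suc k) A x) \<partial>PiM {..<Suc k} (\<lambda>_. lborel)) =
    (\<integral>\<^sup>+x. \<integral>\<^sup>+y. \<phi> (quad_form (Suc k) A (x(k := y))) \<partial>lborel \<partial>PiM {..<k} (\<lambda>_. lborel))"
    unfolding ins by (rule L.product_nn_integral_insert) (auto simp flip: ins)
  also have "\<dots> = (\<integral>\<^sup>+x. ennreal (1 / sqrt a) * (\<integral>\<^sup>+y. \<phi> (y\<^sup>2 + quad_form k S x) \<partial>lborel) \<partial>PiM {..<k} (\<lambda>_. lborel))"
  proof (rule nn_integral_cong)
    fix x :: "nat \<Rightarrow> real"
    have "(\<integral>\<^sup>+y. \<phi> (quad_form (Suc k) A (x(k := y))) \<partial>lborel) = (\<integral>\<^sup>+y. \<phi> (a * (y + b x)\<^sup>2 + quad_form k S x) \<partial>lborel)"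
      by (simp add: split b_upd S_upd)
    also have "\<dots> = (\<integral>\<^sup>+y. \<phi> (a * (- b x + 1 / sqrt a * y + b x)\<^sup>2 + quad_form k S x) * ennreal (1 / sqrt a) \<partial>lborel)"
      using a by (intro nn_integral_lborel_scale) auto
    also have "\<dots> = (\<integral>\<^sup>+y. \<phi> (y\<^sup>2 + quad_form k S x) * ennreal (1 / sqrt a) \<partial>lborel)"
      using a by (simp add: power_divide)
    also have "\<dots> = ennreal (1 / sqrt a) * (\<integral>\<^sup>+y. \<phi> (y\<^sup>2 + quad_form k S x) \<partial>lborel)"
      by (subst nn_integral_multc) (auto simp: mult.commute)
    finally show "(\<integral>\<^sup>+y. \<phi> (quad_form (Suc k) A (x(k := y))) \<partial>lborel) = \<dots>" .
  qed
  also have "\<dots> = ennreal (1 / sqrt a) * (\<integral>\<^sup>+x. \<integral>\<^sup>+y. \<phi> (y\<^sup>2 + quad_form k S x) \<partial>lborel \<partial>PiM {..<k} (\<lambda>_. lborel))"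
    by (rule nn_integral_cmult) measurable
  \<comment> \<open>The last variable moves outside so that, for each fixed y, the induction
    hypothesis applies to the function \<open>\<lambda>u. \<phi> (y^2 + u)\<close>.\<close>
  also have "(\<integral>\<^sup>+x. \<integral>\<^sup>+y. \<phi> (y\<^sup>2 + quad_form k S x) \<partial>lborel \<partial>PiM {..<k} (\<lambda>_. lborel)) =
    (\<integral>\<^sup>+y. \<integral>\<^sup>+x. \<phi> (y\<^sup>2 + quad_form k S x) \<partial>PiM {..<k} (\<lambda>_. lborel) \<partial>lborel)"
    by (rule pair_sigma_finite.Fubini')
       (auto intro!: pair_sigma_finite.intro L.sigma_finite lborel.sigma_finite_measure_axioms simp: case_prod_beta)
  finally have 1: "ennreal (sqrt a) * (\<integral>\<^sup>+x. \<phi> (quad_form (Suc k) A x) \<partial>PiM {..<Suc k} (\<lambda>_. lborel)) =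
     (\<integral>\<^sup>+y. \<integral>\<^sup>+x. \<phi> (y\<^sup>2 + quad_form k S x) \<partial>PiM {..<k} (\<lambda>_. lborel) \<partial>lborel)"
    using a by (simp add: mult.assoc[symmetric] ennreal_mult[symmetric])
  have "ennreal (sqrt ?d) * (\<integral>\<^sup>+y. \<integral>\<^sup>+x. \<phi> (y\<^sup>2 + quad_form k S x) \<partial>PiM {..<k} (\<lambda>_. lborel) \<partial>lborel) =
     (\<integral>\<^sup>+y. ennreal (sqrt ?d) * (\<integral>\<^sup>+x. \<phi> (y\<^sup>2 + quad_form k S x) \<partial>PiM {..<k} (\<lambda>_. lborel)) \<partial>lborel)"
    by (rule nn_integral_cmult[symmetric]) (rule sigma_finite_measure.borel_measurable_nn_integral[OF L.sigma_finite], auto simp: case_prod_beta)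
  also have "\<dots> = (\<integral>\<^sup>+y. \<integral>\<^sup>+x. \<phi> (y\<^sup>2 + (\<Sum>i<k. (x i)\<^sup>2)) \<partial>PiM {..<k} (\<lambda>_. lborel) \<partial>lborel)"
  proof (rule nn_integral_cong)
    fix y :: real
    have "(\<lambda>u. \<phi> (y\<^sup>2 + u)) \<in> borel_measurable borel" by measurable
    from Suc.IH[OF this Ssym Spos]
    show "ennreal (sqrt ?d) * (\<integral>\<^sup>+x. \<phi> (y\<^sup>2 + quad_form k S x) \<partial>PiM {..<k} (\<lambda>_. lborel)) =
      (\<integral>\<^sup>+x. \<phi> (y\<^sup>2 + (\<Sum>i<k. (x i)\<^sup>2)) \<partial>PiM {..<k} (\<lambda>_. lborel))" by simp
  qed
  also have "\<dots> = (\<integral>\<^sup>+x. \<integral>\<^sup>+y. \<phi> (y\<^sup>2 + (\<Sum>i<k. (x i)\<^sup>2)) \<partial>lborel \<partial>PiM {..<k} (\<lambda>_. lborel))"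
    by (rule pair_sigma_finite.Fubini'[symmetric])
       (auto intro!: pair_sigma_finite.intro L.sigma_finite lborel.sigma_finite_measure_axioms simp: case_prod_beta)
  also have "\<dots> = (\<integral>\<^sup>+x. \<phi> (\<Sum>i<Suc k. (x i)\<^sup>2) \<partial>PiM {..<Suc k} (\<lambda>_. lborel))"
    unfolding ins by (subst L.product_nn_integral_insert) (auto simp: add.commute simp flip: ins)
  finally have 2: "ennreal (sqrt ?d) * (\<integral>\<^sup>+y. \<integral>\<^sup>+x. \<phi> (y\<^sup>2 + quad_form k S x) \<partial>PiM {..<k} (\<lambda>_. lborel) \<partial>lborel) =
    (\<integral>\<^sup>+x. \<phi> (\<Sum>i<Suc k. (x i)\<^sup>2) \<partial>PiM {..<Suc k} (\<lambda>_. lborel))" .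
  have "ennreal (sqrt (a * ?d)) = ennreal (sqrt ?d) * ennreal (sqrt a)"
    using a dpos by (simp add: real_sqrt_mult ennreal_mult mult.commute)
  then have "ennreal (sqrt (a * ?d)) * (\<integral>\<^sup>+x. \<phi> (quad_form (Suc k) A x) \<partial>PiM {..<Suc k} (\<lambda>_. lborel)) =
    (\<integral>\<^sup>+x. \<phi> (\<Sum>i<Suc k. (x i)\<^sup>2) \<partial>PiM {..<Suc k} (\<lambda>_. lborel))"
    using 1 2 by (simp only: mult.assoc)
  then show ?case using a dpos unfolding det by simp
qed

text \<open>The form along the line x + t y is a nonnegative polynomial in t, so its discriminant is
  not positive. The form may be degenerate: if it vanishes at y, the polynomial is affine and must
  have slope zero.\<close>

lemma psd_Cauchy_Schwarz:
  assumes sym: "\<And>i j. i < k \<Longrightarrow> j < k \<Longrightarrow> A i j = A j i"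
    and psd: "\<And>x. quad_form k A x \<ge> 0"
  shows "(bilinear_form k A x y)\<^sup>2 \<le> quad_form k A x * quad_form k A y"
proof -
  let ?b = "bilinear_form k A x y"
  have *: "(\<Sum>i<k. \<Sum>j<k. A i j * y i * x j) = ?b"
    unfolding bilinear_form_def by (subst sum.swap) (auto intro!: sum.cong simp: sym)
  then have expand: "quad_form k A (\<lambda>i. x i + t * y i) = quad_form k A x + 2 * t * ?b + t\<^sup>2 * quad_form k A y" for t
  proof -
    have "quad_form k A (\<lambda>i. x i + t * y i) = (\<Sum>i<k. \<Sum>j<k. A i j * x i * x j + t * (A i j * y i * x j) +
        t * (A i j * x i * y j) + t\<^sup>2 * (A i j * y i * y j))"
      unfolding quad_form_def by (intro sum.cong refl) (simp add: algebra_simps power2_eq_square)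
    also have "\<dots> = quad_form k A x + t * (\<Sum>i<k. \<Sum>j<k. A i j * y i * x j) + t * ?b + t\<^sup>2 * quad_form k A y"
      by (simp only: sum.distrib sum_distrib_left[symmetric] quad_form_def bilinear_form_def)
    finally show ?thesis by (simp add: *)
  qed
  show ?thesis
  proof (cases "quad_form k A y = 0")
    case True
    have "?b = 0"
    proof (rule ccontr)
      assume "?b \<noteq> 0"
      \<comment> \<open>At this t the affine polynomial takes the value -1.\<close>
      then show False
        using psd[of "\<lambda>i. x i + (- (quad_form k A x + 1) / (2 * ?b)) * y i"] True
        unfolding expand by (simp add: field_simps)
    qed
    then show ?thesis using True by simp
  next
    case False
    then have "quad_form k A y > 0" using psd[of y] by simp
    then show ?thesis
      using psd[of "\<lambda>i. x i + (- ?b / quad_form k A y) * y i"]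
      unfolding expand by (simp add: field_simps power2_eq_square)
  qed
qed

text \<open>Let \<open>v i\<close> be the i-th row of the inverse matrix. Then the bilinear form of
  \<open>v i\<close> and x is \<open>x i\<close>, and Cauchy-Schwarz bounds \<open>(x i)^2\<close>
  by the form at \<open>v i\<close> times the form at x. No spectral decomposition is
  involved.\<close>

lemma psd_coercive:
  assumes sym: "\<And>i j. i < k \<Longrightarrow> j < k \<Longrightarrow> A i j = A j i"
    and psd: "\<And>x. quad_form k A x \<ge> 0"
    and det: "Determinant.det (Matrix.mat k k (\<lambda>(i, j). A i j)) \<noteq> 0"
  obtains C where "C > 0" "\<And>x i. i < k \<Longrightarrow> (x i)\<^sup>2 \<le> C * quad_form k A x"
proof -
  let ?A = "Matrix.mat k k (\<lambda>(i, j). A i j)"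
  have "?A \<in> Units (ring_mat TYPE(real) k ())"
    using det by (intro det_non_zero_imp_unit) auto
  then obtain B where B: "B \<in> carrier_mat k k" "B * ?A = 1\<^sub>m k"
    by (auto simp: Units_def ring_mat_def)
  define v where "v i = (\<lambda>l. B $$ (i, l))" for i
  have BA: "(\<Sum>l<k. B $$ (i, l) * A l j) = (if i = j then 1 else 0)" if "i < k" "j < k" for i j
  proof -
    have "(B * ?A) $$ (i, j) = (\<Sum>l<k. B $$ (i, l) * A l j)"
      using B(1) that by (auto simp: scalar_prod_def atLeast0LessThan intro!: sum.cong)
    then show ?thesis using that by (simp add: B(2))
  qed
  define C where "C = 1 + (\<Sum>i<k. quad_form k A (v i))"
  have "(x i)\<^sup>2 \<le> C * quad_form k A x" if i: "i < k" for x i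
  proof -
    have "bilinear_form k A (v i) x = (\<Sum>j<k. \<Sum>l<k. A l j * B $$ (i, l) * x j)"
      unfolding bilinear_form_def v_def by (rule sum.swap)
    also have "\<dots> = (\<Sum>j<k. (\<Sum>l<k. B $$ (i, l) * A l j) * x j)"
      by (simp add: sum_distrib_left sum_distrib_right mult_ac)
    also have "\<dots> = (\<Sum>j<k. (if i = j then 1 else 0) * x j)"
      by (rule sum.cong) (use BA[OF i] in auto)
    also have "\<dots> = x i" using i by (simp add: if_distrib[of "\<lambda>a. a * _"] cong: if_cong)
    finally have "(x i)\<^sup>2 \<le> quad_form k A (v i) * quad_form k A x"
      using psd_Cauchy_Schwarz[of k A "v i" x, OF sym psd] by simp
    also have "quad_form k A (v i) \<le> C"
      unfolding C_def using member_le_sum[of i "{..<k}" "\<lambda>i. quad_form k A (v i)"] psd i by simp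
    finally show ?thesis using psd by (simp add: mult_right_mono)
  qed
  moreover have "C > 0" unfolding C_def using psd by (simp add: sum_nonneg add_pos_nonneg)
  ultimately show ?thesis using that by blast
qed

text \<open>The threshold is 2 because the deficit is half the form to second order. The
  corresponding ball has radius sqrt 2, which turns \<open>pi powr (k / 2)\<close> into
  \<open>(2 * pi) powr (k / 2)\<close>.\<close>

lemma emeasure_ellipsoid_pd:
  assumes sym: "\<And>i j. i < k \<Longrightarrow> j < k \<Longrightarrow> A i j = A j i"
    and pos: "\<And>x. (\<exists>i<k. x i \<noteq> 0) \<Longrightarrow> quad_form k A x > 0"
  defines "d \<equiv> Determinant.det (Matrix.mat k k (\<lambda>(i, j). A i j))"
  shows "d > 0" and "emeasure (PiM {..<k} (\<lambda>_. lborel)) {x\<in>space (PiM {..<k} (\<lambda>_. lborel)). quad_form k A x \<le> 2} =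
    ennreal ((2 * pi) powr (real k / 2) / Gamma (real k / 2 + 1) / sqrt d)"
proof -
  let ?L = "PiM {..<k} (\<lambda>_. lborel :: real measure)"
  have setsPiL [measurable_cong]: "sets ?L = sets (PiM {..<k} (\<lambda>_. borel :: real measure))"
    by (rule sets_PiM_cong) auto
  have "(indicator {..2} :: real \<Rightarrow> ennreal) \<in> borel_measurable borel" by simp
  from nn_integral_quad_form[OF this sym pos]
  have d: "d > 0" and eq: "ennreal (sqrt d) * (\<integral>\<^sup>+x. indicator {..2} (quad_form k A x) \<partial>?L) =
    (\<integral>\<^sup>+x. indicator {..2} (\<Sum>i<k. (x i)\<^sup>2) \<partial>?L)"
    unfolding d_def by auto
  show "d > 0" by (fact d)
  have qm [measurable]: "quad_form k A \<in> borel_measurable (PiM {..<k} (\<lambda>_. borel))" by measurable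
  have "(\<integral>\<^sup>+x. indicator {..2} (\<Sum>i<k. (x i)\<^sup>2) \<partial>?L) =
        (\<integral>\<^sup>+x. indicator ({f. sqrt (\<Sum>i\<in>{..<k}. (f i)\<^sup>2) \<le> sqrt 2} \<inter> space ?L) x \<partial>?L)"
    by (rule nn_integral_cong) (auto simp: indicator_def)
  also have "\<dots> = emeasure ?L ({f. sqrt (\<Sum>i\<in>{..<k}. (f i)\<^sup>2) \<le> sqrt 2} \<inter> space ?L)"
    by (rule nn_integral_indicator) measurable
  also have "\<dots> = ennreal (unit_ball_vol (real k) * sqrt 2 ^ k)"
    by (subst emeasure_cball_aux) auto
  also have "unit_ball_vol (real k) * sqrt 2 ^ k = (2 * pi) powr (real k / 2) / Gamma (real k / 2 + 1)"
  proof -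
    have "sqrt 2 ^ k = 2 powr (real k / 2)"
      by (simp add: powr_half_sqrt[symmetric] powr_power)
    then show ?thesis by (simp add: unit_ball_vol_def powr_mult)
  qed
  finally have eq2: "(\<integral>\<^sup>+x. indicator {..2} (\<Sum>i<k. (x i)\<^sup>2) \<partial>?L) = ennreal ((2 * pi) powr (real k / 2) / Gamma (real k / 2 + 1))" .
  have "(\<integral>\<^sup>+x. indicator {..2} (quad_form k A x) \<partial>?L) = (\<integral>\<^sup>+x. indicator {x\<in>space ?L. quad_form k A x \<le> 2} x \<partial>?L)"
    by (rule nn_integral_cong) (auto simp: indicator_def)
  also have "\<dots> = emeasure ?L {x\<in>space ?L. quad_form k A x \<le> 2}"
    by (rule nn_integral_indicator) measurable
  finally have eq3: "ennreal (sqrt d) * emeasure ?L {x\<in>space ?L. quad_form k A x \<le> 2} = ennreal ((2 * pi) powr (real k / 2) / Gamma (real k / 2 + 1))"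
    using eq eq2 by simp
  have "ennreal (1 / sqrt d) * (ennreal (sqrt d) * emeasure ?L {x\<in>space ?L. quad_form k A x \<le> 2}) = emeasure ?L {x\<in>space ?L. quad_form k A x \<le> 2}"
    using d by (simp add: mult.assoc[symmetric] ennreal_mult[symmetric])
  then show "emeasure ?L {x\<in>space ?L. quad_form k A x \<le> 2} =
    ennreal ((2 * pi) powr (real k / 2) / Gamma (real k / 2 + 1) / sqrt d)"
    unfolding eq3 using d by (simp add: ennreal_mult[symmetric] Gamma_real_pos mult.commute)
qed

text \<open>In the singular case a multiple of the identity is added: the ellipsoids of
  \<open>B \<epsilon>\<close> lie inside the given region and have volume
  \<open>?c / sqrt (D \<epsilon>)\<close>, where \<open>D \<epsilon>\<close> tends to 0. So the
  volume is infinite, as is the quotient by zero on the right.\<close>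

lemma emeasure_ellipsoid_psd:
  assumes sym: "\<And>i j. i < k \<Longrightarrow> j < k \<Longrightarrow> A i j = A j i"
    and psd: "\<And>x. quad_form k A x \<ge> 0"
  defines "d \<equiv> Determinant.det (Matrix.mat k k (\<lambda>(i, j). A i j))"
  shows "d \<ge> 0" and "emeasure (PiM {..<k} (\<lambda>_. lborel)) {x\<in>space (PiM {..<k} (\<lambda>_. lborel)). quad_form k A x \<le> 2} =
    ennreal ((2 * pi) powr (real k / 2) / Gamma (real k / 2 + 1)) / ennreal (sqrt d)"
proof -
  let ?L = "PiM {..<k} (\<lambda>_. lborel :: real measure)"
  let ?V = "emeasure ?L {x\<in>space ?L. quad_form k A x \<le> 2}"
  let ?c = "(2 * pi) powr (real k / 2) / Gamma (real k / 2 + 1)"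
  have G: "Gamma (real k / 2 + 1) > 0" by (intro Gamma_real_pos add_nonneg_pos) auto
  from less_imp_neq[OF this] have G0: "Gamma (real k / 2 + 1) \<noteq> 0" by (rule not_sym)
  have c: "?c > 0" by (intro divide_pos_pos G) simp
  have "d \<ge> 0 \<and> ?V = ennreal ?c / ennreal (sqrt d)"
  proof (cases "d = 0")
    case False
    then obtain C where C: "C > 0" "\<And>x i. i < k \<Longrightarrow> (x i)\<^sup>2 \<le> C * quad_form k A x"
      using psd_coercive[OF sym psd] unfolding d_def by metis
    have pd: "quad_form k A x > 0" if ex: "\<exists>i<k. x i \<noteq> 0" for x
    proof -
      obtain i where "i < k" "x i \<noteq> 0" using ex by auto
      then have "0 < C * quad_form k A x" using C(2)[of i x] by (smt (verit) zero_less_power2)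
      then show ?thesis using C(1) by (simp add: zero_less_mult_iff)
    qed
    have "d > 0" "?V = ennreal (?c / sqrt d)"
      using emeasure_ellipsoid_pd[OF sym pd] unfolding d_def by auto
    then show ?thesis using c by (simp add: divide_ennreal)
  next
    case True
    define B where "B \<epsilon> = (\<lambda>i j. A i j + (if i = j then \<epsilon> else 0))" for \<epsilon>
    define D where "D \<epsilon> = Determinant.det (Matrix.mat k k (\<lambda>(i, j). B \<epsilon> i j))" for \<epsilon>
    have Q: "quad_form k (B \<epsilon>) x = quad_form k A x + \<epsilon> * (\<Sum>i<k. (x i)\<^sup>2)" for \<epsilon> x
    proof -
      have "(\<Sum>j<k. B \<epsilon> i j * x i * x j) = (\<Sum>j<k. A i j * x i * x j) + \<epsilon> * (x i)\<^sup>2" if "i < k" for i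
      proof -
        have "(\<Sum>j<k. B \<epsilon> i j * x i * x j) = (\<Sum>j<k. A i j * x i * x j + (if i = j then \<epsilon> * x i * x j else 0))"
          by (rule sum.cong) (auto simp: B_def algebra_simps)
        then show ?thesis using that by (simp add: sum.distrib power2_eq_square)
      qed
      then show ?thesis by (simp add: quad_form_def sum.distrib sum_distrib_left)
    qed
    have pd: "quad_form k (B \<epsilon>) x > 0" if eps: "\<epsilon> > 0" and ex: "\<exists>i<k. x i \<noteq> 0" for \<epsilon> x
    proof -
      obtain i where "i < k" "x i \<noteq> 0" using ex by auto
      then have "(\<Sum>i<k. (x i)\<^sup>2) > 0" by (intro sum_pos2[of _ i]) auto
      then show ?thesis using psd[of x] eps unfolding Q by (simp add: add_nonneg_pos)
    qed
    have Bsym: "B \<epsilon> i j = B \<epsilon> j i" if "i < k" "j < k" for \<epsilon> i j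
      using sym[OF that] by (simp add: B_def)
    have low: "ennreal (?c / sqrt (D \<epsilon>)) \<le> ?V" "D \<epsilon> > 0" if "\<epsilon> > 0" for \<epsilon>
    proof -
      have setsPiL [measurable_cong]: "sets ?L = sets (PiM {..<k} (\<lambda>_. borel :: real measure))"
        by (rule sets_PiM_cong) auto
      have qm [measurable]: "quad_form k A \<in> borel_measurable (PiM {..<k} (\<lambda>_. borel))" by measurable
      have "emeasure ?L {x\<in>space ?L. quad_form k (B \<epsilon>) x \<le> 2} \<le> ?V"
      proof (rule emeasure_mono)
        show "{x\<in>space ?L. quad_form k (B \<epsilon>) x \<le> 2} \<subseteq> {x\<in>space ?L. quad_form k A x \<le> 2}"
          unfolding Q using that by (auto intro: order_trans[rotated] simp: sum_nonneg)
      qed measurable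
      then show "ennreal (?c / sqrt (D \<epsilon>)) \<le> ?V" "D \<epsilon> > 0"
        using emeasure_ellipsoid_pd[OF Bsym pd[OF that]] unfolding D_def by auto
    qed
    \<comment> \<open>The Leibniz formula makes the determinant a polynomial in the entries, hence
      continuous in \<epsilon>.\<close>
    have lim: "((\<lambda>\<epsilon>. sqrt (D \<epsilon>)) \<longlongrightarrow> sqrt d) (at_right 0)"
    proof -
      have "((\<lambda>\<epsilon>. B \<epsilon> i j) \<longlongrightarrow> A i j) (at_right 0)" for i j
        by (cases "i = j") (auto simp: B_def intro!: tendsto_eq_intros)
      then have "((\<lambda>\<epsilon>. \<Sum>p | p permutes {0..<k}. signof p * (\<Prod>i = 0..<k. B \<epsilon> i (p i))) \<longlongrightarrow>
          (\<Sum>p | p permutes {0..<k}. signof p * (\<Prod>i = 0..<k. A i (p i)))) (at_right 0)"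
        by (intro tendsto_sum tendsto_mult tendsto_const tendsto_prod)
      moreover have "Determinant.det (Matrix.mat k k (\<lambda>(i, j). F i j)) = (\<Sum>p | p permutes {0..<k}. signof p * (\<Prod>i = 0..<k. F i (p i)))"
        for F :: "nat \<Rightarrow> nat \<Rightarrow> real"
      proof -
        have "(\<Prod>i = 0..<k. Matrix.mat k k (\<lambda>(i, j). F i j) $$ (i, p i)) = (\<Prod>i = 0..<k. F i (p i))"
          if perm: "p permutes {0..<k}" for p
          using permutes_in_image[OF perm] by (intro prod.cong) auto
        then show ?thesis by (subst det_def'[of _ k]) auto
      qed
      ultimately have "(D \<longlongrightarrow> d) (at_right 0)" by (simp add: D_def[abs_def] d_def)
      then show ?thesis by (rule tendsto_real_sqrt)
    qed
    have "?V = \<infinity>"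
    proof (rule ccontr)
      assume "?V \<noteq> \<infinity>"
      then obtain r where r: "?V = ennreal r" "r \<ge> 0" by (cases ?V) auto
      have "eventually (\<lambda>\<epsilon>. ?c \<le> r * sqrt (D \<epsilon>)) (at_right 0)"
        using eventually_at_right_less
      proof (rule eventually_mono)
        fix \<epsilon> :: real assume "0 < \<epsilon>"
        then show "?c \<le> r * sqrt (D \<epsilon>)" using low[of \<epsilon>] r by (simp add: field_simps)
      qed
      then have "?c \<le> r * sqrt d"
        by (intro tendsto_le[OF _ tendsto_mult[OF tendsto_const lim] tendsto_const]) auto
      then show False using c True by simp
    qed
    then show ?thesis using c True G0 by auto
  qed
  then show "d \<ge> 0" "?V = ennreal ?c / ennreal (sqrt d)" by auto
qed

section \<open>Reduction of angles modulo 2 pi and integration over one period\<close>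

definition circ :: "real \<Rightarrow> real" where
  "circ x = x - 2 * pi * of_int \<lfloor>x / (2 * pi)\<rfloor>"

lemma circ_bounds: "0 \<le> circ x" "circ x < 2 * pi"
  using floor_divide_lower[of "2 * pi" x] floor_divide_upper[of "2 * pi" x]
  by (simp_all add: circ_def algebra_simps)

lemma circ_shift [simp]: "circ (x + 2 * pi * of_int n) = circ x" "circ (x - 2 * pi * of_int n) = circ x"
proof -
  have *: "circ (x + 2 * pi * of_int n) = circ x" for x and n :: int
  proof -
    have "(x + 2 * pi * of_int n) / (2 * pi) = x / (2 * pi) + of_int n" by (simp add: add_divide_distrib)
    then show ?thesis by (simp add: circ_def algebra_simps)
  qed
  show "circ (x + 2 * pi * of_int n) = circ x" by (fact *)
  show "circ (x - 2 * pi * of_int n) = circ x" using *[of x "- n"] by simp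
qed

lemma circ_eq: "0 \<le> x \<Longrightarrow> x < 2 * pi \<Longrightarrow> circ x = x"
  by (simp add: circ_def floor_eq_iff)

lemma measurable_circ [measurable]: "circ \<in> borel_measurable borel"
  unfolding circ_def by measurable

lemma periodic_shift_int:
  fixes f :: "real \<Rightarrow> 'a"
  assumes "\<And>x. f (x + 2 * pi) = f x"
  shows "f (x + 2 * pi * of_int n) = f x"
proof (induction n arbitrary: x rule: int_induct[where k = 0])
  case (step1 i)
  have "f (x + 2 * pi * of_int (i + 1)) = f ((x + 2 * pi * of_int i) + 2 * pi)" by (simp add: algebra_simps)
  then show ?case using step1 assms by simp
next
  case (step2 i)
  have "f (x + 2 * pi * of_int (i - 1)) = f ((x + 2 * pi * of_int (i - 1)) + 2 * pi)" by (simp add: assms)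
  also have "\<dots> = f (x + 2 * pi * of_int i)" by (simp add: algebra_simps)
  finally show ?case using step2 by simp
qed simp

lemma nn_integral_translate:
  fixes f :: "real \<Rightarrow> ennreal"
  assumes "f \<in> borel_measurable borel"
  shows "(\<integral>\<^sup>+x. f x \<partial>lborel) = (\<integral>\<^sup>+y. f (t + y) \<partial>lborel)"
  using nn_integral_lborel_scale[OF assms, of 1 t] by simp

text \<open>The interval is translated by a multiple of 2 pi so that it starts at
  \<open>circ c\<close>; what then sticks out beyond 2 pi is moved back to the front.\<close>

lemma nn_integral_period:
  fixes f :: "real \<Rightarrow> ennreal"
  assumes f [measurable]: "f \<in> borel_measurable borel" and per: "\<And>x. f (x + 2 * pi) = f x"
  shows "(\<integral>\<^sup>+x. f x * indicator {c..<c + 2 * pi} x \<partial>lborel) = (\<integral>\<^sup>+x. f x * indicator {0..<2 * pi} x \<partial>lborel)"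
proof -
  define d where "d = circ c"
  have d: "0 \<le> d" "d < 2 * pi" "c = d + 2 * pi * of_int \<lfloor>c / (2 * pi)\<rfloor>"
    using circ_bounds by (auto simp: d_def circ_def)
  let ?n = "2 * pi * of_int \<lfloor>c / (2 * pi)\<rfloor> :: real"
  have "(\<integral>\<^sup>+x. f x * indicator {c..<c + 2 * pi} x \<partial>lborel) = (\<integral>\<^sup>+y. f (?n + y) * indicator {c..<c + 2 * pi} (?n + y) \<partial>lborel)"
    by (rule nn_integral_translate) measurable
  also have "\<dots> = (\<integral>\<^sup>+y. f y * indicator {d..<d + 2 * pi} y \<partial>lborel)"
  proof (rule nn_integral_cong)
    fix y
    have "f (?n + y) = f y" using periodic_shift_int[of f y, OF per] by (simp add: add.commute)
    moreover have "indicator {c..<c + 2 * pi} (?n + y) = (indicator {d..<d + 2 * pi} y :: ennreal)"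
      by (subst (1 2) d(3)) (auto simp: indicator_def)
    ultimately show "f (?n + y) * indicator {c..<c + 2 * pi} (?n + y) = f y * indicator {d..<d + 2 * pi} y" by simp
  qed
  also have "\<dots> = (\<integral>\<^sup>+y. f y * indicator {d..<2 * pi} y + f y * indicator {2 * pi..<d + 2 * pi} y \<partial>lborel)"
    by (rule nn_integral_cong) (use d in \<open>auto simp: indicator_def\<close>)
  also have "\<dots> = (\<integral>\<^sup>+y. f y * indicator {d..<2 * pi} y \<partial>lborel) + (\<integral>\<^sup>+y. f y * indicator {2 * pi..<d + 2 * pi} y \<partial>lborel)"
    by (rule nn_integral_add) measurable
  also have "(\<integral>\<^sup>+y. f y * indicator {2 * pi..<d + 2 * pi} y \<partial>lborel) = (\<integral>\<^sup>+y. f (2 * pi + y) * indicator {2 * pi..<d + 2 * pi} (2 * pi + y) \<partial>lborel)"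
    by (rule nn_integral_translate) measurable
  also have "\<dots> = (\<integral>\<^sup>+y. f y * indicator {0..<d} y \<partial>lborel)"
    by (rule nn_integral_cong) (use per in \<open>auto simp: indicator_def add.commute\<close>)
  also have "(\<integral>\<^sup>+y. f y * indicator {d..<2 * pi} y \<partial>lborel) + \<dots> = (\<integral>\<^sup>+y. f y * indicator {d..<2 * pi} y + f y * indicator {0..<d} y \<partial>lborel)"
    by (rule nn_integral_add[symmetric]) measurable
  also have "\<dots> = (\<integral>\<^sup>+x. f x * indicator {0..<2 * pi} x \<partial>lborel)"
    by (rule nn_integral_cong) (use d in \<open>auto simp: indicator_def\<close>)
  finally show ?thesis .
qed

definition circ_measure :: "(real \<Rightarrow> real) \<Rightarrow> real measure" where
  "circ_measure p = density lborel (\<lambda>x. ennreal (p x * indicator {0..<2 * pi} x))"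

lemma sets_circ_measure [simp, measurable_cong]: "sets (circ_measure p) = sets borel"
  by (simp add: circ_measure_def)

text \<open>A chart of the circle around an arbitrary base c at scale s. The window
  \<open>{-pi..<pi}\<close> is centred at the base, so small deviations of either sign are never cut
  off, wherever c lies in the period.\<close>

lemma nn_integral_circ_measure:
  fixes f :: "real \<Rightarrow> ennreal"
  assumes f [measurable]: "f \<in> borel_measurable borel" and p [measurable]: "p \<in> borel_measurable borel"
    and per: "\<And>x. p (x + 2 * pi) = p x" and nonneg: "\<And>x. p x \<ge> 0" and s: "s > 0"
  shows "(\<integral>\<^sup>+x. f x \<partial>circ_measure p) =
    (\<integral>\<^sup>+y. f (circ (c + s * y)) * (ennreal (s * p (c + s * y)) * indicator {-pi..<pi} (s * y)) \<partial>lborel)"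
proof -
  have "(\<integral>\<^sup>+x. f x \<partial>circ_measure p) = (\<integral>\<^sup>+x. ennreal (p x * indicator {0..<2 * pi} x) * f x \<partial>lborel)"
    unfolding circ_measure_def by (rule nn_integral_density) measurable
  also have "\<dots> = (\<integral>\<^sup>+x. (f (circ x) * ennreal (p x)) * indicator {0..<2 * pi} x \<partial>lborel)"
    by (rule nn_integral_cong) (auto simp: indicator_def circ_eq mult.commute)
  also have "\<dots> = (\<integral>\<^sup>+x. (f (circ x) * ennreal (p x)) * indicator {c - pi..<c - pi + 2 * pi} x \<partial>lborel)"
    using circ_shift(1)[of _ 1] by (intro nn_integral_period[symmetric]) (auto simp: per)
  also have "\<dots> = (\<integral>\<^sup>+y. (f (circ (c + s * y)) * ennreal (p (c + s * y))) * indicator {c - pi..<c - pi + 2 * pi} (c + s * y) * ennreal s \<partial>lborel)"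
    using s by (intro nn_integral_lborel_scale) auto
  also have "\<dots> = (\<integral>\<^sup>+y. f (circ (c + s * y)) * (ennreal (s * p (c + s * y)) * indicator {-pi..<pi} (s * y)) \<partial>lborel)"
    using s nonneg by (intro nn_integral_cong) (auto simp: indicator_def ennreal_mult mult_ac)
  finally show ?thesis .
qed

section \<open>Poisson approximation\<close>

lemma (in prob_space) expectation_nat_valued:
  fixes W :: "'a \<Rightarrow> nat" and h :: "nat \<Rightarrow> real"
  assumes W [measurable]: "W \<in> M \<rightarrow>\<^sub>M count_space UNIV"
    and le: "\<And>\<omega>. \<omega> \<in> space M \<Longrightarrow> W \<omega> \<le> N"
  shows "expectation (\<lambda>\<omega>. h (W \<omega>)) = (\<Sum>k\<le>N. h k * prob {\<omega>\<in>space M. W \<omega> = k})"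
proof -
  have "expectation (\<lambda>\<omega>. h (W \<omega>)) = expectation (\<lambda>\<omega>. \<Sum>k\<le>N. h k * indicat_real {\<omega>\<in>space M. W \<omega> = k} \<omega>)"
  proof (rule Bochner_Integration.integral_cong[OF refl])
    fix \<omega> assume w: "\<omega> \<in> space M"
    have "(\<Sum>k\<le>N. h k * indicat_real {\<omega>\<in>space M. W \<omega> = k} \<omega>) = (\<Sum>k\<le>N. if k = W \<omega> then h k else 0)"
      by (rule sum.cong) (auto simp: w)
    also have "\<dots> = h (W \<omega>)"
      using le[OF w] by simp
    finally show "h (W \<omega>) = (\<Sum>k\<le>N. h k * indicat_real {\<omega>\<in>space M. W \<omega> = k} \<omega>)" ..
  qed
  also have "\<dots> = (\<Sum>k\<le>N. h k * prob {\<omega>\<in>space M. W \<omega> = k})"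
    using W by (subst Bochner_Integration.integral_sum) (auto intro!: sum.cong integrable_mult_right integrable_real_indicator simp: emeasure_eq_measure)
  finally show ?thesis .
qed

text \<open>Integrating factor \<open>exp (- \<mu> * u)\<close> and the mean value theorem. As the
  factor is at most 1 on the interval, the error does not grow with \<mu>.\<close>

lemma exp_perturbed_ode:
  fixes \<phi> \<phi>' :: "real \<Rightarrow> real"
  assumes der: "\<And>u. 0 \<le> u \<Longrightarrow> u \<le> 1 \<Longrightarrow> (\<phi> has_real_derivative \<phi>' u) (at u)"
    and bnd: "\<And>u. 0 \<le> u \<Longrightarrow> u \<le> 1 \<Longrightarrow> \<bar>\<phi>' u - \<mu> * \<phi> u\<bar> \<le> \<epsilon>"
    and "\<mu> \<ge> 0"
  shows "\<bar>exp (- \<mu>) * \<phi> 1 - \<phi> 0\<bar> \<le> \<epsilon>"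
proof -
  define \<psi> where "\<psi> u = exp (- \<mu> * u) * \<phi> u" for u
  have "DERIV \<psi> u :> exp (- \<mu> * u) * (\<phi>' u - \<mu> * \<phi> u)" if "0 \<le> u" "u \<le> 1" for u
    unfolding \<psi>_def using der[OF that] by (auto intro!: derivative_eq_intros simp: algebra_simps)
  from MVT2[of 0 1, OF _ this] obtain z where z: "0 < z" "z < 1"
    and eq: "\<psi> 1 - \<psi> 0 = (1 - 0) * (exp (- \<mu> * z) * (\<phi>' z - \<mu> * \<phi> z))"
    by auto
  have "\<bar>\<psi> 1 - \<psi> 0\<bar> = exp (- \<mu> * z) * \<bar>\<phi>' z - \<mu> * \<phi> z\<bar>"
    by (simp add: eq abs_mult)
  also have "\<dots> \<le> 1 * \<epsilon>"
    using z bnd[of z] \<open>\<mu> \<ge> 0\<close> by (intro mult_mono) auto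
  finally show ?thesis by (simp add: \<psi>_def)
qed

text \<open>The generating function \<open>\<phi> u = E[u ^ W]\<close> of the number \<open>W\<close> of occurring events satisfies
  \<open>\<phi>' \<approx> \<mu> \<phi>\<close> on \<open>[0, 1]\<close> up to the Chen--Stein error terms, and \<open>\<phi> 0\<close> is the probability in question.\<close>
lemma (in prob_space) poisson_approx_none:
  fixes A :: "'i \<Rightarrow> 'a set" and D :: "'i \<Rightarrow> 'i set"
  assumes fin: "finite I"
    and A [measurable]: "\<And>i. i \<in> I \<Longrightarrow> A i \<in> events"
    and D: "\<And>i. i \<in> I \<Longrightarrow> D i \<subseteq> I - {i}"
    and indep: "\<And>i (u::real). i \<in> I \<Longrightarrow>
       expectation (\<lambda>\<omega>. indicat_real (A i) \<omega> * u ^ card {j\<in>D i. \<omega> \<in> A j}) =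
       prob (A i) * expectation (\<lambda>\<omega>. u ^ card {j\<in>D i. \<omega> \<in> A j})"
  shows "\<bar>prob (space M - (\<Union>i\<in>I. A i)) - exp (- (\<Sum>i\<in>I. prob (A i)))\<bar> \<le>
    (\<Sum>i\<in>I. prob (A i \<inter> (\<Union>j\<in>I - D i - {i}. A j)) + prob (A i) * prob (\<Union>j\<in>I - D i. A j))"
    (is "_ \<le> (\<Sum>i\<in>I. ?e i)")
proof -
  define W where "W \<omega> = card {j\<in>I. \<omega> \<in> A j}" for \<omega>
  define V where "V i \<omega> = card {j\<in>D i. \<omega> \<in> A j}" for i \<omega>
  have card_eq: "card {j\<in>J. \<omega> \<in> A j} = (\<Sum>j\<in>J. if \<omega> \<in> A j then 1 else 0)" if "J \<subseteq> I" for J \<omega>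
    using finite_subset[OF that fin] by (simp add: sum.If_cases Int_def)
  have Wm [measurable]: "W \<in> M \<rightarrow>\<^sub>M count_space UNIV"
    unfolding W_def card_eq[OF order_refl] by measurable
  have Vm [measurable]: "V i \<in> M \<rightarrow>\<^sub>M count_space UNIV" if "i \<in> I" for i
  proof -
    have *: "D i \<subseteq> I" using D[OF that] by auto
    have [measurable]: "\<And>j. j \<in> D i \<Longrightarrow> A j \<in> events" using * by auto
    show ?thesis unfolding V_def card_eq[OF *] by measurable
  qed
  have W_le: "W \<omega> \<le> card I" for \<omega>
    unfolding W_def by (intro card_mono fin) auto
  have V_le: "V i \<omega> \<le> W \<omega>" if "i \<in> I" for i \<omega>
    unfolding W_def V_def using D[OF that] fin by (intro card_mono) auto
  define \<phi> where "\<phi> u = (\<Sum>k\<le>card I. u ^ k * prob {\<omega>\<in>space M. W \<omega> = k})" for u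
  define \<phi>' where "\<phi>' u = (\<Sum>k\<le>card I. (of_nat k * u ^ (k - 1)) * prob {\<omega>\<in>space M. W \<omega> = k})" for u
  have \<phi>_eq: "\<phi> u = expectation (\<lambda>\<omega>. u ^ W \<omega>)" for u
    unfolding \<phi>_def by (rule expectation_nat_valued[symmetric]) (use W_le in auto)
  have \<phi>'_eq: "\<phi>' u = expectation (\<lambda>\<omega>. of_nat (W \<omega>) * u ^ (W \<omega> - 1))" for u
    unfolding \<phi>'_def by (rule expectation_nat_valued[symmetric]) (use W_le in auto)
  have der: "(\<phi> has_real_derivative \<phi>' u) (at u)" for u
    unfolding \<phi>_def \<phi>'_def by (auto intro!: derivative_eq_intros)
  have int: "integrable M (\<lambda>\<omega>. f \<omega> :: real)"
    if "f \<in> borel_measurable M" "\<And>\<omega>. \<omega> \<in> space M \<Longrightarrow> \<bar>f \<omega>\<bar> \<le> 1" for f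
    using that by (intro integrable_const_bound[where B = 1]) auto
  define \<mu> where "\<mu> = (\<Sum>i\<in>I. prob (A i))"
  have bnd: "\<bar>\<phi>' u - \<mu> * \<phi> u\<bar> \<le> (\<Sum>i\<in>I. ?e i)" if u: "0 \<le> u" "u \<le> 1" for u
  proof -
    have pw: "\<bar>u ^ n\<bar> \<le> 1" for n using u by (simp add: power_le_one)
    have dif: "\<bar>u ^ n - u ^ k\<bar> \<le> 1" for n k
      using u zero_le_power[of u n] zero_le_power[of u k] power_le_one[of u n] power_le_one[of u k]
      by linarith
    have ind_pw: "\<bar>indicat_real (A i) \<omega> * u ^ n\<bar> \<le> 1" for i \<omega> n
      using pw[of n] by (auto simp: indicator_def)
    \<comment> \<open>Each occurring event contributes one summand, so the derivative becomes a sum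
      over indices to which the independence hypothesis can be applied.\<close>
    have "of_nat (W \<omega>) * u ^ (W \<omega> - 1) = (\<Sum>i\<in>I. indicat_real (A i) \<omega> * u ^ (W \<omega> - 1))" for \<omega>
    proof -
      have "of_nat (W \<omega>) = (\<Sum>i\<in>I. indicat_real (A i) \<omega>)"
        unfolding W_def card_eq[OF order_refl] by (auto intro!: sum.cong)
      then show ?thesis by (simp add: sum_distrib_right)
    qed
    then have "\<phi>' u = (\<Sum>i\<in>I. expectation (\<lambda>\<omega>. indicat_real (A i) \<omega> * u ^ (W \<omega> - 1)))"
      unfolding \<phi>'_eq using ind_pw by (simp, subst Bochner_Integration.integral_sum) (auto intro!: int)
    then have "\<bar>\<phi>' u - \<mu> * \<phi> u\<bar> = \<bar>\<Sum>i\<in>I. expectation (\<lambda>\<omega>. indicat_real (A i) \<omega> * u ^ (W \<omega> - 1)) - prob (A i) * \<phi> u\<bar>"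
      by (simp add: \<mu>_def sum_distrib_right sum_subtractf)
    also have "\<dots> \<le> (\<Sum>i\<in>I. \<bar>expectation (\<lambda>\<omega>. indicat_real (A i) \<omega> * u ^ (W \<omega> - 1)) - prob (A i) * \<phi> u\<bar>)"
      by (rule sum_abs)
    also have "\<dots> \<le> (\<Sum>i\<in>I. ?e i)"
    proof (rule sum_mono)
      fix i assume i: "i \<in> I"
      \<comment> \<open>On B the event \<open>A i\<close> is accompanied by another one with index
        outside \<open>D i\<close>; on C some event with index outside \<open>D i\<close>, possibly
        \<open>A i\<close>, occurs. Hence on \<open>A i\<close> the count \<open>V i\<close>
        replaces \<open>W - 1\<close> at the cost of prob B, and it turns back into W at the cost of
        prob C, with independence used in between.\<close>
      define B where "B = A i \<inter> (\<Union>j\<in>I - D i - {i}. A j)"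
      define C where "C = (\<Union>j\<in>I - D i. A j)"
      have [measurable]: "B \<in> events" "C \<in> events" "A i \<in> events"
        unfolding B_def C_def using i fin by (auto intro!: sets.finite_UN sets.Int)
      have C: "W \<omega> = V i \<omega>" if "\<omega> \<notin> C" for \<omega>
        unfolding W_def V_def using that D[OF i] by (intro arg_cong[of _ _ card]) (auto simp: C_def)
      have B: "W \<omega> - 1 = V i \<omega>" if "\<omega> \<in> A i" "\<omega> \<notin> B" for \<omega>
      proof -
        have "{j\<in>I. \<omega> \<in> A j} = insert i {j\<in>D i. \<omega> \<in> A j}"
          using that D[OF i] i by (auto simp: B_def)
        moreover have "finite {j\<in>D i. \<omega> \<in> A j}" "i \<notin> {j\<in>D i. \<omega> \<in> A j}"
          using D[OF i] finite_subset[OF _ fin, of "{j\<in>D i. \<omega> \<in> A j}"] by auto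
        ultimately show ?thesis by (simp add: W_def V_def)
      qed
      have "\<bar>expectation (\<lambda>\<omega>. indicat_real (A i) \<omega> * u ^ (W \<omega> - 1)) -
             expectation (\<lambda>\<omega>. indicat_real (A i) \<omega> * u ^ V i \<omega>)\<bar> =
            \<bar>expectation (\<lambda>\<omega>. indicat_real (A i) \<omega> * u ^ (W \<omega> - 1) - indicat_real (A i) \<omega> * u ^ V i \<omega>)\<bar>"
        using ind_pw i by (subst Bochner_Integration.integral_diff) (auto intro!: int)
      also have "\<dots> \<le> expectation (\<lambda>\<omega>. \<bar>indicat_real (A i) \<omega> * u ^ (W \<omega> - 1) - indicat_real (A i) \<omega> * u ^ V i \<omega>\<bar>)"
        by (rule integral_abs_bound)
      also have "\<dots> \<le> expectation (indicat_real B)"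
      proof (rule integral_mono)
        show "\<bar>indicat_real (A i) \<omega> * u ^ (W \<omega> - 1) - indicat_real (A i) \<omega> * u ^ V i \<omega>\<bar> \<le> indicat_real B \<omega>"
          for \<omega> using B[of \<omega>] dif by (cases "\<omega> \<in> A i"; cases "\<omega> \<in> B") (auto simp: B_def)
      qed (use i dif in \<open>auto intro!: int simp: indicator_def\<close>)
      finally have 1: "\<bar>expectation (\<lambda>\<omega>. indicat_real (A i) \<omega> * u ^ (W \<omega> - 1)) -
             prob (A i) * expectation (\<lambda>\<omega>. u ^ V i \<omega>)\<bar> \<le> prob B"
        using indep[OF i, of u] by (simp add: V_def)
      have "\<bar>expectation (\<lambda>\<omega>. u ^ V i \<omega>) - \<phi> u\<bar> = \<bar>expectation (\<lambda>\<omega>. u ^ V i \<omega> - u ^ W \<omega>)\<bar>"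
        unfolding \<phi>_eq using pw i by (subst Bochner_Integration.integral_diff) (auto intro!: int)
      also have "\<dots> \<le> expectation (\<lambda>\<omega>. \<bar>u ^ V i \<omega> - u ^ W \<omega>\<bar>)"
        by (rule integral_abs_bound)
      also have "\<dots> \<le> expectation (indicat_real C)"
      proof (rule integral_mono)
        show "\<bar>u ^ V i \<omega> - u ^ W \<omega>\<bar> \<le> indicat_real C \<omega>" for \<omega>
          using C[of \<omega>] dif by (cases "\<omega> \<in> C") auto
      qed (use i dif in \<open>auto intro!: int\<close>)
      finally have 2: "\<bar>prob (A i) * expectation (\<lambda>\<omega>. u ^ V i \<omega>) - prob (A i) * \<phi> u\<bar> \<le> prob (A i) * prob C"
        by (simp add: right_diff_distrib[symmetric] abs_mult mult_left_mono)
      show "\<bar>expectation (\<lambda>\<omega>. indicat_real (A i) \<omega> * u ^ (W \<omega> - 1)) - prob (A i) * \<phi> u\<bar> \<le> ?e i"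
        using 1 2 by (simp add: B_def C_def)
    qed
    finally show ?thesis .
  qed
  have "\<phi> 1 = 1"
    unfolding \<phi>_eq by (simp add: prob_space)
  moreover have "\<phi> 0 = prob (space M - (\<Union>i\<in>I. A i))"
  proof -
    \<comment> \<open>Since \<open>0 ^ 0 = 1\<close>, evaluation at 0 keeps exactly the term k =
      0.\<close>
    have "\<phi> 0 = (\<Sum>k\<le>card I. if k = 0 then prob {\<omega>\<in>space M. W \<omega> = k} else 0)"
      unfolding \<phi>_def by (rule sum.cong) auto
    also have "\<dots> = prob {\<omega>\<in>space M. W \<omega> = 0}" by simp
    also have "{\<omega>\<in>space M. W \<omega> = 0} = space M - (\<Union>i\<in>I. A i)"
      using fin by (auto simp: W_def)
    finally show ?thesis .
  qed
  ultimately show ?thesis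
    using exp_perturbed_ode[of \<phi> \<phi>' \<mu> "\<Sum>i\<in>I. ?e i", OF der bnd]
    by (simp add: \<mu>_def sum_nonneg abs_minus_commute)
qed


text \<open>Union bound over the element shared with S; the rest of the set is chosen freely among
  the remaining elements.\<close>

lemma card_subsets_meeting:
  assumes "finite N" "S \<subseteq> N" "card S = m" "m > 0"
  shows "card {T. T \<subseteq> N \<and> card T = m \<and> T \<inter> S \<noteq> {}} \<le> m * (card N - 1 choose (m - 1))"
proof -
  let ?F = "\<lambda>c. insert c ` {T. T \<subseteq> N - {c} \<and> card T = m - 1}"
  have fin: "finite S" "finite T" if "T \<subseteq> N" for T
    using assms that finite_subset by auto
  have sub: "{T. T \<subseteq> N \<and> card T = m \<and> T \<inter> S \<noteq> {}} \<subseteq> (\<Union>c\<in>S. ?F c)"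
  proof
    fix T assume "T \<in> {T. T \<subseteq> N \<and> card T = m \<and> T \<inter> S \<noteq> {}}"
    then obtain x where T: "T \<subseteq> N" "card T = m" "x \<in> T" "x \<in> S" by auto
    then have "T = insert x (T - {x})" "T - {x} \<subseteq> N - {x}" "card (T - {x}) = m - 1"
      using fin[of T] by auto
    then show "T \<in> (\<Union>c\<in>S. ?F c)"
      using T by blast
  qed
  have card1: "card (?F c) \<le> (card N - 1 choose (m - 1))" if "c \<in> S" for c
  proof -
    have "card (?F c) \<le> card {T. T \<subseteq> N - {c} \<and> card T = m - 1}"
      by (rule card_image_le) (use assms in auto)
    also have "\<dots> = (card N - 1 choose (m - 1))"
      using assms that by (subst n_subsets) auto
    finally show ?thesis .
  qed
  have "card {T. T \<subseteq> N \<and> card T = m \<and> T \<inter> S \<noteq> {}} \<le> card (\<Union>c\<in>S. ?F c)"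
    using assms fin[of "{}"] by (intro card_mono[OF _ sub]) auto
  also have "\<dots> \<le> (\<Sum>c\<in>S. card (?F c))"
    using fin[of "{}"] by (intro card_UN_le) auto
  also have "\<dots> \<le> (\<Sum>c\<in>S. (card N - 1 choose (m - 1)))"
    by (rule sum_mono) (rule card1)
  finally show ?thesis using assms by simp
qed

text \<open>Two configurations sharing a point can occur together only if some point outside the first one
  is close, in the sense of \<open>N\<close>, to a point of it; this makes their contribution negligible.\<close>
lemma (in prob_space) no_close_tuple_approx:
  fixes X :: "nat \<Rightarrow> 'a \<Rightarrow> real" and E :: "(nat \<Rightarrow> real) set" and \<mu> :: "real measure" and m n :: nat
  defines "A \<equiv> \<lambda>S. {\<omega>\<in>space M. (\<lambda>i\<in>{..<m}. X (sorted_list_of_set S ! i) \<omega>) \<in> E}"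
  defines "I \<equiv> {S. S \<subseteq> {1..n} \<and> card S = m}"
  defines "q \<equiv> measure (PiM {..<m} (\<lambda>_. \<mu>)) E"
  assumes X: "indep_vars (\<lambda>_. borel) X {1..n}"
    and distr: "\<And>i. i \<in> {1..n} \<Longrightarrow> distr M borel (X i) = \<mu>"
    and E [measurable]: "E \<in> sets (PiM {..<m} (\<lambda>_. borel))"
    and N [measurable]: "N \<in> sets (borel \<Otimes>\<^sub>M borel)"
    and near: "\<And>x i j. x \<in> E \<Longrightarrow> i < m \<Longrightarrow> j < m \<Longrightarrow> (x i, x j) \<in> N"
    and \<kappa>: "\<And>a. measure \<mu> {b. (a, b) \<in> N} \<le> \<kappa>"
    and m: "0 < m"
  shows "\<bar>prob (space M - (\<Union>S\<in>I. A S)) - exp (- (real (n choose m) * q))\<bar> \<le>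
    real (n choose m) * q * (real m * real n * \<kappa>) +
    real (n choose m) * q * (real m * real ((n - 1) choose (m - 1)) * q)"
proof -
  have Xm [measurable]: "random_variable borel (X i)" if "i \<in> {1..n}" for i
    using X that by (auto simp: indep_vars_def)
  define \<nu> where "\<nu> = PiM {..<m} (\<lambda>_. \<mu>)"
  have finI: "finite I" unfolding I_def by simp
  have cardI: "card I = (n choose m)" unfolding I_def using n_subsets[of "{1..n}" m] by simp
  \<comment> \<open>The events are expressed through the coordinates in S, so that independence of
    disjoint blocks of the variables applies to them.\<close>
  define e where "e S = {f\<in>space (PiM S (\<lambda>_. borel)). (\<lambda>i\<in>{..<m}. f (sorted_list_of_set S ! i)) \<in> E}"
    for S :: "nat set"
  have nth: "sorted_list_of_set S ! i \<in> S" if "S \<in> I" "i < m" for S i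
  proof -
    have "finite S" "length (sorted_list_of_set S) = m"
      using that finite_subset[of S "{1..n}"] by (auto simp: I_def)
    then show ?thesis using that(2) set_sorted_list_of_set nth_mem by metis
  qed
  have ex_nth: "\<exists>i<m. sorted_list_of_set S ! i = c" if "S \<in> I" "c \<in> S" for S c
  proof -
    have *: "finite S" "length (sorted_list_of_set S) = m"
      using that finite_subset[of S "{1..n}"] by (auto simp: I_def)
    then have "c \<in> set (sorted_list_of_set S)" using that by simp
    then show ?thesis using *(2) unfolding in_set_conv_nth by auto
  qed
  have reidx: "(\<lambda>f. \<lambda>i\<in>{..<m}. f (sorted_list_of_set S ! i)) \<in> PiM S (\<lambda>_. borel) \<rightarrow>\<^sub>M PiM {..<m} (\<lambda>_. borel :: real measure)"
    if "S \<in> I" for S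
    using nth[OF that] by (intro measurable_restrict measurable_component_singleton) auto
  have e [measurable]: "e S \<in> sets (PiM S (\<lambda>_. borel))" if "S \<in> I" for S
    unfolding e_def using measurable_sets[OF reidx[OF that] E] by (simp add: vimage_def Int_def conj_commute)
  have A_eq: "A S = {\<omega>\<in>space M. (\<lambda>i\<in>S'. X i \<omega>) \<in> {f\<in>space (PiM S' (\<lambda>_. borel)). restrict f S \<in> e S}}"
    if "S \<in> I" "S \<subseteq> S'" for S S'
  proof -
    have "(\<lambda>i\<in>{..<m}. restrict (restrict (\<lambda>i. X i \<omega>) S') S (sorted_list_of_set S ! i)) =
          (\<lambda>i\<in>{..<m}. X (sorted_list_of_set S ! i) \<omega>)" for \<omega>
      using nth[OF that(1)] that(2) by (auto simp: restrict_def fun_eq_iff)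
    then show ?thesis by (simp add: A_def e_def space_PiM del: restrict_apply)
  qed
  have restr_m [measurable]: "(\<lambda>\<omega>. \<lambda>i\<in>S. X i \<omega>) \<in> M \<rightarrow>\<^sub>M PiM S (\<lambda>_. borel)" if "S \<subseteq> {1..n}" for S
    using that by (intro measurable_restrict) auto
  have A_eq1: "A S = (\<lambda>\<omega>. \<lambda>i\<in>S. X i \<omega>) -` e S \<inter> space M" if "S \<in> I" for S
    unfolding A_eq[OF that order_refl] by (auto simp: space_PiM simp del: restrict_apply)
  have A [measurable]: "A S \<in> events" if "S \<in> I" for S
    unfolding A_eq1[OF that] using that by (intro measurable_sets[OF restr_m e]) (auto simp: I_def)
  have prob_mu: "prob_space \<mu>" if "i \<in> {1..n}" for i
    using prob_space_distr[OF Xm[OF that]] distr[OF that] by simp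
  have sets_mu: "sets \<mu> = sets borel" if "i \<in> {1..n}" for i
    using distr[OF that] by (metis sets_distr)
  have ne: "S \<noteq> {}" "S \<subseteq> {1..n}" if "S \<in> I" for S using that m by (auto simp: I_def)
  have distrS: "distr M (PiM S (\<lambda>_. borel)) (\<lambda>\<omega>. \<lambda>i\<in>S. X i \<omega>) = PiM S (\<lambda>_. \<mu>)"
    if "S \<noteq> {}" "S \<subseteq> {1..n}" for S
  proof -
    have "indep_vars (\<lambda>_. borel) X S" by (rule indep_vars_subset[OF X that(2)])
    then have "distr M (PiM S (\<lambda>_. borel)) (\<lambda>\<omega>. \<lambda>i\<in>S. X i \<omega>) = PiM S (\<lambda>i. distr M borel (X i))"
      using that by (subst (asm) indep_vars_iff_distr_eq_PiM') auto
    also have "\<dots> = PiM S (\<lambda>_. \<mu>)"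
      using that(2) distr by (intro PiM_cong) auto
    finally show ?thesis .
  qed
  \<comment> \<open>Reindexing by the increasing enumeration of S preserves the product measure, so
    the probability does not depend on S.\<close>
  have measure_e: "measure (PiM S (\<lambda>_. \<mu>)) (e S) = q" if S: "S \<in> I" for S
  proof -
    obtain i0 where i0: "i0 \<in> {1..n}" using ne[OF S] by blast
    have sets_PiM_mu: "sets (PiM S' (\<lambda>_. \<mu>)) = sets (PiM S' (\<lambda>_. borel))" for S' :: "nat set"
      by (rule sets_PiM_cong) (auto simp: sets_mu[OF i0])
    have "distr (PiM S (\<lambda>_. \<mu>)) (PiM {..<m} (\<lambda>_. \<mu>)) (\<lambda>f. \<lambda>i\<in>{..<m}. f (sorted_list_of_set S ! i)) = \<nu>"
      unfolding \<nu>_def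
    proof (rule distr_PiM_reindex)
      show "inj_on ((!) (sorted_list_of_set S)) {..<m}"
        using finite_subset[OF ne(2)[OF S]] S by (intro inj_on_nth) (auto simp: I_def)
    qed (use prob_mu[OF i0] nth[OF S] in auto)
    then have "q = measure (distr (PiM S (\<lambda>_. \<mu>)) (PiM {..<m} (\<lambda>_. \<mu>)) (\<lambda>f. \<lambda>i\<in>{..<m}. f (sorted_list_of_set S ! i))) E"
      by (simp add: q_def \<nu>_def)
    also have "\<dots> = measure (PiM S (\<lambda>_. \<mu>)) (e S)"
      using reidx[OF S] E
      by (subst measure_distr) (auto simp: e_def sets_PiM_mu vimage_def Int_def conj_commute
            sets_eq_imp_space_eq[OF sets_PiM_mu] cong: measurable_cong_sets)
    finally show ?thesis ..
  qed
  have probA: "prob (A S) = q" if "S \<in> I" for S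
    using measure_e[OF that] restr_m[OF ne(2)[OF that]] e[OF that]
    by (simp add: A_eq1[OF that] distrS[OF ne[OF that], symmetric] measure_distr)
  \<comment> \<open>Tuples with disjoint index sets are independent; those meeting S make up the
    error terms.\<close>
  define D where "D S = {T\<in>I. T \<inter> S = {}}" for S
  have "\<bar>prob (space M - (\<Union>S\<in>I. A S)) - exp (- (\<Sum>S\<in>I. prob (A S)))\<bar> \<le>
    (\<Sum>S\<in>I. prob (A S \<inter> (\<Union>T\<in>I - D S - {S}. A T)) + prob (A S) * prob (\<Union>T\<in>I - D S. A T))"
  proof (rule poisson_approx_none[OF finI A])
    show "D S \<subseteq> I - {S}" if "S \<in> I" for S
      using ne[OF that] by (auto simp: D_def)
    show "expectation (\<lambda>\<omega>. indicat_real (A S) \<omega> * u ^ card {T \<in> D S. \<omega> \<in> A T}) =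
          prob (A S) * expectation (\<lambda>\<omega>. u ^ card {T \<in> D S. \<omega> \<in> A T})"
      if S: "S \<in> I" for S and u :: real
    proof -
      define S' where "S' = {1..n} - S"
      \<comment> \<open>The power of u is a product over the tuples disjoint from S, hence a
        function of the coordinates outside S alone.\<close>
      define v where "v f = (\<Prod>T\<in>D S. if restrict f T \<in> e T then u else 1)" for f
      have finD: "finite (D S)" unfolding D_def using finI by simp
      have DS: "T \<in> I" "T \<subseteq> S'" if "T \<in> D S" for T
        using that ne(2)[of T] by (auto simp: D_def S'_def)
      have v [measurable]: "v \<in> borel_measurable (PiM S' (\<lambda>_. borel))"
        unfolding v_def
      proof (rule borel_measurable_prod)
        fix T assume T: "T \<in> D S"
        have [measurable]: "(\<lambda>f. restrict f T) \<in> PiM S' (\<lambda>_. borel) \<rightarrow>\<^sub>M PiM T (\<lambda>_. borel :: real measure)"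
          using DS[OF T] by (intro measurable_restrict_subset) auto
        note e[OF DS(1)[OF T], measurable]
        show "(\<lambda>f. if restrict f T \<in> e T then u else 1) \<in> borel_measurable (PiM S' (\<lambda>_. borel))"
          by measurable
      qed
      have v_eq: "u ^ card {T \<in> D S. \<omega> \<in> A T} = v (\<lambda>i\<in>S'. X i \<omega>)" if "\<omega> \<in> space M" for \<omega>
      proof -
        have "v (\<lambda>i\<in>S'. X i \<omega>) = (\<Prod>T\<in>D S. if \<omega> \<in> A T then u else 1)"
          unfolding v_def using A_eq[OF DS] that by (intro prod.cong) (auto simp: space_PiM)
        also have "\<dots> = u ^ card {T \<in> D S. \<omega> \<in> A T}"
          using finD by (simp add: prod.If_cases Int_def)
        finally show ?thesis ..
      qed
      have ind: "indep_var (PiM S (\<lambda>_. borel)) (\<lambda>\<omega>. restrict (\<lambda>i. X i \<omega>) S) (PiM S' (\<lambda>_. borel)) (\<lambda>\<omega>. restrict (\<lambda>i. X i \<omega>) S')"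
        by (rule indep_var_restrict[OF X]) (use ne(2)[OF S] in \<open>auto simp: S'_def\<close>)
      note e[OF S, measurable]
      have ind2: "indep_var borel (indicat_real (e S) \<circ> (\<lambda>\<omega>. restrict (\<lambda>i. X i \<omega>) S)) borel (v \<circ> (\<lambda>\<omega>. restrict (\<lambda>i. X i \<omega>) S'))"
        by (rule indep_var_compose[OF ind]) measurable
      have ind_eq: "indicat_real (A S) \<omega> = indicat_real (e S) (restrict (\<lambda>i. X i \<omega>) S)" if "\<omega> \<in> space M" for \<omega>
        using that by (simp add: A_eq1[OF S] indicator_def)
      have v_bnd: "\<bar>v f\<bar> \<le> (max 1 \<bar>u\<bar>) ^ card (D S)" for f
        unfolding v_def abs_prod prod_constant[symmetric] by (rule prod_mono) auto
      have "expectation (\<lambda>\<omega>. indicat_real (A S) \<omega> * u ^ card {T \<in> D S. \<omega> \<in> A T}) =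
        expectation (\<lambda>\<omega>. (indicat_real (e S) \<circ> (\<lambda>\<omega>. restrict (\<lambda>i. X i \<omega>) S)) \<omega> * (v \<circ> (\<lambda>\<omega>. restrict (\<lambda>i. X i \<omega>) S')) \<omega>)"
        by (rule Bochner_Integration.integral_cong) (auto simp: ind_eq v_eq)
      also have "\<dots> = expectation (indicat_real (e S) \<circ> (\<lambda>\<omega>. restrict (\<lambda>i. X i \<omega>) S)) * expectation (v \<circ> (\<lambda>\<omega>. restrict (\<lambda>i. X i \<omega>) S'))"
      proof (rule indep_var_lebesgue_integral[OF ind2])
        show "integrable M (indicat_real (e S) \<circ> (\<lambda>\<omega>. restrict (\<lambda>i. X i \<omega>) S))"
          using indep_var_rv1[OF ind2] by (intro integrable_const_bound[where B=1]) (auto simp: indicator_def)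
        show "integrable M (v \<circ> (\<lambda>\<omega>. restrict (\<lambda>i. X i \<omega>) S'))"
          using indep_var_rv2[OF ind2] v_bnd by (intro integrable_const_bound[where B="(max 1 \<bar>u\<bar>) ^ card (D S)"]) auto
      qed
      also have "expectation (indicat_real (e S) \<circ> (\<lambda>\<omega>. restrict (\<lambda>i. X i \<omega>) S)) = expectation (indicat_real (A S))"
        by (rule Bochner_Integration.integral_cong) (auto simp: ind_eq)
      also have "\<dots> = prob (A S)" using A[OF S] by simp
      also have "expectation (v \<circ> (\<lambda>\<omega>. restrict (\<lambda>i. X i \<omega>) S')) = expectation (\<lambda>\<omega>. u ^ card {T \<in> D S. \<omega> \<in> A T})"
        by (rule Bochner_Integration.integral_cong) (auto simp: v_eq)
      finally show ?thesis .
    qed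
  qed auto
  also have "\<dots> \<le> (\<Sum>S\<in>I. q * (real m * real n * \<kappa>) + q * (real m * real ((n - 1) choose (m - 1)) * q))"
  proof (rule sum_mono, rule add_mono)
    fix S assume S: "S \<in> I"
    have finS: "finite S" "card S = m" using ne(2)[OF S] S finite_subset by (auto simp: I_def)
    obtain i0 where i0: "i0 \<in> {1..n}" using ne[OF S] by blast
    interpret mu: prob_space \<mu> by (rule prob_mu[OF i0])
    have "\<kappa> \<ge> 0" using measure_nonneg order_trans[OF _ \<kappa>] by blast
    have q0: "q \<ge> 0" by (simp add: q_def)
    \<comment> \<open>Given the block of coordinates in S, the independent point \<open>X j\<close>
      falls near \<open>X c\<close> with probability at most \<kappa>.\<close>
    have single: "prob (A S \<inter> {\<omega>\<in>space M. (X c \<omega>, X j \<omega>) \<in> N}) \<le> q * \<kappa>"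
      if c: "c \<in> S" and j: "j \<in> {1..n} - S" for c j
    proof -
      have "indep_var (PiM S (\<lambda>_. borel)) (\<lambda>\<omega>. restrict (\<lambda>i. X i \<omega>) S) (PiM {j} (\<lambda>_. borel)) (\<lambda>\<omega>. restrict (\<lambda>i. X i \<omega>) {j})"
        by (rule indep_var_restrict[OF X]) (use ne(2)[OF S] j in auto)
      then have joint: "distr M (PiM S (\<lambda>_. borel) \<Otimes>\<^sub>M PiM {j} (\<lambda>_. borel)) (\<lambda>\<omega>. (restrict (\<lambda>i. X i \<omega>) S, restrict (\<lambda>i. X i \<omega>) {j})) =
        PiM S (\<lambda>_. \<mu>) \<Otimes>\<^sub>M PiM {j} (\<lambda>_. \<mu>)"
        using distrS[OF ne[OF S]] distrS[of "{j}"] j by (subst (asm) indep_var_distribution_eq) auto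
      define H where "H = {z\<in>space (PiM S (\<lambda>_. borel :: real measure) \<Otimes>\<^sub>M PiM {j} (\<lambda>_. borel :: real measure)). fst z \<in> e S \<and> (fst z c, snd z j) \<in> N}"
      have [measurable]: "(\<lambda>z. fst z c) \<in> PiM S (\<lambda>_. borel :: real measure) \<Otimes>\<^sub>M PiM {j} (\<lambda>_. borel :: real measure) \<rightarrow>\<^sub>M borel"
        using c by (intro measurable_compose[OF measurable_fst measurable_component_singleton]) auto
      have [measurable]: "(\<lambda>z. snd z j) \<in> PiM S (\<lambda>_. borel :: real measure) \<Otimes>\<^sub>M PiM {j} (\<lambda>_. borel :: real measure) \<rightarrow>\<^sub>M borel"
        by (intro measurable_compose[OF measurable_snd measurable_component_singleton]) auto
      note e[OF S, measurable]
      have H [measurable]: "H \<in> sets (PiM S (\<lambda>_. borel) \<Otimes>\<^sub>M PiM {j} (\<lambda>_. borel))"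
        unfolding H_def by measurable
      interpret PS: prob_space "PiM S (\<lambda>_. \<mu>)" by (rule prob_space_PiM) unfold_locales
      interpret Pj: prob_space "PiM {j} (\<lambda>_. \<mu>)" by (rule prob_space_PiM) unfold_locales
      have sets_PiM_mu: "sets (PiM S' (\<lambda>_. \<mu>)) = sets (PiM S' (\<lambda>_. borel))" for S' :: "nat set"
        by (rule sets_PiM_cong) (auto simp: sets_mu[OF i0])
      have jm [measurable]: "random_variable borel (X j)" using j by auto
      have restr_j: "(\<lambda>\<omega>. \<lambda>i\<in>{j}. X i \<omega>) \<in> M \<rightarrow>\<^sub>M PiM {j} (\<lambda>_. borel)" using j by (intro restr_m) auto
      note restr_m[OF ne(2)[OF S], measurable] restr_j[measurable]
      have "A S \<inter> {\<omega>\<in>space M. (X c \<omega>, X j \<omega>) \<in> N} = (\<lambda>\<omega>. (restrict (\<lambda>i. X i \<omega>) S, restrict (\<lambda>i. X i \<omega>) {j})) -` H \<inter> space M"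
        using c by (auto simp: H_def A_eq1[OF S] space_pair_measure space_PiM)
      then have "emeasure M (A S \<inter> {\<omega>\<in>space M. (X c \<omega>, X j \<omega>) \<in> N}) = emeasure (PiM S (\<lambda>_. \<mu>) \<Otimes>\<^sub>M PiM {j} (\<lambda>_. \<mu>)) H"
        by (simp add: joint[symmetric] emeasure_distr)
      also have "\<dots> = (\<integral>\<^sup>+f. emeasure (PiM {j} (\<lambda>_. \<mu>)) (Pair f -` H) \<partial>PiM S (\<lambda>_. \<mu>))"
        using H sets_pair_measure_cong[OF sets_PiM_mu[of S] sets_PiM_mu[of "{j}"]]
        by (intro Pj.emeasure_pair_measure_alt) simp
      also have "\<dots> \<le> (\<integral>\<^sup>+f. ennreal \<kappa> * indicator (e S) f \<partial>PiM S (\<lambda>_. \<mu>))"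
      proof (rule nn_integral_mono)
        fix f assume "f \<in> space (PiM S (\<lambda>_. \<mu>))"
        have Nf: "{b. (f c, b) \<in> N} \<in> sets borel"
          using sets_Pair1[OF N, of "f c"] by (simp add: vimage_def)
        show "emeasure (PiM {j} (\<lambda>_. \<mu>)) (Pair f -` H) \<le> ennreal \<kappa> * indicator (e S) f"
        proof (cases "f \<in> e S")
          case True
          have f: "f \<in> space (PiM S (\<lambda>_. borel))" using True by (simp add: e_def)
          have eq: "Pair f -` H = {g\<in>space (PiM {j} (\<lambda>_. borel)). g j \<in> {b. (f c, b) \<in> N}}"
            using True f by (auto simp: H_def space_pair_measure)
          have "Pair f -` H \<in> sets (PiM {j} (\<lambda>_. borel))"
            using sets_Pair1[OF H] .
          then have "emeasure (PiM {j} (\<lambda>_. \<mu>)) (Pair f -` H) = emeasure M ((\<lambda>\<omega>. \<lambda>i\<in>{j}. X i \<omega>) -` (Pair f -` H) \<inter> space M)"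
            using j restr_j by (subst distrS[symmetric]) (auto simp: emeasure_distr)
          also have "(\<lambda>\<omega>. \<lambda>i\<in>{j}. X i \<omega>) -` (Pair f -` H) \<inter> space M = X j -` {b. (f c, b) \<in> N} \<inter> space M"
            unfolding eq by (auto simp: space_PiM)
          also have "emeasure M \<dots> = emeasure \<mu> {b. (f c, b) \<in> N}"
            using j jm Nf by (subst distr[symmetric, of j]) (auto simp: emeasure_distr)
          finally show ?thesis
            using True \<kappa>[of "f c"] by (simp add: mu.emeasure_eq_measure ennreal_leI)
        next
          case False
          then have "Pair f -` H = {}" by (auto simp: H_def)
          then show ?thesis by simp
        qed
      qed
      also have "\<dots> = ennreal \<kappa> * emeasure (PiM S (\<lambda>_. \<mu>)) (e S)"
        using e[OF S] by (subst nn_integral_cmult_indicator) (auto simp: sets_PiM_mu)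
      also have "\<dots> = ennreal (q * \<kappa>)"
        using \<open>\<kappa> \<ge> 0\<close> q0 by (simp add: PS.emeasure_eq_measure measure_e[OF S] ennreal_mult mult.commute)
      finally show ?thesis using q0 \<open>\<kappa> \<ge> 0\<close> by (simp add: emeasure_eq_measure)
    qed
    have Nm: "{\<omega>\<in>space M. (X c \<omega>, X j \<omega>) \<in> N} \<in> events" if "c \<in> {1..n}" "j \<in> {1..n}" for c j
      using Xm[OF that(1)] Xm[OF that(2)] by measurable
    have "prob (A S \<inter> (\<Union>T\<in>I - D S - {S}. A T)) \<le> prob (\<Union>c\<in>S. \<Union>j\<in>{1..n}-S. A S \<inter> {\<omega>\<in>space M. (X c \<omega>, X j \<omega>) \<in> N})"
    proof (rule finite_measure_mono)
      show "(\<Union>c\<in>S. \<Union>j\<in>{1..n}-S. A S \<inter> {\<omega>\<in>space M. (X c \<omega>, X j \<omega>) \<in> N}) \<in> events"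
        using finS A[OF S] ne(2)[OF S] by (intro sets.finite_UN sets.Int Nm) auto
      show "A S \<inter> (\<Union>T\<in>I - D S - {S}. A T) \<subseteq> (\<Union>c\<in>S. \<Union>j\<in>{1..n}-S. A S \<inter> {\<omega>\<in>space M. (X c \<omega>, X j \<omega>) \<in> N})"
      proof
        fix \<omega> assume "\<omega> \<in> A S \<inter> (\<Union>T\<in>I - D S - {S}. A T)"
        then obtain T where w: "\<omega> \<in> A S" "\<omega> \<in> A T" and T: "T \<in> I" "T \<notin> D S" "T \<noteq> S" by auto
        obtain c where c: "c \<in> T" "c \<in> S" using T by (auto simp: D_def)
        \<comment> \<open>T and S have the same size and differ, so T has a point outside S; by
          \<open>near\<close> this point is close to the shared one.\<close>
        have "\<not> T \<subseteq> S" using T(1,3) finS card_subset_eq[of S T] by (auto simp: I_def)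
        then obtain j where j: "j \<in> T" "j \<notin> S" by auto
        obtain i1 i2 where i: "i1 < m" "i2 < m" "sorted_list_of_set T ! i1 = c" "sorted_list_of_set T ! i2 = j"
          using ex_nth[OF T(1) c(1)] ex_nth[OF T(1) j(1)] by auto
        have "(X c \<omega>, X j \<omega>) \<in> N" "\<omega> \<in> space M"
          using near[of "\<lambda>i\<in>{..<m}. X (sorted_list_of_set T ! i) \<omega>", OF _ i(1,2)] w(2) i by (auto simp: A_def)
        moreover have "j \<in> {1..n}" using j ne(2)[OF T(1)] by auto
        ultimately show "\<omega> \<in> (\<Union>c\<in>S. \<Union>j\<in>{1..n}-S. A S \<inter> {\<omega>\<in>space M. (X c \<omega>, X j \<omega>) \<in> N})"
          using c j w by (intro UN_I[of c] UN_I[of j]) auto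
      qed
    qed
    also have "\<dots> \<le> (\<Sum>c\<in>S. prob (\<Union>j\<in>{1..n}-S. A S \<inter> {\<omega>\<in>space M. (X c \<omega>, X j \<omega>) \<in> N}))"
      using finS A[OF S] ne(2)[OF S] by (intro finite_measure_subadditive_finite) (auto intro!: sets.finite_UN sets.Int Nm)
    also have "\<dots> \<le> (\<Sum>c\<in>S. \<Sum>j\<in>{1..n}-S. prob (A S \<inter> {\<omega>\<in>space M. (X c \<omega>, X j \<omega>) \<in> N}))"
      using finS A[OF S] ne(2)[OF S] by (intro sum_mono finite_measure_subadditive_finite) (auto intro!: sets.Int Nm)
    also have "\<dots> \<le> (\<Sum>c\<in>S. \<Sum>j\<in>{1..n}-S. q * \<kappa>)"
      by (intro sum_mono single)
    also have "\<dots> = real m * (real (card ({1..n} - S)) * (q * \<kappa>))"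
      using finS by simp
    also have "\<dots> \<le> real m * (real n * (q * \<kappa>))"
      using q0 \<open>\<kappa> \<ge> 0\<close> card_mono[of "{1..n}" "{1..n} - S"] by (intro mult_left_mono mult_right_mono) auto
    finally show "prob (A S \<inter> (\<Union>T\<in>I - D S - {S}. A T)) \<le> q * (real m * real n * \<kappa>)"
      by (simp add: mult_ac)
    have ID: "I - D S = {T. T \<subseteq> {1..n} \<and> card T = m \<and> T \<inter> S \<noteq> {}}"
      by (auto simp: I_def D_def)
    have "prob (\<Union>T\<in>I - D S. A T) \<le> (\<Sum>T\<in>I - D S. prob (A T))"
      using finI A by (intro finite_measure_subadditive_finite) auto
    also have "\<dots> = real (card (I - D S)) * q" using probA by simp
    also have "real (card (I - D S)) * q \<le> real (m * ((n - 1) choose (m - 1))) * q"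
      using card_subsets_meeting[of "{1..n}" S m] finS ne(2)[OF S] m q0 unfolding ID
      by (intro mult_right_mono of_nat_mono) auto
    finally have "prob (\<Union>T\<in>I - D S. A T) \<le> real m * real ((n - 1) choose (m - 1)) * q" by simp
    then show "prob (A S) * prob (\<Union>T\<in>I - D S. A T) \<le> q * (real m * real ((n - 1) choose (m - 1)) * q)"
      using q0 by (simp add: probA[OF S] mult_left_mono)
  qed
  also have "\<dots> = real (n choose m) * q * (real m * real n * \<kappa>) +
    real (n choose m) * q * (real m * real ((n - 1) choose (m - 1)) * q)"
    by (simp add: cardI algebra_simps)
  finally show ?thesis
    by (simp add: probA cardI)
qed

section \<open>The deficit near regular polygons\<close>

lemma double_sum_split:
  fixes F :: "nat \<Rightarrow> nat \<Rightarrow> real"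
  shows "(\<Sum>i<m. \<Sum>j<m. F i j) = (\<Sum>i<m. F i i) + (\<Sum>j<m. \<Sum>i<j. F i j + F j i)"
  by (induction m) (simp_all add: sum.distrib)

text \<open>\<open>F i j\<close> carries the weight \<alpha> at the cyclic distance from i to j. For
  fixed j this distance takes each value 1, ..., m-1 once as i varies, so every \<open>u j\<close>
  receives the same total weight. This handles the constant, the linear and the quadratic part of
  the deficit alike.\<close>

lemma cyclic_pair_sum:
  fixes \<alpha> u :: "nat \<Rightarrow> real"
  shows "(\<Sum>j<m. \<Sum>i<j. \<alpha> (j - i) * u j + \<alpha> (m - (j - i)) * u i) = (\<Sum>s=1..m-1. \<alpha> s) * (\<Sum>j<m. u j)"
proof -
  define F where "F i j = (if i < j then \<alpha> (j - i) * u j else if j < i then \<alpha> (m - (i - j)) * u j else 0)" for i j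
  have "(\<Sum>j<m. \<Sum>i<j. \<alpha> (j - i) * u j + \<alpha> (m - (j - i)) * u i) = (\<Sum>j<m. \<Sum>i<j. F i j + F j i)"
    by (intro sum.cong refl) (auto simp: F_def)
  also have "\<dots> = (\<Sum>i<m. \<Sum>j<m. F i j)"
    unfolding double_sum_split by (simp add: F_def)
  also have "\<dots> = (\<Sum>j<m. \<Sum>i<m. F i j)"
    by (rule sum.swap)
  also have "\<dots> = (\<Sum>j<m. (\<Sum>s=1..m-1. \<alpha> s) * u j)"
  proof (rule sum.cong[OF refl])
    fix j assume "j \<in> {..<m}"
    then have j: "j < m" by simp
    have "(\<Sum>i<m. F i j) = (\<Sum>i\<in>{..<j} \<union> {j} \<union> {j<..<m}. F i j)"
      using j by (intro sum.cong) auto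
    also have "\<dots> = (\<Sum>i<j. F i j) + F j j + (\<Sum>i\<in>{j<..<m}. F i j)"
      by (subst sum.union_disjoint; auto)+
    also have "(\<Sum>i<j. F i j) = (\<Sum>s\<in>{1..j}. \<alpha> s * u j)"
      by (rule sum.reindex_bij_witness[of _ "\<lambda>s. j - s" "\<lambda>i. j - i"]) (auto simp: F_def)
    also have "(\<Sum>i\<in>{j<..<m}. F i j) = (\<Sum>s\<in>{j<..m-1}. \<alpha> s * u j)"
      by (rule sum.reindex_bij_witness[of _ "\<lambda>s. m + j - s" "\<lambda>i. m + j - i"])
         (use j in \<open>auto simp: F_def intro!: arg_cong[of _ _ \<alpha>]\<close>)
    also have "F j j = 0" by (simp add: F_def)
    also have "(\<Sum>s\<in>{1..j}. \<alpha> s * u j) + 0 + (\<Sum>s\<in>{j<..m-1}. \<alpha> s * u j) = (\<Sum>s\<in>{1..j} \<union> {j<..m-1}. \<alpha> s * u j)"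
      by (subst sum.union_disjoint) auto
    also have "{1..j} \<union> {j<..m-1} = {1..m-1}" using j by auto
    finally show "(\<Sum>i<m. F i j) = (\<Sum>s=1..m-1. \<alpha> s) * u j" by (simp add: sum_distrib_right)
  qed
  also have "\<dots> = (\<Sum>s=1..m-1. \<alpha> s) * (\<Sum>j<m. u j)" by (simp add: sum_distrib_left)
  finally show ?thesis .
qed

lemma ex_sorting_permutation:
  fixes \<beta> :: "nat \<Rightarrow> real"
  obtains \<sigma> where "\<sigma> permutes {..<k}" "\<And>i j. i \<le> j \<Longrightarrow> j < k \<Longrightarrow> \<beta> (\<sigma> i) \<le> \<beta> (\<sigma> j)"
proof -
  define js where "js = sort_key \<beta> [0..<k]"
  define \<sigma> where "\<sigma> i = (if i < k then js ! i else i)" for i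
  have js: "length js = k" "distinct js" "set js = {..<k}" "sorted (map \<beta> js)"
    by (auto simp: js_def)
  have "bij_betw ((!) js) {..<k} {..<k}"
    by (rule bij_betw_nth) (simp_all add: js)
  then have "bij_betw \<sigma> {..<k} {..<k}"
    by (rule bij_betw_cong[THEN iffD1, rotated]) (simp add: \<sigma>_def)
  then have "\<sigma> permutes {..<k}"
    by (rule bij_imp_permutes) (simp add: \<sigma>_def)
  moreover have "\<beta> (\<sigma> i) \<le> \<beta> (\<sigma> j)" if "i \<le> j" "j < k" for i j
    using sorted_nth_mono[OF js(4), of i j] that js(1) by (simp add: \<sigma>_def)
  ultimately show ?thesis using that by blast
qed

lemma circ_cong: "x - y = 2 * pi * of_int n \<Longrightarrow> circ x = circ y"
  using circ_shift(1)[of y n] by (simp add: algebra_simps)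

lemma circ_diff_int: obtains n where "circ x - x = 2 * pi * of_int n"
  using that[of "- \<lfloor>x / (2 * pi)\<rfloor>"] by (simp add: circ_def)

lemma Arg2pi_divide_circ:
  assumes "w \<noteq> 0" "z \<noteq> 0"
  shows "Arg2pi (w / z) = circ (Arg2pi w - Arg2pi z)"
proof -
  obtain n where n: "circ (Arg2pi w - Arg2pi z) - (Arg2pi w - Arg2pi z) = 2 * pi * of_int n"
    by (rule circ_diff_int)
  then have c: "circ (Arg2pi w - Arg2pi z) = Arg2pi w - Arg2pi z + 2 * pi * of_int n" by simp
  have "exp (\<i> * of_real (circ (Arg2pi w - Arg2pi z))) = exp (\<i> * of_real (Arg2pi w)) / exp (\<i> * of_real (Arg2pi z))"
  proof -
    have "exp (\<i> * of_real (circ (Arg2pi w - Arg2pi z))) = exp (\<i> * of_real (Arg2pi w) - \<i> * of_real (Arg2pi z) + of_int n * (of_real (2 * pi) * \<i>))"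
      by (simp add: c algebra_simps)
    also have "\<dots> = exp (\<i> * of_real (Arg2pi w) - \<i> * of_real (Arg2pi z))"
      using exp_integer_2pi[of "of_int n"] by (simp add: exp_add mult_ac)
    finally show ?thesis by (simp add: exp_diff)
  qed
  then have "of_real (norm w / norm z) * exp (\<i> * of_real (circ (Arg2pi w - Arg2pi z))) = w / z"
    using Arg2pi_eq[of w] Arg2pi_eq[of z] by (metis of_real_divide times_divide_times_eq)
  then show ?thesis
    using assms circ_bounds by (intro Arg2pi_unique[of "norm w / norm z"]) auto
qed

lemma has_real_derivative_affine:
  fixes f :: "real \<Rightarrow> real"
  assumes "(f has_real_derivative D) (at (c + e * x))"
  shows "((\<lambda>x. f (c + e * x)) has_real_derivative D * e) (at x)"
  by (rule DERIV_chain2[where f = f and g = "\<lambda>x. c + e * x"]) (use assms in \<open>auto intro!: derivative_eq_intros\<close>)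

section \<open>The deficit of a tuple of angles and its symmetries\<close>

locale concave_kernel =
  fixes g :: "real \<Rightarrow> real" and m :: nat
  assumes m2: "m \<ge> 2"
    and g_cont: "continuous_on {0..2*pi} g"
    and g_conc: "strictly_concave_on {0..2*pi} g"
    and g_C3: "\<And>s. s \<in> {1..m-1} \<Longrightarrow> C3_near g (2 * pi * real s / real m)"
    and g_sym: "\<And>x. x \<in> {0..2*pi} \<Longrightarrow> g x = g (2 * pi - x)"
begin

text \<open>The symmetry of g about pi makes this 2 pi-periodic extension even, so the kernel
  depends neither on the order of the points nor on the point from which angles are
  measured.\<close>

definition ghat :: "real \<Rightarrow> real" where "ghat x = g (circ x)"

definition deficit :: "(nat \<Rightarrow> real) \<Rightarrow> real" where
  "deficit x = 1/2 * (\<Sum>s=1..m-1. real m * g (2 * pi * real s / real m)) - (\<Sum>j<m. \<Sum>i<j. ghat (x j - x i))"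

definition ang :: "nat \<Rightarrow> real" where "ang s = 2 * pi * real s / real m"
text \<open>The base angle carries the last index \<open>m - 1\<close>, whose vertex \<open>2 \<pi>\<close> is \<open>0\<close> on the circle; the
  deviations of the other angles are then indexed like the rows of \<open>G\<close>.\<close>
definition vertex :: "nat \<Rightarrow> real" where "vertex i = 2 * pi * (real i + 1) / real m"
definition gd :: "nat \<Rightarrow> real" where "gd s = deriv g (ang s)"
definition \<kappa> :: "nat \<Rightarrow> real" where "\<kappa> s = - (deriv ^^ 2) g (ang s)"
text \<open>The gap between the tangent of g at \<open>ang s\<close> and g itself, nonnegative on
  the domain by concavity.\<close>

definition h :: "nat \<Rightarrow> real \<Rightarrow> real" where "h s x = g (ang s) + gd s * (x - ang s) - g x"
text \<open>The entries of -G. This is the Laplacian of the complete graph on the m vertices, with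
  edge weight \<open>\<kappa>\<close> at the cyclic distance of the endpoints, after deletion of the
  row and column of the base vertex.\<close>

definition Amat :: "nat \<Rightarrow> nat \<Rightarrow> real" where
  "Amat i j = (if i = j then \<Sum>s=1..m-1. \<kappa> s else - \<kappa> (if i < j then j - i else i - j))"

abbreviation Q :: "(nat \<Rightarrow> real) \<Rightarrow> real" where "Q \<equiv> quad_form (m - 1) Amat"
abbreviation Leb :: "(nat \<Rightarrow> real) measure" where "Leb \<equiv> PiM {..<m-1} (\<lambda>_. lborel)"

lemma ang_bounds: "s \<in> {1..m-1} \<Longrightarrow> 0 < ang s \<and> ang s < 2 * pi"
  using m2 by (auto simp: ang_def field_simps)

lemma ang_compl: "s \<le> m \<Longrightarrow> ang (m - s) = 2 * pi - ang s"
  using m2 by (simp add: ang_def of_nat_diff field_simps)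

lemma vertex_diff: "i \<le> j \<Longrightarrow> vertex j - vertex i = ang (j - i)"
  using m2 by (simp add: ang_def vertex_def of_nat_diff field_simps)

lemma vertex_last: "vertex (m - 1) = 2 * pi"
  using m2 by (simp add: vertex_def of_nat_diff)

lemma minus_G_mat: "- G_mat g m = Matrix.mat (m - 1) (m - 1) (\<lambda>(i, j). Amat i j)"
  by (rule eq_matI) (auto simp: G_mat_def Amat_def \<kappa>_def ang_def sum_negf of_nat_diff abs_if)

lemma Amat_sym: "Amat i j = Amat j i" by (simp add: Amat_def)

lemma g_0: "g 0 = g (2 * pi)" using g_sym[of 0] by simp

lemma ghat_eq: "0 \<le> x \<Longrightarrow> x \<le> 2 * pi \<Longrightarrow> ghat x = g x"
proof (cases "x = 2 * pi")
  case True
  have "circ (2 * pi) = 0" using circ_shift(1)[of 0 1] circ_eq[of 0] by simp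
  then show ?thesis using True by (simp add: ghat_def g_0)
qed (simp add: ghat_def circ_eq)

lemma ghat_cong: "x - y = 2 * pi * of_int n \<Longrightarrow> ghat x = ghat y"
  unfolding ghat_def by (metis circ_cong)

lemma ghat_minus: "ghat (- x) = ghat x"
proof -
  obtain n where "circ x - x = 2 * pi * of_int n" by (rule circ_diff_int)
  then have "- x - (2 * pi - circ x) = 2 * pi * of_int (n - 1)" by (simp add: algebra_simps)
  then have "ghat (- x) = ghat (2 * pi - circ x)" by (rule ghat_cong)
  also have "\<dots> = g (2 * pi - circ x)" using circ_bounds[of x] by (intro ghat_eq) auto
  also have "\<dots> = g (circ x)" using g_sym[of "circ x"] circ_bounds[of x] by simp
  finally show ?thesis by (simp add: ghat_def)
qed

lemma measurable_ghat [measurable]: "ghat \<in> borel_measurable borel"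
proof -
  have 1 [measurable]: "(\<lambda>x. indicator {0..2*pi} x *\<^sub>R g x) \<in> borel_measurable borel"
    by (rule borel_measurable_continuous_on_indicator) (use g_cont in auto)
  have "ghat = (\<lambda>x. indicator {0..2*pi} (circ x) *\<^sub>R g (circ x))"
    using circ_bounds by (auto simp: ghat_def fun_eq_iff indicator_def less_imp_le)
  also have "\<dots> \<in> borel_measurable borel"
    using measurable_compose[OF measurable_circ 1] by simp
  finally show ?thesis .
qed

lemma measurable_deficit [measurable]: "deficit \<in> borel_measurable (PiM {..<m} (\<lambda>_. borel))"
proof -
  have "(\<lambda>x. ghat (x j - x i)) \<in> borel_measurable (PiM {..<m} (\<lambda>_. borel))" if "j < m" "i < j" for i j
  proof -
    have "(\<lambda>x. x j - x i) \<in> borel_measurable (PiM {..<m} (\<lambda>_. borel :: real measure))"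
      using that by (intro borel_measurable_diff measurable_component_singleton) auto
    from measurable_compose[OF this measurable_ghat] show ?thesis .
  qed
  then have "(\<lambda>x. \<Sum>j<m. \<Sum>i<j. ghat (x j - x i)) \<in> borel_measurable (PiM {..<m} (\<lambda>_. borel))"
    by (intro borel_measurable_sum) auto
  then show ?thesis unfolding deficit_def[abs_def] by measurable
qed

lemma deficit_cong:
  assumes "\<And>i. i < m \<Longrightarrow> \<exists>n::int. x i - y i = c + 2 * pi * of_int n"
  shows "deficit x = deficit y"
proof -
  have "ghat (x j - x i) = ghat (y j - y i)" if ij: "i < m" "j < m" for i j
  proof -
    obtain n1 n2 where "x i - y i = c + 2 * pi * of_int n1" "x j - y j = c + 2 * pi * of_int n2"
      using assms ij by metis
    then have "(x j - x i) - (y j - y i) = 2 * pi * of_int (n2 - n1)" by (simp add: algebra_simps)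
    then show ?thesis by (rule ghat_cong)
  qed
  then show ?thesis unfolding deficit_def by (intro arg_cong2[of _ _ _ _ "(-)"] sum.cong refl) auto
qed

text \<open>As \<open>ghat\<close> is even, the sum over pairs is half of a sum over all ordered
  pairs minus its diagonal, and permutations leave the latter unchanged.\<close>

lemma deficit_permute:
  assumes \<sigma>: "\<sigma> permutes {..<m}"
  shows "deficit (\<lambda>i. x (\<sigma> i)) = deficit x"
proof -
  have *: "(\<Sum>j<m. \<Sum>i<j. ghat (y j - y i)) = ((\<Sum>i<m. \<Sum>j<m. ghat (y j - y i)) - (\<Sum>i<m. ghat 0)) / 2" for y
  proof -
    have "ghat (y i - y j) = ghat (y j - y i)" for i j
      using ghat_minus[of "y i - y j"] by simp
    then show ?thesis
      using double_sum_split[of "\<lambda>i j. ghat (y j - y i)" m] by (simp add: sum_distrib_left[symmetric])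
  qed
  have "(\<Sum>i<m. \<Sum>j<m. ghat (x (\<sigma> j) - x (\<sigma> i))) = (\<Sum>i<m. \<Sum>j<m. ghat (x j - x (\<sigma> i)))"
  proof (rule sum.cong[OF refl])
    show "(\<Sum>j<m. ghat (x (\<sigma> j) - x (\<sigma> i))) = (\<Sum>j<m. ghat (x j - x (\<sigma> i)))" for i
      using sum.permute[OF \<sigma>, of "\<lambda>j. ghat (x j - x (\<sigma> i))"] by (simp add: comp_def)
  qed
  also have "\<dots> = (\<Sum>i<m. \<Sum>j<m. ghat (x j - x i))"
    using sum.permute[OF \<sigma>, of "\<lambda>i. \<Sum>j<m. ghat (x j - x i)"] by (simp add: comp_def)
  finally show ?thesis unfolding deficit_def * by simp
qed

text \<open>Differences of the \<open>\<beta> i\<close> lie strictly between -2 pi and 2 pi, so g of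
  their absolute value is \<open>ghat\<close> of the difference, which ignores both the rotation by
  the first point and the reduction modulo 2 pi.\<close>

lemma angle_kernel_eq:
  assumes len: "length zs = m" and sphere: "\<And>z. z \<in> set zs \<Longrightarrow> z \<in> sphere 0 1"
  shows "angle_kernel g zs = (\<Sum>j<m. \<Sum>i<j. ghat (Arg2pi (zs ! j) - Arg2pi (zs ! i)))"
proof -
  define \<beta> where "\<beta> i = (if i = 0 then 0 else ccw_angle (zs ! 0) (zs ! i))" for i
  have nz: "zs ! i \<noteq> 0" if "i < m" for i
    using sphere[of "zs ! i"] that len by auto
  have \<beta>: "\<beta> i = circ (Arg2pi (zs ! i) - Arg2pi (zs ! 0))" if "i < m" for i
    using nz[OF that] nz[of 0] m2 circ_eq[of 0]
    by (auto simp: \<beta>_def ccw_angle_def Arg2pi_divide_circ)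
  have "g \<bar>\<beta> j - \<beta> i\<bar> = ghat (Arg2pi (zs ! j) - Arg2pi (zs ! i))" if "i < m" "j < m" for i j
  proof -
    have "0 \<le> \<beta> i" "\<beta> i < 2 * pi" "0 \<le> \<beta> j" "\<beta> j < 2 * pi"
      using that by (simp_all add: \<beta> circ_bounds)
    then have "g \<bar>\<beta> j - \<beta> i\<bar> = ghat \<bar>\<beta> j - \<beta> i\<bar>" by (intro ghat_eq[symmetric]) auto
    also have "\<dots> = ghat (\<beta> j - \<beta> i)" using ghat_minus[of "\<beta> j - \<beta> i"] by (simp add: abs_if)
    also have "\<dots> = ghat (Arg2pi (zs ! j) - Arg2pi (zs ! i))"
    proof -
      obtain n1 n2 where "circ (Arg2pi (zs ! i) - Arg2pi (zs ! 0)) - (Arg2pi (zs ! i) - Arg2pi (zs ! 0)) = 2 * pi * of_int n1"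
        "circ (Arg2pi (zs ! j) - Arg2pi (zs ! 0)) - (Arg2pi (zs ! j) - Arg2pi (zs ! 0)) = 2 * pi * of_int n2"
        by (metis circ_diff_int)
      then have "(\<beta> j - \<beta> i) - (Arg2pi (zs ! j) - Arg2pi (zs ! i)) = 2 * pi * of_int (n2 - n1)"
        using that by (simp add: \<beta> algebra_simps)
      then show ?thesis by (rule ghat_cong)
    qed
    finally show ?thesis .
  qed
  then show ?thesis
    unfolding angle_kernel_def Let_def \<beta>_def[symmetric] len by (intro sum.cong refl) auto
qed

lemma derivs:
  assumes s: "s \<in> {1..m-1}"
  shows "eventually (\<lambda>x. (g has_real_derivative deriv g x) (at x)) (nhds (ang s))"
    and "(deriv g has_real_derivative - \<kappa> s) (at (ang s))"
proof -
  obtain S where S: "open S" "ang s \<in> S" and k: "k_times_cont_diff_on 3 g S"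
    using g_C3[OF s] unfolding C3_near_def ang_def by auto
  have *: "((deriv ^^ j) g has_real_derivative deriv ((deriv ^^ j) g) x) (at x)" if "x \<in> S" "j < 3" for x j
    using k that S(1) unfolding k_times_cont_diff_on_def
    by (metis DERIV_deriv_iff_real_differentiable at_within_open differentiable_on_def)
  show "eventually (\<lambda>x. (g has_real_derivative deriv g x) (at x)) (nhds (ang s))"
    using eventually_nhds_in_open[OF S] by (rule eventually_mono) (use *[of _ 0] in auto)
  show "(deriv g has_real_derivative - \<kappa> s) (at (ang s))"
    using *[OF S(2), of 1] by (simp add: \<kappa>_def numeral_2_eq_2)
qed

lemma deriv_g: "s \<in> {1..m-1} \<Longrightarrow> (g has_real_derivative gd s) (at (ang s))"
  unfolding gd_def by (rule eventually_nhds_x_imp_x[OF derivs(1)])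

text \<open>The reflection symmetry holds in a neighborhood of \<open>ang s\<close>, so it may be
  differentiated twice.\<close>

lemma deriv_compl:
  assumes s: "s \<in> {1..m-1}"
  shows "gd (m - s) = - gd s" and "\<kappa> (m - s) = \<kappa> s"
proof -
  have s': "m - s \<in> {1..m-1}" using s m2 by auto
  have an: "ang (m - s) = 2 * pi - ang s" using s by (intro ang_compl) auto
  have ev0: "eventually (\<lambda>x. x \<in> {0<..<2*pi}) (nhds (ang s))"
    using ang_bounds[OF s] by (intro eventually_nhds_in_open) auto
  have refl_lim: "((\<lambda>x. 2 * pi - x) \<longlongrightarrow> ang (m - s)) (nhds (ang s))"
    unfolding an by (intro tendsto_intros filterlim_ident)
  have ev1: "eventually (\<lambda>x. (g has_real_derivative deriv g (2 * pi - x)) (at (2 * pi - x))) (nhds (ang s))"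
    using eventually_compose_filterlim[OF derivs(1)[OF s'] refl_lim] .
  have odd: "eventually (\<lambda>x. deriv g x = - deriv g (2 * pi - x)) (nhds (ang s))"
    using ev0 ev1 derivs(1)[OF s]
  proof eventually_elim
    case (elim x)
    have "((\<lambda>x. g (2 * pi - x)) has_real_derivative - deriv g (2 * pi - x)) (at x)"
      using has_real_derivative_affine[of g _ "2 * pi" "-1" x] elim(2) by simp
    moreover have "eventually (\<lambda>y. g (2 * pi - y) = g y) (nhds x)"
      using eventually_nhds_in_open[of "{0<..<2*pi}" x] elim(1)
      by (auto elim!: eventually_mono simp: g_sym[symmetric])
    ultimately have "(g has_real_derivative - deriv g (2 * pi - x)) (at x)"
      using DERIV_cong_ev[OF refl, of "\<lambda>x. g (2 * pi - x)" g] by (subst DERIV_cong_ev[OF refl _ refl, symmetric])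
    then show ?case using elim(3) DERIV_unique by blast
  qed
  show "gd (m - s) = - gd s"
    using eventually_nhds_x_imp_x[OF odd] by (simp add: gd_def an)
  have "((\<lambda>x. - deriv g (2 * pi - x)) has_real_derivative - \<kappa> (m - s)) (at (ang s))"
    using DERIV_minus[OF has_real_derivative_affine[of "deriv g" _ "2 * pi" "-1" "ang s"]] derivs(2)[OF s', unfolded an] by simp
  then have "(deriv g has_real_derivative - \<kappa> (m - s)) (at (ang s))"
    by (subst DERIV_cong_ev[OF refl odd refl])
  then show "\<kappa> (m - s) = \<kappa> s"
    using derivs(2)[OF s] DERIV_unique by fastforce
qed

text \<open>Expansion of g at the ideal differences \<open>ang (j - i)\<close>: the constants add up
  to the value at the regular polygon, and the linear terms cancel since \<open>gd\<close> changes
  sign when s is replaced by m - s. The condition on b says that the angles increase within one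
  turn.\<close>

lemma deficit_eq:
  assumes b: "\<And>i j. i < j \<Longrightarrow> j < m \<Longrightarrow> 0 \<le> b j - b i \<and> b j - b i \<le> 2 * pi"
  shows "deficit b = (\<Sum>j<m. \<Sum>i<j. h (j - i) (b j - b i))"
proof -
  have ss: "j - i \<in> {1..m-1}" if "i < j" "j < m" for i j using that by auto
  have "(\<Sum>j<m. \<Sum>i<j. ghat (b j - b i)) = (\<Sum>j<m. \<Sum>i<j. g (b j - b i))"
    by (intro sum.cong refl ghat_eq) (use b in auto)
  moreover have "(\<Sum>j<m. \<Sum>i<j. g (ang (j - i))) = 1/2 * (\<Sum>s=1..m-1. real m * g (2 * pi * real s / real m))"
  proof -
    have "(\<Sum>j<m. \<Sum>i<j. g (ang (j - i))) = (\<Sum>j<m. \<Sum>i<j. g (ang (j - i)) * (1/2) + g (ang (m - (j - i))) * (1/2))"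
    proof (intro sum.cong refl)
      fix j i assume "j \<in> {..<m}" "i \<in> {..<j}"
      then have ij: "j - i \<in> {1..m-1}" by auto
      have "g (ang (m - (j - i))) = g (ang (j - i))"
        using g_sym[of "ang (j - i)"] ang_bounds[OF ij] ang_compl[of "j - i"] ij by auto
      then show "g (ang (j - i)) = g (ang (j - i)) * (1/2) + g (ang (m - (j - i))) * (1/2)" by simp
    qed
    also have "\<dots> = (\<Sum>s=1..m-1. g (ang s)) * (\<Sum>j<m. 1/2)"
      using cyclic_pair_sum[of "\<lambda>s. g (ang s)" "\<lambda>_. 1/2" m] .
    finally show ?thesis by (simp add: ang_def sum_distrib_left mult.commute)
  qed
  moreover have "(\<Sum>j<m. \<Sum>i<j. gd (j - i) * ((b j - b i) - ang (j - i))) = 0"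
  proof -
    define v where "v i = b i - vertex i" for i
    have "(\<Sum>j<m. \<Sum>i<j. gd (j - i) * ((b j - b i) - ang (j - i))) =
      (\<Sum>j<m. \<Sum>i<j. gd (j - i) * v j + gd (m - (j - i)) * v i)"
    proof (intro sum.cong refl)
      fix j i assume "j \<in> {..<m}" "i \<in> {..<j}"
      then have ij: "j - i \<in> {1..m-1}" "i \<le> j" by auto
      show "gd (j - i) * ((b j - b i) - ang (j - i)) = gd (j - i) * v j + gd (m - (j - i)) * v i"
        using deriv_compl(1)[OF ij(1)] vertex_diff[OF ij(2)] by (simp add: v_def algebra_simps flip: vertex_diff[OF ij(2)])
    qed
    also have "\<dots> = (\<Sum>s=1..m-1. gd s) * (\<Sum>j<m. v j)" by (rule cyclic_pair_sum)
    also have "(\<Sum>s=1..m-1. gd s) = 0"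
    proof -
      have "(\<Sum>s=1..m-1. gd s) = (\<Sum>s=1..m-1. gd (m - s))"
        by (rule sum.reindex_bij_witness[of _ "\<lambda>s. m - s" "\<lambda>s. m - s"]) auto
      also have "\<dots> = - (\<Sum>s=1..m-1. gd s)"
        by (simp add: sum_negf[symmetric] deriv_compl(1))
      finally show ?thesis by simp
    qed
    finally show ?thesis by simp
  qed
  ultimately show ?thesis
    by (simp add: deficit_def h_def sum.distrib sum_subtractf)
qed

text \<open>The Laplacian identity. With \<open>w (m - 1) = 0\<close> the deleted row and column may
  be added back without changing the form.\<close>

lemma quad_form_Amat:
  assumes "w (m - 1) = 0"
  shows "Q w = (\<Sum>j<m. \<Sum>i<j. \<kappa> (j - i) * (w j - w i)\<^sup>2)"
proof -
  define F where "F i j = Amat i j * w i * w j" for i j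
  have F0: "F i j = 0" if "i = m - 1 \<or> j = m - 1" for i j using that assms by (auto simp: F_def)
  have "(\<Sum>i<m-1. \<Sum>j<m-1. F i j) = (\<Sum>i<m-1. \<Sum>j<m. F i j)"
    by (intro sum.cong refl sum.mono_neutral_left) (auto intro!: F0)
  also have "\<dots> = (\<Sum>i<m. \<Sum>j<m. F i j)"
    by (rule sum.mono_neutral_left) (auto intro!: sum.neutral F0)
  finally have "(\<Sum>i<m. \<Sum>j<m. F i j) = (\<Sum>i<m-1. \<Sum>j<m-1. F i j)" ..
  then have "Q w = (\<Sum>i<m. F i i) + (\<Sum>j<m. \<Sum>i<j. F i j + F j i)"
    unfolding quad_form_def F_def[symmetric] double_sum_split[symmetric] by simp
  also have "(\<Sum>i<m. F i i) = (\<Sum>s=1..m-1. \<kappa> s) * (\<Sum>j<m. (w j)\<^sup>2)"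
    by (simp add: F_def Amat_def sum_distrib_left power2_eq_square mult.assoc)
  also have "\<dots> = (\<Sum>j<m. \<Sum>i<j. \<kappa> (j - i) * (w j)\<^sup>2 + \<kappa> (m - (j - i)) * (w i)\<^sup>2)"
    by (rule cyclic_pair_sum[symmetric])
  also have "\<dots> + (\<Sum>j<m. \<Sum>i<j. F i j + F j i) = (\<Sum>j<m. \<Sum>i<j. \<kappa> (j - i) * (w j - w i)\<^sup>2)"
    unfolding sum.distrib[symmetric]
  proof (intro sum.cong refl)
    fix j i assume "j \<in> {..<m}" "i \<in> {..<j}"
    then have ij: "j - i \<in> {1..m-1}" "i < j" by auto
    show "\<kappa> (j - i) * (w j)\<^sup>2 + \<kappa> (m - (j - i)) * (w i)\<^sup>2 + (F i j + F j i) = \<kappa> (j - i) * (w j - w i)\<^sup>2"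
      using ij(2) deriv_compl(2)[OF ij(1)] by (simp add: F_def Amat_def algebra_simps power2_eq_square)
  qed
  finally show ?thesis .
qed

section \<open>Tangent gaps: positivity and second order expansion\<close>

lemma h_nonneg:
  assumes s: "s \<in> {1..m-1}" and x: "x \<in> {0..2*pi}"
  shows "h s x \<ge> 0"
proof -
  have "convex_on {0..2*pi} (\<lambda>x. - g x)"
  proof (rule convex_onI)
    fix t x y :: real assume *: "0 < t" "t < 1" "x \<in> {0..2*pi}" "y \<in> {0..2*pi}"
    show "- g ((1 - t) *\<^sub>R x + t *\<^sub>R y) \<le> (1 - t) * - g x + t * - g y"
    proof (cases "x = y")
      case False
      then show ?thesis using g_conc * unfolding strictly_concave_on_def by fastforce
    qed (simp add: algebra_simps)
  qed auto
  moreover have "((\<lambda>x. - g x) has_real_derivative - gd s) (at (ang s) within {0..2*pi})"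
    using DERIV_minus[OF deriv_g[OF s]] by (rule has_field_derivative_at_within)
  ultimately have "- g x - (- g (ang s)) \<ge> - gd s * (x - ang s)"
    using ang_bounds[OF s] x by (intro convex_on_imp_above_tangent[of "{0..2*pi}"]) auto
  then show ?thesis by (simp add: h_def)
qed

text \<open>The gap is strictly convex and vanishes at \<open>ang s\<close>; at the midpoint between
  x and \<open>ang s\<close> it is nonnegative and less than half of \<open>h s x\<close>.\<close>

lemma h_pos:
  assumes s: "s \<in> {1..m-1}" and x: "x \<in> {0..2*pi}" and ne: "x \<noteq> ang s"
  shows "h s x > 0"
proof -
  have a: "ang s \<in> {0..2*pi}" using ang_bounds[OF s] by auto
  have conc: "(1 - u) * g x + u * g y < g ((1 - u) * x + u * y)"
    if "x \<in> {0..2*pi}" "y \<in> {0..2*pi}" "x \<noteq> y" "0 < u" "u < 1" for x y u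
    using g_conc that unfolding strictly_concave_on_def by blast
  have "(1 - 1/2) * g x + 1/2 * g (ang s) < g ((1 - 1/2) * x + 1/2 * ang s)"
    using conc[OF x a ne, of "1/2"] by simp
  moreover have "h s ((1 - 1/2) * x + 1/2 * ang s) \<ge> 0"
    using x a by (intro h_nonneg[OF s]) auto
  ultimately show ?thesis by (simp add: h_def field_simps)
qed

text \<open>A positive continuous function on a compact set is bounded away from 0, and there are
  only finitely many s. If no point is that far away, any constant will do.\<close>

lemma h_away:
  assumes "\<delta> > 0"
  obtains c where "c > 0" "\<And>s x. s \<in> {1..m-1} \<Longrightarrow> x \<in> {0..2*pi} \<Longrightarrow> \<bar>x - ang s\<bar> \<ge> \<delta> \<Longrightarrow> h s x \<ge> c"
proof -
  have "\<exists>c>0. \<forall>x\<in>{0..2*pi}. \<bar>x - ang s\<bar> \<ge> \<delta> \<longrightarrow> h s x \<ge> c" if s: "s \<in> {1..m-1}" for s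
  proof -
    let ?K = "{0..2*pi} \<inter> {x. \<delta> \<le> \<bar>x - ang s\<bar>}"
    have K: "compact ?K"
      by (intro compact_Int_closed closed_Collect_le continuous_intros) auto
    have cont: "continuous_on ?K (h s)"
      unfolding h_def[abs_def] using continuous_on_subset[OF g_cont, of ?K] by (intro continuous_intros) auto
    show ?thesis
    proof (cases "?K = {}")
      case True
      then show ?thesis by (intro exI[of _ 1]) auto
    next
      case False
      from continuous_attains_inf[OF K this cont] obtain x0 where "x0 \<in> ?K" "\<forall>y\<in>?K. h s x0 \<le> h s y" by auto
      then show ?thesis using h_pos[OF s, of x0] assms by (intro exI[of _ "h s x0"]) auto
    qed
  qed
  then obtain c where c: "\<And>s. s \<in> {1..m-1} \<Longrightarrow> c s > 0"
    "\<And>s x. s \<in> {1..m-1} \<Longrightarrow> x \<in> {0..2*pi} \<Longrightarrow> \<bar>x - ang s\<bar> \<ge> \<delta> \<Longrightarrow> h s x \<ge> c s"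
    by metis
  have ne: "{1..m-1} \<noteq> {}" using m2 by auto
  show ?thesis
  proof (rule that[of "Min (c ` {1..m-1})"])
    show "Min (c ` {1..m-1}) > 0" using c(1) ne by (subst Min_gr_iff) auto
    fix s x assume s: "s \<in> {1..m-1}" and x: "x \<in> {0..2*pi}" "\<bar>x - ang s\<bar> \<ge> \<delta>"
    have "Min (c ` {1..m-1}) \<le> c s" using s by (intro Min_le) auto
    then show "h s x \<ge> Min (c ` {1..m-1})" using c(2)[OF s x] by linarith
  qed
qed

text \<open>The mean value theorem turns the first order expansion of \<open>deriv g\<close> at
  \<open>ang s\<close> into the second order expansion of the gap.\<close>

lemma h_taylor:
  assumes "\<eta> > 0"
  obtains \<delta> where "\<delta> > 0" "\<And>s d. s \<in> {1..m-1} \<Longrightarrow> \<bar>d\<bar> < \<delta> \<Longrightarrow> \<bar>h s (ang s + d) - \<kappa> s / 2 * d\<^sup>2\<bar> \<le> \<eta> * d\<^sup>2"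
proof -
  have "\<exists>\<delta>>0. \<forall>d. \<bar>d\<bar> < \<delta> \<longrightarrow> \<bar>h s (ang s + d) - \<kappa> s / 2 * d\<^sup>2\<bar> \<le> \<eta> * d\<^sup>2" if s: "s \<in> {1..m-1}" for s
  proof -
    obtain \<delta>1 where \<delta>1: "\<delta>1 > 0" "\<And>x. \<bar>x - ang s\<bar> < \<delta>1 \<Longrightarrow> (g has_real_derivative deriv g x) (at x)"
      using derivs(1)[OF s] unfolding eventually_nhds_metric dist_real_def by auto
    have "((\<lambda>d. (deriv g (ang s + d) - deriv g (ang s)) / d) \<longlongrightarrow> - \<kappa> s) (at 0)"
      using derivs(2)[OF s] by (simp add: DERIV_def)
    from LIM_D[OF this assms] obtain \<delta>2 where \<delta>2: "\<delta>2 > 0"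
      "\<And>d. d \<noteq> 0 \<Longrightarrow> \<bar>d\<bar> < \<delta>2 \<Longrightarrow> \<bar>(deriv g (ang s + d) - deriv g (ang s)) / d + \<kappa> s\<bar> < \<eta>"
      by auto
    define \<phi> where "\<phi> d = h s (ang s + d) - \<kappa> s / 2 * d\<^sup>2" for d
    define \<phi>' where "\<phi>' d = gd s - deriv g (ang s + d) - \<kappa> s * d" for d
    have der: "(\<phi> has_real_derivative \<phi>' d) (at d)" if "\<bar>d\<bar> < \<delta>1" for d
    proof -
      have "((\<lambda>d. g (ang s + d)) has_real_derivative deriv g (ang s + d)) (at d)"
        using has_real_derivative_affine[of g _ "ang s" 1 d] \<delta>1(2)[of "ang s + d"] that by simp
      then show ?thesis unfolding \<phi>_def[abs_def] \<phi>'_def h_def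
        by (auto intro!: derivative_eq_intros simp: algebra_simps)
    qed
    have bnd: "\<bar>\<phi>' d\<bar> \<le> \<eta> * \<bar>d\<bar>" if "\<bar>d\<bar> < \<delta>2" for d
    proof (cases "d = 0")
      case False
      have "\<phi>' d = - (((deriv g (ang s + d) - deriv g (ang s)) / d + \<kappa> s) * d)"
        using False by (simp add: \<phi>'_def gd_def distrib_right)
      then have "\<bar>\<phi>' d\<bar> = \<bar>(deriv g (ang s + d) - deriv g (ang s)) / d + \<kappa> s\<bar> * \<bar>d\<bar>"
        by (simp add: abs_mult)
      then show ?thesis using \<delta>2(2)[OF False that] by (simp add: mult_right_mono)
    qed (simp add: \<phi>'_def gd_def)
    have "\<bar>\<phi> d\<bar> \<le> \<eta> * d\<^sup>2" if d: "\<bar>d\<bar> < min \<delta>1 \<delta>2" for d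
    proof (cases "d = 0")
      case True
      then show ?thesis by (simp add: \<phi>_def h_def)
    next
      case False
      have "\<exists>z. \<bar>z\<bar> \<le> \<bar>d\<bar> \<and> \<phi> d - \<phi> 0 = d * \<phi>' z"
      proof (cases "d > 0")
        case True
        then obtain z where "0 < z" "z < d" "\<phi> d - \<phi> 0 = (d - 0) * \<phi>' z"
          using MVT2[of 0 d \<phi> \<phi>'] der d by auto
        then show ?thesis by (intro exI[of _ z]) auto
      next
        case neg: False
        then obtain z where "d < z" "z < 0" "\<phi> 0 - \<phi> d = (0 - d) * \<phi>' z"
          using MVT2[of d 0 \<phi> \<phi>'] der d False by auto
        then show ?thesis using neg by (intro exI[of _ z]) auto
      qed
      then obtain z where z: "\<bar>z\<bar> \<le> \<bar>d\<bar>" "\<phi> d - \<phi> 0 = d * \<phi>' z" by auto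
      have "\<bar>\<phi> d\<bar> = \<bar>d\<bar> * \<bar>\<phi>' z\<bar>" using z(2) by (simp add: \<phi>_def h_def abs_mult)
      also have "\<dots> \<le> \<bar>d\<bar> * (\<eta> * \<bar>z\<bar>)" using bnd[of z] z(1) d by (intro mult_left_mono) auto
      also have "\<dots> \<le> \<bar>d\<bar> * (\<eta> * \<bar>d\<bar>)" using z(1) assms by (intro mult_left_mono) auto
      also have "\<dots> = \<eta> * \<bar>d\<bar>\<^sup>2" by (simp only: power2_eq_square mult_ac)
      also have "\<dots> = \<eta> * d\<^sup>2" by simp
      finally show ?thesis .
    qed
    then show ?thesis using \<delta>1(1) \<delta>2(1) by (intro exI[of _ "min \<delta>1 \<delta>2"]) (auto simp: \<phi>_def)
  qed
  then obtain d0 where d0: "\<And>s. s \<in> {1..m-1} \<Longrightarrow> d0 s > 0"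
    "\<And>s d. s \<in> {1..m-1} \<Longrightarrow> \<bar>d\<bar> < d0 s \<Longrightarrow> \<bar>h s (ang s + d) - \<kappa> s / 2 * d\<^sup>2\<bar> \<le> \<eta> * d\<^sup>2"
    by metis
  have ne: "{1..m-1} \<noteq> {}" using m2 by auto
  show ?thesis
  proof (rule that[of "Min (d0 ` {1..m-1})"])
    show "Min (d0 ` {1..m-1}) > 0" using d0(1) ne by (subst Min_gr_iff) auto
    fix s d assume s: "s \<in> {1..m-1}" and d: "\<bar>d\<bar> < Min (d0 ` {1..m-1})"
    have "Min (d0 ` {1..m-1}) \<le> d0 s" using s by (intro Min_le) auto
    then have "\<bar>d\<bar> < d0 s" using d by linarith
    then show "\<bar>h s (ang s + d) - \<kappa> s / 2 * d\<^sup>2\<bar> \<le> \<eta> * d\<^sup>2" by (rule d0(2)[OF s])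
  qed
qed

lemma \<kappa>_nonneg:
  assumes s: "s \<in> {1..m-1}" shows "\<kappa> s \<ge> 0"
proof (rule ccontr)
  assume "\<not> \<kappa> s \<ge> 0"
  then obtain \<delta> where \<delta>: "\<delta> > 0" "\<And>d. \<bar>d\<bar> < \<delta> \<Longrightarrow> \<bar>h s (ang s + d) - \<kappa> s / 2 * d\<^sup>2\<bar> \<le> (- \<kappa> s / 4) * d\<^sup>2"
    using h_taylor[of "- \<kappa> s / 4"] s by (metis divide_pos_pos neg_0_less_iff_less not_le zero_less_numeral)
  \<comment> \<open>A negative \<kappa> would make the gap at \<open>ang s + d\<close> at most
    \<open>\<kappa> s / 4 * d^2 < 0\<close>; the minimum keeps this point in the domain of
    g.\<close>
  define d where "d = min (\<delta> / 2) (2 * pi - ang s)"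
  have d: "0 < d" "d < \<delta>" "ang s + d \<le> 2 * pi" using \<delta>(1) ang_bounds[OF s] by (auto simp: d_def)
  have "h s (ang s + d) \<ge> 0" using d ang_bounds[OF s] by (intro h_nonneg[OF s]) auto
  moreover have "h s (ang s + d) \<le> \<kappa> s / 4 * d\<^sup>2" using \<delta>(2)[of d] d by (auto simp: algebra_simps)
  moreover have "\<kappa> s / 4 * d\<^sup>2 < 0" using \<open>\<not> \<kappa> s \<ge> 0\<close> d by (intro mult_neg_pos) auto
  ultimately show False by linarith
qed

lemma quad_form_Amat_nonneg: "Q x \<ge> 0"
proof -
  define w where "w = x(m - 1 := 0)"
  have "Q x = Q w"
    by (rule quad_form_cong) (auto simp: w_def)
  also have "\<dots> = (\<Sum>j<m. \<Sum>i<j. \<kappa> (j - i) * (w j - w i)\<^sup>2)"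
    by (rule quad_form_Amat) (simp add: w_def)
  also have "\<dots> \<ge> 0"
    by (intro sum_nonneg mult_nonneg_nonneg \<kappa>_nonneg) auto
  finally show ?thesis .
qed

section \<open>Quadratic behaviour of the deficit near regular polygons\<close>

text \<open>For fixed y finitely many gaps are involved, each with its second order expansion. The
  pointwise limit is what dominated convergence asks for.\<close>

lemma deficit_near_vertices:
  assumes y: "y (m - 1) = 0"
  shows "((\<lambda>s. deficit (\<lambda>i. vertex i + s * y i) / s\<^sup>2) \<longlongrightarrow> Q y / 2) (at_right 0)"
proof (rule tendstoI)
  fix e :: real assume e: "e > 0"
  define B where "B = (\<Sum>j<m. \<Sum>i<j. (y j - y i)\<^sup>2)"
  have B0: "B \<ge> 0" unfolding B_def by (intro sum_nonneg) auto
  define \<eta> where "\<eta> = e / (B + 1) / 2"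
  have "\<eta> > 0" using e B0 by (simp add: \<eta>_def)
  from h_taylor[OF this] obtain \<delta> where \<delta>: "\<delta> > 0"
    "\<And>s d. s \<in> {1..m-1} \<Longrightarrow> \<bar>d\<bar> < \<delta> \<Longrightarrow> \<bar>h s (ang s + d) - \<kappa> s / 2 * d\<^sup>2\<bar> \<le> \<eta> * d\<^sup>2" by metis
  define Y where "Y = 1 + (\<Sum>j<m. \<bar>y j\<bar>)"
  have Y: "\<bar>y j - y i\<bar> \<le> 2 * Y" if "i < m" "j < m" for i j
    using member_le_sum[of i "{..<m}" "\<lambda>j. \<bar>y j\<bar>"] member_le_sum[of j "{..<m}" "\<lambda>j. \<bar>y j\<bar>"] that
    by (auto simp: Y_def)
  have Ypos: "Y > 0" unfolding Y_def by (intro add_pos_nonneg sum_nonneg) auto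
  \<comment> \<open>2 pi / m is the distance of the extreme ideal differences from 0 and 2 pi;
    deviations below it keep the angles ordered within one turn, as \<open>deficit_eq\<close>
    demands.\<close>
  define \<delta>' where "\<delta>' = min \<delta> (2 * pi / m)"
  have \<delta>': "\<delta>' > 0" using \<delta>(1) m2 by (simp add: \<delta>'_def)
  have "eventually (\<lambda>s. s < \<delta>' / (2 * Y)) (at_right 0)" "eventually (\<lambda>s. s > (0::real)) (at_right 0)"
    using order_tendstoD(2)[OF tendsto_ident_at[of "0::real" "{0<..}"], of "\<delta>' / (2 * Y)"] \<delta>' Ypos eventually_at_right_less[of "0::real"]
    by auto
  then show "eventually (\<lambda>s. dist (deficit (\<lambda>i. vertex i + s * y i) / s\<^sup>2) (Q y / 2) < e) (at_right 0)"
  proof eventually_elim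
    case (elim s)
    have small: "\<bar>s * (y j - y i)\<bar> < \<delta>'" if "i < m" "j < m" for i j
    proof -
      have "\<bar>s * (y j - y i)\<bar> \<le> s * (2 * Y)" using Y[OF that] elim by (simp add: abs_mult)
      also have "\<dots> < \<delta>'" using elim Ypos by (simp add: field_simps)
      finally show ?thesis .
    qed
    have diff: "(vertex j + s * y j) - (vertex i + s * y i) = ang (j - i) + s * (y j - y i)" if "i \<le> j" for i j
      using vertex_diff[OF that] by (simp add: algebra_simps)
    have "deficit (\<lambda>i. vertex i + s * y i) = (\<Sum>j<m. \<Sum>i<j. h (j - i) ((vertex j + s * y j) - (vertex i + s * y i)))"
    proof (rule deficit_eq)
      fix i j assume ij: "i < j" "j < m"
      then have r: "1 \<le> real (j - i)" "real (j - i) \<le> real m - 1" by auto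
      have "2 * pi * 1 \<le> 2 * pi * real (j - i)" using r by (intro mult_left_mono) auto
      then have 1: "2 * pi / m \<le> ang (j - i)"
        using m2 by (simp add: ang_def divide_right_mono)
      have "2 * pi * real (j - i) \<le> 2 * pi * (real m - 1)" using r by (intro mult_left_mono) auto
      then have "ang (j - i) \<le> 2 * pi * (real m - 1) / m"
        using m2 by (simp add: ang_def divide_right_mono)
      then have 2: "ang (j - i) \<le> 2 * pi - 2 * pi / m"
        using m2 by (simp add: field_simps)
      show "0 \<le> (vertex j + s * y j) - (vertex i + s * y i) \<and> (vertex j + s * y j) - (vertex i + s * y i) \<le> 2 * pi"
        using small[of i j] ij 1 2 by (subst (1 2) diff) (auto simp: \<delta>'_def)
    qed
    also have "\<dots> = (\<Sum>j<m. \<Sum>i<j. h (j - i) (ang (j - i) + s * (y j - y i)))"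
      by (intro sum.cong refl) (simp add: diff)
    finally have eq: "deficit (\<lambda>i. vertex i + s * y i) / s\<^sup>2 - Q y / 2 =
      (\<Sum>j<m. \<Sum>i<j. h (j - i) (ang (j - i) + s * (y j - y i)) / s\<^sup>2 - \<kappa> (j - i) / 2 * (y j - y i)\<^sup>2)"
      unfolding quad_form_Amat[of y, OF y] by (simp add: sum_divide_distrib sum_subtractf)
    have "\<bar>deficit (\<lambda>i. vertex i + s * y i) / s\<^sup>2 - Q y / 2\<bar> \<le> (\<Sum>j<m. \<Sum>i<j. \<bar>h (j - i) (ang (j - i) + s * (y j - y i)) / s\<^sup>2 - \<kappa> (j - i) / 2 * (y j - y i)\<^sup>2\<bar>)"
      unfolding eq by (rule order_trans[OF sum_abs], rule sum_mono, rule sum_abs)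
    also have "\<dots> \<le> (\<Sum>j<m. \<Sum>i<j. \<eta> * (y j - y i)\<^sup>2)"
    proof (rule sum_mono, rule sum_mono)
      fix j i assume "j \<in> {..<m}" "i \<in> {..<j}"
      then have ij: "j - i \<in> {1..m-1}" "i < m" "j < m" by auto
      define d where "d = y j - y i"
      define H where "H = h (j - i) (ang (j - i) + s * d)"
      have s: "s\<^sup>2 > 0" using elim by simp
      have "\<bar>H - \<kappa> (j - i) / 2 * (s * d)\<^sup>2\<bar> \<le> \<eta> * (s * d)\<^sup>2"
        unfolding H_def using small[OF ij(2,3)] by (intro \<delta>(2)[OF ij(1)]) (simp add: \<delta>'_def d_def)
      then have "\<bar>H - \<kappa> (j - i) / 2 * (s * d)\<^sup>2\<bar> / s\<^sup>2 \<le> \<eta> * (s * d)\<^sup>2 / s\<^sup>2"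
        using s by (intro divide_right_mono) auto
      also have "\<eta> * (s * d)\<^sup>2 / s\<^sup>2 = \<eta> * d\<^sup>2" using s by (simp add: power_mult_distrib)
      also have "\<bar>H - \<kappa> (j - i) / 2 * (s * d)\<^sup>2\<bar> / s\<^sup>2 = \<bar>(H - \<kappa> (j - i) / 2 * (s * d)\<^sup>2) / s\<^sup>2\<bar>"
        by simp
      also have "(H - \<kappa> (j - i) / 2 * (s * d)\<^sup>2) / s\<^sup>2 = H / s\<^sup>2 - \<kappa> (j - i) / 2 * d\<^sup>2"
        using s by (simp add: diff_divide_distrib power_mult_distrib)
      finally show "\<bar>h (j - i) (ang (j - i) + s * (y j - y i)) / s\<^sup>2 - \<kappa> (j - i) / 2 * (y j - y i)\<^sup>2\<bar> \<le> \<eta> * (y j - y i)\<^sup>2"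
        by (simp add: H_def d_def)
    qed
    also have "\<dots> = \<eta> * B" by (simp add: B_def sum_distrib_left)
    also have "\<dots> \<le> e / 2"
      using e B0 by (simp add: \<eta>_def field_simps)
    finally show ?case using e by (simp add: dist_real_def)
  qed
qed

text \<open>After sorting, every summand of \<open>deficit_eq\<close> is nonnegative, so a small deficit forces every
  pair close to its ideal position; the second order expansion then bounds the distance.\<close>
lemma small_deficit_near_regular:
  assumes det: "Determinant.det (- G_mat g m) \<noteq> 0"
  obtains R z0 where "R > 0" "z0 > 0"
    "\<And>z x. deficit x \<le> z \<Longrightarrow> z \<le> z0 \<Longrightarrow>
       \<exists>\<sigma>. \<sigma> permutes {..<m-1} \<and> (\<forall>i<m-1. \<exists>n::int. \<bar>x (\<sigma> i) - x (m - 1) - vertex i - 2 * pi * of_int n\<bar> \<le> R * sqrt z)"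
    "\<And>x i. i < m - 1 \<Longrightarrow> Q x \<le> 2 \<Longrightarrow> \<bar>x i\<bar> \<le> R"
proof -
  obtain C where C: "C > 0" "\<And>x i. i < m - 1 \<Longrightarrow> (x i)\<^sup>2 \<le> C * Q x"
    using psd_coercive[OF Amat_sym quad_form_Amat_nonneg det[unfolded minus_G_mat]] by metis
  \<comment> \<open>At most \<open>m^2\<close> pairs, each with squared difference at most
    \<open>4 * C * Q w\<close>, then have a total expansion error of \<open>Q w / 4\<close>, half of
    the main term \<open>Q w / 2\<close>.\<close>
  define \<eta> where "\<eta> = 1 / (16 * real m ^ 2 * C)"
  have "\<eta> > 0" using C m2 by (simp add: \<eta>_def)
  from h_taylor[OF this] obtain \<delta> where \<delta>: "\<delta> > 0"
    "\<And>s d. s \<in> {1..m-1} \<Longrightarrow> \<bar>d\<bar> < \<delta> \<Longrightarrow> \<bar>h s (ang s + d) - \<kappa> s / 2 * d\<^sup>2\<bar> \<le> \<eta> * d\<^sup>2" by metis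
  from h_away[OF \<delta>(1)] obtain c where c: "c > 0"
    "\<And>s x. s \<in> {1..m-1} \<Longrightarrow> x \<in> {0..2*pi} \<Longrightarrow> \<bar>x - ang s\<bar> \<ge> \<delta> \<Longrightarrow> h s x \<ge> c" by metis
  \<comment> \<open>The estimate below gives \<open>Q w \<le> 4 * z\<close>, hence deviations of at
    most \<open>sqrt (C * (4 * z))\<close>.\<close>
  define R where "R = 2 * sqrt C"
  have main: "\<exists>\<sigma>. \<sigma> permutes {..<m-1} \<and> (\<forall>i<m-1. \<exists>n::int. \<bar>x (\<sigma> i) - x (m - 1) - vertex i - 2 * pi * of_int n\<bar> \<le> R * sqrt z)"
    if x: "deficit x \<le> z" and z: "z \<le> c / 2" for x z
  proof -
    define \<beta> where "\<beta> i = circ (x i - x (m - 1))" for i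
    obtain \<sigma> where \<sigma>: "\<sigma> permutes {..<m-1}" "\<And>i j. i \<le> j \<Longrightarrow> j < m - 1 \<Longrightarrow> \<beta> (\<sigma> i) \<le> \<beta> (\<sigma> j)"
      using ex_sorting_permutation[of "m - 1" \<beta>] by metis
    \<comment> \<open>The base point is placed at 2 pi, the end of the turn, and not at 0, so that
      it comes last in increasing order like its vertex.\<close>
    define b where "b i = (if i < m - 1 then \<beta> (\<sigma> i) else 2 * pi)" for i
    have \<sigma>m: "\<sigma> permutes {..<m}" by (rule permutes_subset[OF \<sigma>(1)]) auto
    have \<sigma>l: "\<sigma> (m - 1) = m - 1" using permutes_not_in[OF \<sigma>(1)] by auto
    have bn: "\<exists>n::int. x (\<sigma> i) - b i = x (m - 1) + 2 * pi * of_int n" if "i < m" for i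
    proof (cases "i < m - 1")
      case True
      obtain n where "circ (x (\<sigma> i) - x (m - 1)) - (x (\<sigma> i) - x (m - 1)) = 2 * pi * of_int n" by (rule circ_diff_int)
      then show ?thesis using True by (intro exI[of _ "- n"]) (simp add: b_def \<beta>_def)
    next
      case False
      then have "i = m - 1" using that by auto
      then show ?thesis using \<sigma>l by (intro exI[of _ "-1"]) (simp add: b_def)
    qed
    have "deficit x = deficit (\<lambda>i. x (\<sigma> i))" by (rule deficit_permute[OF \<sigma>m, symmetric])
    also have "\<dots> = deficit b" by (rule deficit_cong) (use bn in auto)
    finally have Db: "deficit b \<le> z" using x by simp
    have \<beta>b: "0 \<le> \<beta> i" "\<beta> i < 2 * pi" for i by (simp_all add: \<beta>_def circ_bounds)
    have b: "0 \<le> b j - b i \<and> b j - b i \<le> 2 * pi" if "i < j" "j < m" for i j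
      using that \<sigma>(2)[of i j] \<beta>b[of "\<sigma> i"] \<beta>b[of "\<sigma> j"] by (auto simp: b_def)
    have sums: "deficit b = (\<Sum>j<m. \<Sum>i<j. h (j - i) (b j - b i))" by (rule deficit_eq[OF b])
    have hn: "h (j - i) (b j - b i) \<ge> 0" if "i < j" "j < m" for i j
      using b[OF that] that by (intro h_nonneg) auto
    have close: "\<bar>(b j - b i) - ang (j - i)\<bar> < \<delta>" if ij: "i < j" "j < m" for i j
    proof (rule ccontr)
      assume "\<not> ?thesis"
      \<comment> \<open>One pair off by \<delta> would contribute a gap of at least c, and the other
        gaps cannot compensate it, so the deficit would exceed \<open>c / 2\<close>.\<close>
      then have "c \<le> h (j - i) (b j - b i)" using b[OF ij] ij by (intro c(2)) auto
      also have "\<dots> \<le> (\<Sum>i<j. h (j - i) (b j - b i))"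
        using ij hn by (intro member_le_sum[of i "{..<j}" "\<lambda>i. h (j - i) (b j - b i)"]) auto
      also have "\<dots> \<le> (\<Sum>j<m. \<Sum>i<j. h (j - i) (b j - b i))"
        using ij hn by (intro member_le_sum[of j "{..<m}" "\<lambda>j. \<Sum>i<j. h (j - i) (b j - b i)"] sum_nonneg) auto
      finally show False using Db z c(1) sums by linarith
    qed
    define w where "w i = b i - vertex i" for i
    have wl: "w (m - 1) = 0" using vertex_last by (simp add: w_def b_def)
    have wQ: "(w i)\<^sup>2 \<le> C * Q w" if "i < m" for i
    proof (cases "i < m - 1")
      case False
      then have "i = m - 1" using that by auto
      then show ?thesis using wl C(1) quad_form_Amat_nonneg[of w] by simp
    qed (rule C(2))
    have "Q w / 2 - real m ^ 2 * (\<eta> * (4 * C * Q w)) \<le> deficit b"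
    proof -
      have "(\<Sum>j<m. \<Sum>i<j. \<kappa> (j - i) / 2 * (w j - w i)\<^sup>2 - \<eta> * (4 * C * Q w)) \<le> deficit b"
        unfolding sums
      proof (intro sum_mono)
        fix j i assume "j \<in> {..<m}" "i \<in> {..<j}"
        then have ij: "j - i \<in> {1..m-1}" "i < j" "j < m" "i < m" by auto
        have d: "(b j - b i) - ang (j - i) = w j - w i" using vertex_diff[of i j] ij by (simp add: w_def)
        have "\<bar>h (j - i) (ang (j - i) + (w j - w i)) - \<kappa> (j - i) / 2 * (w j - w i)\<^sup>2\<bar> \<le> \<eta> * (w j - w i)\<^sup>2"
          using close[OF ij(2,3)] by (intro \<delta>(2)[OF ij(1)]) (simp add: d)
        moreover have "ang (j - i) + (w j - w i) = b j - b i" using d by simp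
        ultimately have "\<kappa> (j - i) / 2 * (w j - w i)\<^sup>2 - \<eta> * (w j - w i)\<^sup>2 \<le> h (j - i) (b j - b i)" by simp
        moreover have "(w j - w i)\<^sup>2 \<le> 4 * C * Q w"
        proof -
          have "(w j - w i)\<^sup>2 \<le> 2 * (w j)\<^sup>2 + 2 * (w i)\<^sup>2"
            using zero_le_power2[of "w j + w i"] by (simp add: power2_eq_square algebra_simps)
          then show ?thesis using wQ[OF ij(3)] wQ[OF ij(4)] by linarith
        qed
        then have "\<eta> * (w j - w i)\<^sup>2 \<le> \<eta> * (4 * C * Q w)" using \<open>\<eta> > 0\<close> by (intro mult_left_mono) auto
        ultimately show "\<kappa> (j - i) / 2 * (w j - w i)\<^sup>2 - \<eta> * (4 * C * Q w) \<le> h (j - i) (b j - b i)" by linarith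
      qed
      moreover have "(\<Sum>j<m. \<Sum>i<j. \<kappa> (j - i) / 2 * (w j - w i)\<^sup>2 - \<eta> * (4 * C * Q w)) =
        Q w / 2 - (\<Sum>j<m. \<Sum>i<j. \<eta> * (4 * C * Q w))"
        unfolding quad_form_Amat[of w, OF wl] by (simp add: sum_subtractf sum_divide_distrib)
      moreover have "(\<Sum>j<m. \<Sum>i<j. \<eta> * (4 * C * Q w)) \<le> real m ^ 2 * (\<eta> * (4 * C * Q w))"
      proof -
        have "(\<Sum>j<m. \<Sum>i<j. N) \<le> real m ^ 2 * N" if "N \<ge> 0" for N :: real
        proof -
          have "(\<Sum>j<m. \<Sum>i<j. N) \<le> (\<Sum>j<m. real m * N)"
            by (rule sum_mono) (use that in \<open>simp add: mult_right_mono\<close>)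
          then show ?thesis by (simp add: power2_eq_square mult.assoc)
        qed
        then show ?thesis using \<open>\<eta> > 0\<close> C(1) quad_form_Amat_nonneg[of w] by simp
      qed
      ultimately show ?thesis by linarith
    qed
    moreover have "real m ^ 2 * (\<eta> * (4 * C * Q w)) = Q w / 4"
      using C(1) m2 by (simp add: \<eta>_def field_simps)
    ultimately have Qz: "Q w \<le> 4 * z" using Db by linarith
    have "\<exists>n::int. \<bar>x (\<sigma> i) - x (m - 1) - vertex i - 2 * pi * of_int n\<bar> \<le> R * sqrt z" if i: "i < m - 1" for i
    proof -
      have im: "i < m" using i by simp
      obtain n :: int where n: "x (\<sigma> i) - b i = x (m - 1) + 2 * pi * of_int n" using bn[OF im] by blast
      then have "x (\<sigma> i) - x (m - 1) - vertex i - 2 * pi * of_int n = w i" by (simp add: w_def)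
      moreover have "(w i)\<^sup>2 \<le> C * (4 * z)" using wQ[OF im] mult_left_mono[OF Qz, of C] C(1) by linarith
      then have "\<bar>w i\<bar> \<le> sqrt (C * (4 * z))" using real_sqrt_le_mono by fastforce
      moreover have "sqrt (C * (4 * z)) = R * sqrt z" by (simp add: R_def real_sqrt_mult)
      ultimately show ?thesis by (intro exI[of _ n]) simp
    qed
    then show ?thesis using \<sigma>(1) by auto
  qed
  have "\<bar>x i\<bar> \<le> R" if "i < m - 1" "Q x \<le> 2" for x i
  proof -
    have "(x i)\<^sup>2 \<le> C * 2" using C(2)[OF that(1), of x] mult_left_mono[OF that(2), of C] C(1) by linarith
    then have "\<bar>x i\<bar> \<le> sqrt (C * 2)" using real_sqrt_le_mono by fastforce
    also have "\<dots> \<le> sqrt (C * 4)" using C(1) by simp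
    also have "\<dots> = R" by (simp add: R_def real_sqrt_mult)
    finally show ?thesis .
  qed
  then show ?thesis using that[of R "c / 2"] main C(1) c(1) by (auto simp: R_def)
qed

end

section \<open>Asymptotics for one tuple\<close>

lemma two_pi_multiple_small:
  assumes "\<bar>y - 2 * pi * of_int n\<bar> \<le> \<rho>" "\<bar>y\<bar> \<le> pi" "\<rho> < pi"
  shows "n = 0"
proof (rule ccontr)
  assume "n \<noteq> 0"
  then have "1 \<le> \<bar>of_int n :: real\<bar>" by linarith
  then have "2 * pi * 1 \<le> 2 * pi * \<bar>of_int n :: real\<bar>" by (intro mult_left_mono) auto
  also have "\<dots> = \<bar>2 * pi * of_int n\<bar>" by (simp add: abs_mult)
  finally show False using assms by linarith
qed

locale concave_kernel_density = concave_kernel +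
  fixes p :: "real \<Rightarrow> real"
  assumes p_cont: "continuous_on UNIV p"
    and p_per: "\<And>x. p (x + 2 * pi) = p x"
    and p_nonneg: "\<And>x. p x \<ge> 0"
    and p_int: "integral {0..2*pi} p = 1"
begin

lemma measurable_p [measurable]: "p \<in> borel_measurable borel"
  using p_cont by (rule borel_measurable_continuous_onI)

lemma p_isCont: "isCont p x"
  using p_cont by (simp add: continuous_on_eq_continuous_at)

lemma p_bounded: obtains B where "B > 0" "\<And>x. p x \<le> B"
proof -
  have "compact (p ` {0..2*pi})"
    by (rule compact_continuous_image) (auto intro: continuous_on_subset[OF p_cont])
  then obtain B where B: "\<And>x. x \<in> {0..2*pi} \<Longrightarrow> norm (p x) \<le> B"
    by (metis compact_imp_bounded bounded_iff imageI)
  have "p x \<le> max B 1" for x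
  proof -
    obtain n where "circ x - x = 2 * pi * of_int n" by (rule circ_diff_int)
    then have "circ x = x + 2 * pi * of_int n" by simp
    then have "p (circ x) = p x" using periodic_shift_int[of p x n, OF p_per] by simp
    then show ?thesis using B[of "circ x"] circ_bounds[of x] by auto
  qed
  then show ?thesis using that[of "max B 1"] by auto
qed

abbreviation \<mu> :: "real measure" where "\<mu> \<equiv> circ_measure p"

lemma nn_integral_period_eq:
  assumes f: "continuous_on {0..2*pi} f" and nonneg: "\<And>x. f x \<ge> (0::real)" and [measurable]: "f \<in> borel_measurable borel"
  shows "(\<integral>\<^sup>+x. ennreal (f x) * indicator {0..<2*pi} x \<partial>lborel) = ennreal (integral {0..2*pi} f)"
proof -
  have "(f has_integral integral {0..2*pi} f) {0..2*pi}"
    using integrable_continuous_interval[OF f] by (rule integrable_integral)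
  then have "((\<lambda>x. if x \<in> {0..2*pi} then f x else 0) has_integral integral {0..2*pi} f) UNIV"
    by (simp only: has_integral_restrict_UNIV)
  then have "(\<integral>\<^sup>+x. ennreal (if x \<in> {0..2*pi} then f x else 0) \<partial>lborel) = ennreal (integral {0..2*pi} f)"
    using nonneg by (intro nn_integral_has_integral_lborel) auto
  moreover have "(\<integral>\<^sup>+x. ennreal (f x) * indicator {0..<2*pi} x \<partial>lborel) = (\<integral>\<^sup>+x. ennreal (if x \<in> {0..2*pi} then f x else 0) \<partial>lborel)"
  proof (rule nn_integral_cong_AE)
    have "AE x in lborel. x \<noteq> 2 * pi" by (rule AE_lborel_singleton)
    then show "AE x in lborel. ennreal (f x) * indicator {0..<2*pi} x = ennreal (if x \<in> {0..2*pi} then f x else 0)"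
      by eventually_elim (auto simp: indicator_def)
  qed
  ultimately show ?thesis by simp
qed

lemma prob_space_mu: "prob_space \<mu>"
proof
  have "emeasure \<mu> (space \<mu>) = (\<integral>\<^sup>+x. ennreal (p x * indicator {0..<2*pi} x) \<partial>lborel)"
    unfolding circ_measure_def by (subst emeasure_density) auto
  also have "\<dots> = (\<integral>\<^sup>+x. ennreal (p x) * indicator {0..<2*pi} x \<partial>lborel)"
    by (rule nn_integral_cong) (auto simp: indicator_def)
  also have "\<dots> = 1"
    using nn_integral_period_eq[of p] p_cont p_nonneg p_int by (simp add: continuous_on_subset)
  finally show "emeasure \<mu> (space \<mu>) = 1" .
qed

sublocale mu: prob_space \<mu> by (rule prob_space_mu)

text \<open>In the chart around c only one translate of the target interval meets the window,
  because \<rho> < pi.\<close>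

lemma emeasure_mu_near:
  assumes B: "\<And>x. p x \<le> B" and \<rho>: "0 \<le> \<rho>" "\<rho> < pi"
  shows "emeasure \<mu> {b. \<exists>n::int. \<bar>b - c - 2 * pi * of_int n\<bar> \<le> \<rho>} \<le> ennreal (2 * B * \<rho>)"
proof -
  let ?S = "{b. \<exists>n::int. \<bar>b - c - 2 * pi * of_int n\<bar> \<le> \<rho>}"
  have B0: "B \<ge> 0" using p_nonneg B order_trans by blast
  have [measurable]: "?S \<in> sets borel" by measurable
  have "emeasure \<mu> ?S = (\<integral>\<^sup>+x. indicator ?S x \<partial>\<mu>)" by simp
  also have "\<dots> = (\<integral>\<^sup>+y. indicator ?S (circ (c + 1 * y)) * (ennreal (1 * p (c + 1 * y)) * indicator {-pi..<pi} (1 * y)) \<partial>lborel)"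
    by (rule nn_integral_circ_measure) (auto simp: p_per p_nonneg)
  also have "\<dots> \<le> (\<integral>\<^sup>+y. ennreal B * indicator {-\<rho>..\<rho>} y \<partial>lborel)"
  proof (rule nn_integral_mono)
    fix y
    show "indicator ?S (circ (c + 1 * y)) * (ennreal (1 * p (c + 1 * y)) * indicator {-pi..<pi} (1 * y)) \<le> ennreal B * indicator {-\<rho>..\<rho>} y"
    proof (cases "circ (c + y) \<in> ?S \<and> y \<in> {-pi..<pi}")
      case True
      then obtain n :: int where n: "\<bar>circ (c + y) - c - 2 * pi * of_int n\<bar> \<le> \<rho>" by auto
      obtain n' where "circ (c + y) - (c + y) = 2 * pi * of_int n'" by (rule circ_diff_int)
      then have "\<bar>y - 2 * pi * of_int (n - n')\<bar> \<le> \<rho>" using n by (simp add: algebra_simps)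
      moreover from this have "n - n' = 0" by (rule two_pi_multiple_small) (use True \<rho> in auto)
      ultimately have "y \<in> {-\<rho>..\<rho>}" by auto
      then show ?thesis using B[of "c + y"] by (auto simp: indicator_def ennreal_leI)
    qed (auto simp: indicator_def)
  qed
  also have "\<dots> = ennreal (2 * B * \<rho>)"
    using \<rho> B0 by (simp add: nn_integral_cmult ennreal_mult[symmetric] mult_ac)
  finally show ?thesis .
qed

section \<open>Tuples close to a regular polygon, with and without a fixed order\<close>

text \<open>Point i is assigned to vertex i as seen from the base point m - 1, whereas
  \<open>config\<close> allows every assignment. The closeness condition is the truncation that
  keeps the limiting volume finite.\<close>

definition config0 :: "real \<Rightarrow> real \<Rightarrow> (nat \<Rightarrow> real) set" where
  "config0 z r = {x\<in>space (PiM {..<m} (\<lambda>_. borel)). deficit x \<le> z \<and>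
     (\<forall>i\<in>{..<m-1}. \<exists>n::int. \<bar>x i - x (m - 1) - vertex i - 2 * pi * of_int n\<bar> \<le> r)}"

definition config :: "real \<Rightarrow> real \<Rightarrow> (nat \<Rightarrow> real) set" where
  "config z r = {x\<in>space (PiM {..<m} (\<lambda>_. borel)). deficit x \<le> z \<and>
     (\<exists>\<sigma>. \<sigma> permutes {..<m-1} \<and> (\<forall>i<m-1. \<exists>n::int. \<bar>x (\<sigma> i) - x (m - 1) - vertex i - 2 * pi * of_int n\<bar> \<le> r))}"

lemma sets_config0 [measurable]: "config0 z r \<in> sets (PiM {..<m} (\<lambda>_. borel))"
proof -
  have [measurable]: "(\<lambda>x. x i) \<in> borel_measurable (PiM {..<m} (\<lambda>_. borel :: real measure))" if "i \<in> {..<m-1}" for i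
    using that by (intro measurable_component_singleton) auto
  have [measurable]: "(\<lambda>x. x (m - 1)) \<in> borel_measurable (PiM {..<m} (\<lambda>_. borel :: real measure))"
    using m2 by (intro measurable_component_singleton) auto
  show ?thesis unfolding config0_def by measurable
qed

lemma permutes_fix_last:
  assumes "\<sigma> permutes {..<m-1}"
  shows "\<sigma> permutes {..<m}" "\<sigma> (m - 1) = m - 1"
  using permutes_subset[OF assms, of "{..<m}"] permutes_not_in[OF assms, of "m - 1"] by auto

definition reindex :: "(nat \<Rightarrow> nat) \<Rightarrow> (nat \<Rightarrow> real) \<Rightarrow> nat \<Rightarrow> real" where
  "reindex \<sigma> x = (\<lambda>i\<in>{..<m}. x (\<sigma> i))"

lemma measurable_reindex [measurable]:
  assumes "\<sigma> permutes {..<m-1}"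
  shows "reindex \<sigma> \<in> PiM {..<m} (\<lambda>_. borel) \<rightarrow>\<^sub>M PiM {..<m} (\<lambda>_. borel)"
  unfolding reindex_def[abs_def] using permutes_in_image[OF permutes_fix_last(1)[OF assms]]
  by (intro measurable_restrict measurable_component_singleton) auto

lemma deficit_restrict: "deficit (restrict x {..<m}) = deficit x"
  by (rule deficit_cong[where c = 0]) (auto intro!: exI[of _ 0])

lemma config_eq:
  "config z r = (\<Union>\<sigma>\<in>{\<sigma>. \<sigma> permutes {..<m-1}}. reindex \<sigma> -` config0 z r \<inter> space (PiM {..<m} (\<lambda>_. borel)))"
proof -
  have "x \<in> config z r \<longleftrightarrow> (\<exists>\<sigma>. \<sigma> permutes {..<m-1} \<and> reindex \<sigma> x \<in> config0 z r)"
    if "x \<in> space (PiM {..<m} (\<lambda>_. borel))" for x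
  proof -
    have "reindex \<sigma> x \<in> config0 z r \<longleftrightarrow> deficit x \<le> z \<and> (\<forall>i<m-1. \<exists>n::int. \<bar>x (\<sigma> i) - x (m - 1) - vertex i - 2 * pi * of_int n\<bar> \<le> r)"
      if \<sigma>: "\<sigma> permutes {..<m-1}" for \<sigma>
    proof -
      have "deficit (reindex \<sigma> x) = deficit x"
        unfolding reindex_def deficit_restrict by (rule deficit_permute[OF permutes_fix_last(1)[OF \<sigma>]])
      moreover have "reindex \<sigma> x (m - 1) = x (m - 1)"
        using permutes_fix_last(2)[OF \<sigma>] m2 by (simp add: reindex_def)
      moreover have "reindex \<sigma> x i = x (\<sigma> i)" if "i < m - 1" for i using that by (auto simp: reindex_def)
      moreover have "reindex \<sigma> x \<in> space (PiM {..<m} (\<lambda>_. borel))" by (simp add: reindex_def space_PiM)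
      ultimately show ?thesis by (auto simp: config0_def)
    qed
    then show ?thesis using that unfolding config_def by blast
  qed
  moreover have "config z r \<subseteq> space (PiM {..<m} (\<lambda>_. borel))" by (auto simp: config_def)
  ultimately show ?thesis by blast
qed

lemma sets_config [measurable]: "config z r \<in> sets (PiM {..<m} (\<lambda>_. borel))"
  unfolding config_eq
  by (intro sets.finite_UN finite_permutations measurable_sets[OF measurable_reindex]) auto

lemma sets_PiM_mu: "sets (PiM I (\<lambda>_. \<mu>)) = sets (PiM I (\<lambda>_. borel))"
  by (rule sets_PiM_cong) auto

text \<open>For \<open>r < \<pi> / m\<close> a configuration determines the order in which its points approximate the
  vertices, so the \<open>(m - 1)!\<close> orders contribute disjoint sets of equal measure.\<close>
lemma emeasure_config:
  assumes r: "r < pi / m"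
  shows "emeasure (PiM {..<m} (\<lambda>_. \<mu>)) (config z r) = ennreal (fact (m - 1)) * emeasure (PiM {..<m} (\<lambda>_. \<mu>)) (config0 z r)"
proof -
  let ?P = "{\<sigma>. \<sigma> permutes {..<m-1}}" and ?M = "PiM {..<m} (\<lambda>_. \<mu>)"
  let ?A = "\<lambda>\<sigma>. reindex \<sigma> -` config0 z r \<inter> space (PiM {..<m} (\<lambda>_. borel))"
  have space: "space ?M = space (PiM {..<m} (\<lambda>_. borel))" using sets_eq_imp_space_eq[OF sets_PiM_mu] .
  have sets: "?A \<sigma> \<in> sets ?M" if "\<sigma> \<in> ?P" for \<sigma>
    using measurable_sets[OF measurable_reindex sets_config0] that by (simp add: sets_PiM_mu)
  \<comment> \<open>Distinct vertices are at least 2 pi / m apart on the circle, which exceeds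
    \<open>2 * r\<close>; the divisibility argument says this in units of 2 pi / m.\<close>
  have unique: "i = j" if ij: "i < m - 1" "j < m - 1" and near: "\<bar>y - vertex i - 2 * pi * of_int a\<bar> \<le> r"
    "\<bar>y - vertex j - 2 * pi * of_int b\<bar> \<le> r" for y i j and a b :: int
  proof -
    have "2 * r < 2 * pi / m" using r by simp
    then have "\<bar>(vertex i + 2 * pi * of_int a) - (vertex j + 2 * pi * of_int b)\<bar> < 2 * pi / m"
      using near by linarith
    then have "\<bar>(vertex i - vertex j) + 2 * pi * of_int (a - b)\<bar> < 2 * pi / m"
      by (simp add: algebra_simps)
    moreover have "(vertex i - vertex j) + 2 * pi * of_int (a - b) = 2 * pi / m * of_int (int i - int j + int m * (a - b))"
      using m2 by (simp add: vertex_def field_simps)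
    ultimately have "2 * pi / m * \<bar>of_int (int i - int j + int m * (a - b))\<bar> < 2 * pi / m * 1"
      using m2 by (simp add: abs_mult)
    then have "\<bar>of_int (int i - int j + int m * (a - b)) :: real\<bar> < 1"
      using m2 by (subst (asm) mult_less_cancel_left_pos) auto
    then have "int i - int j + int m * (a - b) = 0" by linarith
    then have "int i - int j = int m * (b - a)" by (simp add: algebra_simps)
    then have "int m dvd (int i - int j)" by simp
    then have "int i - int j = 0" using ij dvd_imp_le_int[of "int i - int j" "int m"] by linarith
    then show ?thesis by simp
  qed
  have disj: "disjoint_family_on ?A ?P"
    unfolding disjoint_family_on_def
  proof (intro ballI impI, rule ccontr)
    fix \<sigma> \<tau> assume \<sigma>: "\<sigma> \<in> ?P" and \<tau>: "\<tau> \<in> ?P" and ne: "\<sigma> \<noteq> \<tau>" and "?A \<sigma> \<inter> ?A \<tau> \<noteq> {}"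
    then obtain x where x: "reindex \<sigma> x \<in> config0 z r" "reindex \<tau> x \<in> config0 z r" by auto
    have near: "\<exists>n::int. \<bar>(x (\<rho> i) - x (m - 1)) - vertex i - 2 * pi * of_int n\<bar> \<le> r"
      if "\<rho> \<in> ?P" "reindex \<rho> x \<in> config0 z r" "i < m - 1" for \<rho> i
    proof -
      have "reindex \<rho> x i = x (\<rho> i)" "reindex \<rho> x (m - 1) = x (m - 1)"
        using that permutes_fix_last(2)[of \<rho>] m2 by (auto simp: reindex_def)
      moreover have "\<exists>n::int. \<bar>reindex \<rho> x i - reindex \<rho> x (m - 1) - vertex i - 2 * pi * of_int n\<bar> \<le> r"
        using that(2,3) unfolding config0_def by blast
      ultimately show ?thesis by simp
    qed
    have "\<sigma> i = \<tau> i" for i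
    proof (cases "i < m - 1")
      case True
      \<comment> \<open>The point \<open>\<sigma> i\<close> is placed at vertex i by \<sigma> and at
        vertex j by \<tau>.\<close>
      define j where "j = inv_into UNIV \<tau> (\<sigma> i)"
      have j: "\<tau> j = \<sigma> i" "j < m - 1"
        using \<sigma> \<tau> True permutes_in_image[of \<sigma> "{..<m-1}" i] permutes_in_image[OF permutes_inv[of \<tau>], of "{..<m-1}" "\<sigma> i"]
        by (auto simp: j_def permutes_inverses)
      obtain a b :: int where "\<bar>(x (\<sigma> i) - x (m - 1)) - vertex i - 2 * pi * of_int a\<bar> \<le> r"
        "\<bar>(x (\<tau> j) - x (m - 1)) - vertex j - 2 * pi * of_int b\<bar> \<le> r"
        using near[OF \<sigma> x(1) True] near[OF \<tau> x(2) j(2)] by auto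
      then have "i = j" using unique[OF True j(2)] j(1) by metis
      then show ?thesis using j(1) by simp
    next
      case False
      then show ?thesis using \<sigma> \<tau> by (simp add: permutes_def)
    qed
    then show False using ne by auto
  qed
  have each: "emeasure ?M (?A \<sigma>) = emeasure ?M (config0 z r)" if \<sigma>: "\<sigma> \<in> ?P" for \<sigma>
  proof -
    have perm: "\<sigma> permutes {..<m}" using permutes_fix_last(1) \<sigma> by auto
    have "distr ?M ?M (reindex \<sigma>) = ?M"
      unfolding reindex_def[abs_def]
      by (rule distr_PiM_reindex[of "{..<m}" "\<lambda>_. \<mu>" \<sigma> "{..<m}", OF prob_space_mu permutes_inj_on[OF perm]])
         (use permutes_in_image[OF perm] in auto)
    then have "emeasure ?M (config0 z r) = emeasure (distr ?M ?M (reindex \<sigma>)) (config0 z r)" by simp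
    also have "\<dots> = emeasure ?M (reindex \<sigma> -` config0 z r \<inter> space ?M)"
      using measurable_reindex[of \<sigma>] \<sigma> sets_config0
      by (intro emeasure_distr) (auto simp: sets_PiM_mu cong: measurable_cong_sets)
    finally show ?thesis by (simp add: space)
  qed
  have "emeasure ?M (config z r) = (\<Sum>\<sigma>\<in>?P. emeasure ?M (?A \<sigma>))"
    unfolding config_eq using sets disj finite_permutations[of "{..<m-1}"]
    by (intro sum_emeasure[symmetric]) auto
  also have "\<dots> = (\<Sum>\<sigma>\<in>?P. emeasure ?M (config0 z r))" by (intro sum.cong refl each)
  also have "\<dots> = ennreal (fact (m - 1)) * emeasure ?M (config0 z r)"
    using card_permutations[of "{..<m-1}" "m - 1"] by (simp add: ennreal_of_nat_eq_real_of_nat)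
  finally show ?thesis .
qed

section \<open>Rescaling around a base point\<close>

text \<open>The box keeps the volume finite when Q is degenerate; if Q is positive definite, it
  contains the whole ellipsoid for large R.\<close>

definition boxed_ellipsoid :: "real \<Rightarrow> (nat \<Rightarrow> real) set" where
  "boxed_ellipsoid R = {y\<in>space Leb. Q y \<le> 2 \<and> (\<forall>i\<in>{..<m-1}. \<bar>y i\<bar> \<le> R)}"

definition Vol :: "real \<Rightarrow> ennreal" where
  "Vol R = emeasure Leb (boxed_ellipsoid R)"

text \<open>What remains for base angle a after the substitution
  \<open>x i = a + vertex i + s * y i\<close>, without the Jacobian. The points of
  \<open>Leb\<close> carry no base coordinate, so its deviation is set to 0 explicitly.\<close>

definition local_integrand :: "real \<Rightarrow> real \<Rightarrow> real \<Rightarrow> (nat \<Rightarrow> real) \<Rightarrow> ennreal" where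
  "local_integrand R s a y = (\<Prod>i<m-1. ennreal (p (a + vertex i + s * y i))) *
     indicator {y. (\<forall>i\<in>{..<m-1}. \<bar>y i\<bar> \<le> R) \<and> deficit (\<lambda>i. vertex i + s * (y(m - 1 := 0)) i) \<le> s\<^sup>2} y"

lemma measurable_local_integrand:
  "(\<lambda>z. local_integrand R s (fst z) (snd z)) \<in> borel_measurable (borel \<Otimes>\<^sub>M PiM {..<m-1} (\<lambda>_. borel))"
proof -
  let ?L = "PiM {..<m-1} (\<lambda>_. borel :: real measure)"
  have ins: "{..<m} = insert (m - 1) {..<m-1}" using m2 by auto
  have comp: "(\<lambda>y. y i) \<in> borel_measurable ?L" if "i < m - 1" for i
    using that by (intro measurable_component_singleton) auto
  have "(\<lambda>y. \<lambda>i\<in>{..<m}. vertex i + s * (y(m - 1 := 0)) i) \<in> ?L \<rightarrow>\<^sub>M PiM {..<m} (\<lambda>_. borel)"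
  proof (rule measurable_restrict)
    fix i assume "i \<in> {..<m}"
    then have "i < m - 1 \<or> i = m - 1" by auto
    then show "(\<lambda>y. vertex i + s * (y(m - 1 := 0)) i) \<in> ?L \<rightarrow>\<^sub>M borel"
      using comp by (auto intro!: borel_measurable_add borel_measurable_times)
  qed
  from measurable_compose[OF this measurable_deficit]
  have d: "(\<lambda>y. deficit (\<lambda>i. vertex i + s * (y(m - 1 := 0)) i)) \<in> borel_measurable ?L"
    unfolding deficit_restrict .
  have d' [measurable]: "(\<lambda>z. deficit (\<lambda>i. vertex i + s * ((snd z)(m - 1 := 0)) i)) \<in> borel_measurable (borel \<Otimes>\<^sub>M ?L)"
    by (rule measurable_compose[OF measurable_snd d])
  have c' [measurable]: "(\<lambda>z. snd z i) \<in> borel_measurable ((borel :: real measure) \<Otimes>\<^sub>M ?L)" if "i \<in> {..<m-1}" for i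
    using that by (intro measurable_compose[OF measurable_snd comp]) auto
  have "{z \<in> space (borel \<Otimes>\<^sub>M ?L). snd z \<in> {y. (\<forall>i\<in>{..<m-1}. \<bar>y i\<bar> \<le> R) \<and> deficit (\<lambda>i. vertex i + s * (y(m - 1 := 0)) i) \<le> s\<^sup>2}}
    \<in> sets ((borel :: real measure) \<Otimes>\<^sub>M ?L)"
    unfolding mem_Collect_eq by measurable
  from borel_measurable_indicator'[OF this]
  have "(\<lambda>z. indicator {y. (\<forall>i\<in>{..<m-1}. \<bar>y i\<bar> \<le> R) \<and> deficit (\<lambda>i. vertex i + s * (y(m - 1 := 0)) i) \<le> s\<^sup>2} (snd z) :: ennreal)
    \<in> borel_measurable ((borel :: real measure) \<Otimes>\<^sub>M ?L)" .
  moreover have "(\<lambda>z. \<Prod>i<m-1. ennreal (p (fst z + vertex i + s * snd z i))) \<in> borel_measurable ((borel :: real measure) \<Otimes>\<^sub>M ?L)"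
  proof (rule borel_measurable_prod_ennreal)
    fix i assume "i \<in> {..<m-1}"
    note c'[OF this, measurable]
    have "(\<lambda>z. fst z + vertex i + s * snd z i) \<in> borel_measurable ((borel :: real measure) \<Otimes>\<^sub>M ?L)" by measurable
    from measurable_compose[OF this measurable_p]
    show "(\<lambda>z. ennreal (p (fst z + vertex i + s * snd z i))) \<in> borel_measurable ((borel :: real measure) \<Otimes>\<^sub>M ?L)" by measurable
  qed
  ultimately show ?thesis unfolding local_integrand_def by (intro borel_measurable_times_ennreal)
qed

lemma sets_PiM_lborel: "sets (PiM I (\<lambda>_. lborel)) = sets (PiM I (\<lambda>_. borel :: real measure))"
  by (rule sets_PiM_cong) auto

lemma measurable_local_integrand1:
  "(\<lambda>y. local_integrand R s a y) \<in> borel_measurable Leb"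
proof -
  have "(\<lambda>y. (a, y)) \<in> PiM {..<m-1} (\<lambda>_. borel :: real measure) \<rightarrow>\<^sub>M borel \<Otimes>\<^sub>M PiM {..<m-1} (\<lambda>_. borel :: real measure)"
    by measurable
  from measurable_compose[OF this measurable_local_integrand]
  show ?thesis by (simp add: sets_PiM_lborel cong: measurable_cong_sets)
qed

lemma measurable_local_integrand2:
  "(\<lambda>a. \<integral>\<^sup>+y. local_integrand R s a y \<partial>Leb) \<in> borel_measurable borel"
proof -
  interpret L: product_sigma_finite "\<lambda>_::nat. lborel :: real measure" by standard
  interpret S: sigma_finite_measure "Leb"
    by (rule L.sigma_finite) auto
  have "sets ((borel :: real measure) \<Otimes>\<^sub>M Leb) = sets ((borel :: real measure) \<Otimes>\<^sub>M PiM {..<m-1} (\<lambda>_. borel :: real measure))"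
    by (rule sets_pair_measure_cong[OF refl sets_PiM_lborel])
  then show ?thesis
    using measurable_local_integrand
    by (intro S.borel_measurable_nn_integral) (simp add: case_prod_beta' cong: measurable_cong_sets)
qed

text \<open>For a fixed base angle, every other angle is written in the chart around its own vertex
  at scale s; the Jacobians give \<open>s ^ (m - 1)\<close>. The bound \<open>R * s < pi\<close>
  keeps the box inside the window of the chart and leaves one lattice translate.\<close>

lemma emeasure_config0:
  assumes s: "s > 0" and R: "R * s < pi"
  shows "emeasure (PiM {..<m} (\<lambda>_. \<mu>)) (config0 (s\<^sup>2) (R * s)) =
    ennreal (s ^ (m - 1)) * (\<integral>\<^sup>+a. \<integral>\<^sup>+y. local_integrand R s a y \<partial>Leb \<partial>\<mu>)"
proof -
  interpret P: product_sigma_finite "\<lambda>_. \<mu>" by standard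
  let ?E = "config0 (s\<^sup>2) (R * s)"
  have ins: "{..<m} = insert (m - 1) {..<m-1}" using m2 by auto
  have Em: "?E \<in> sets (PiM {..<m} (\<lambda>_. \<mu>))" using sets_config0 by (simp add: sets_PiM_mu)
  have "emeasure (PiM {..<m} (\<lambda>_. \<mu>)) ?E = (\<integral>\<^sup>+x. indicator ?E x \<partial>PiM {..<m} (\<lambda>_. \<mu>))"
    using Em by simp
  also have "\<dots> = (\<integral>\<^sup>+a. \<integral>\<^sup>+x. indicator ?E (x(m - 1 := a)) \<partial>PiM {..<m-1} (\<lambda>_. \<mu>) \<partial>\<mu>)"
    using Em unfolding ins by (intro P.product_nn_integral_insert_rev) auto
  also have "\<dots> = (\<integral>\<^sup>+a. ennreal (s ^ (m - 1)) * (\<integral>\<^sup>+y. local_integrand R s a y \<partial>Leb) \<partial>\<mu>)"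
  proof (rule nn_integral_cong)
    fix a
    let ?T = "\<lambda>i y. circ (a + vertex i + s * y)"
    let ?k = "\<lambda>i y. ennreal (s * p (a + vertex i + s * y)) * indicator {-pi..<pi} (s * y) :: ennreal"
    have upd: "(\<lambda>x. x(m - 1 := a)) \<in> PiM {..<m-1} (\<lambda>_. borel) \<rightarrow>\<^sub>M PiM {..<m} (\<lambda>_. borel :: real measure)"
      unfolding ins by (rule measurable_fun_upd[where J = "{..<m-1}"]) auto
    have "(\<integral>\<^sup>+x. indicator ?E (x(m - 1 := a)) \<partial>PiM {..<m-1} (\<lambda>_. \<mu>)) =
      (\<integral>\<^sup>+y. indicator ?E ((\<lambda>i\<in>{..<m-1}. ?T i (y i))(m - 1 := a)) * (\<Prod>i\<in>{..<m-1}. ?k i (y i)) \<partial>Leb)"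
    proof (rule nn_integral_PiM_substitution)
      show "sigma_finite_measure \<mu>" by (rule mu.sigma_finite_measure_axioms)
      show "(\<lambda>x. indicator ?E (x(m - 1 := a)) :: ennreal) \<in> borel_measurable (PiM {..<m-1} (\<lambda>_. borel))"
        by (rule measurable_compose[OF upd]) (use sets_config0 in measurable)
      show "(\<integral>\<^sup>+x. f x \<partial>\<mu>) = (\<integral>\<^sup>+y. f (?T i y) * ?k i y \<partial>lborel)" if "f \<in> borel_measurable borel" for f i
        by (rule nn_integral_circ_measure) (use that s in \<open>auto simp: p_per p_nonneg\<close>)
    qed auto
    also have "\<dots> = (\<integral>\<^sup>+y. ennreal (s ^ (m - 1)) * local_integrand R s a y \<partial>Leb)"
    proof (rule nn_integral_cong)
      fix y :: "nat \<Rightarrow> real"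
      define x where "x = (\<lambda>i\<in>{..<m-1}. ?T i (y i))(m - 1 := a)"
      have xl: "x (m - 1) = a" by (simp add: x_def)
      have xs: "x \<in> space (PiM {..<m} (\<lambda>_. borel))" unfolding ins x_def by (auto simp: space_PiM PiE_def extensional_def)
      have xi: "x i = circ (a + vertex i + s * y i)" if "i < m - 1" for i using that by (simp add: x_def)
      have kprod: "(\<Prod>i\<in>{..<m-1}. ?k i (y i)) = ennreal (s ^ (m - 1)) * (\<Prod>i<m-1. ennreal (p (a + vertex i + s * y i))) *
          (\<Prod>i<m-1. indicator {-pi..<pi} (s * y i))"
        using s p_nonneg by (simp add: prod.distrib ennreal_mult ennreal_power)
      show "indicator ?E ((\<lambda>i\<in>{..<m-1}. ?T i (y i))(m - 1 := a)) * (\<Prod>i\<in>{..<m-1}. ?k i (y i)) = ennreal (s ^ (m - 1)) * local_integrand R s a y"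
      proof (cases "\<forall>i<m-1. s * y i \<in> {-pi..<pi}")
        \<comment> \<open>Outside the window both sides vanish, the left one by the chart and the
          right one by the box.\<close>
        case False
        then obtain i where i: "i < m - 1" "s * y i \<notin> {-pi..<pi}" by auto
        have "(\<Prod>i<m-1. indicator {-pi..<pi} (s * y i) :: ennreal) = 0"
          using i by (intro prod_zero) (auto intro!: bexI[of _ i])
        moreover have "\<not> \<bar>y i\<bar> \<le> R"
        proof
          assume "\<bar>y i\<bar> \<le> R"
          then have "\<bar>s * y i\<bar> \<le> R * s" using s by (simp add: abs_mult mult.commute)
          then show False using i(2) R by auto
        qed
        ultimately show ?thesis unfolding kprod using i by (auto simp: local_integrand_def indicator_def)
      next
        case True
        have "deficit x = deficit (\<lambda>i. vertex i + s * (y(m - 1 := 0)) i)"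
        proof (rule deficit_cong[where c = a])
          fix i assume "i < m"
          show "\<exists>n::int. x i - (vertex i + s * (y(m - 1 := 0)) i) = a + 2 * pi * of_int n"
          proof (cases "i < m - 1")
            case True
            obtain n where "circ (a + vertex i + s * y i) - (a + vertex i + s * y i) = 2 * pi * of_int n" by (rule circ_diff_int)
            then show ?thesis using True xi[OF True] by (intro exI[of _ n]) simp
          next
            case False
            then have "i = m - 1" using \<open>i < m\<close> by auto
            then show ?thesis using xl vertex_last by (intro exI[of _ "-1"]) simp
          qed
        qed
        moreover have "(\<exists>n::int. \<bar>x i - x (m - 1) - vertex i - 2 * pi * of_int n\<bar> \<le> R * s) \<longleftrightarrow> \<bar>y i\<bar> \<le> R" if i: "i < m - 1" for i
        proof -
          obtain n' where n': "circ (a + vertex i + s * y i) - (a + vertex i + s * y i) = 2 * pi * of_int n'" by (rule circ_diff_int)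
          have eq: "x i - x (m - 1) - vertex i - 2 * pi * of_int n = s * y i - 2 * pi * of_int (n - n')" for n
            using n' by (simp add: xi[OF i] xl[simplified] algebra_simps)
          have iff: "\<bar>s * y i\<bar> \<le> R * s \<longleftrightarrow> \<bar>y i\<bar> \<le> R" using s by (simp add: abs_mult mult.commute[of R])
          have "n = n'" if "\<bar>s * y i - 2 * pi * of_int (n - n')\<bar> \<le> R * s" for n
            using two_pi_multiple_small[OF that _ R] True i by force
          then show ?thesis unfolding eq iff[symmetric] by (metis cancel_comm_monoid_add_class.diff_cancel diff_zero mult_zero_right of_int_0)
        qed
        ultimately have "x \<in> ?E \<longleftrightarrow> (\<forall>i\<in>{..<m-1}. \<bar>y i\<bar> \<le> R) \<and> deficit (\<lambda>i. vertex i + s * (y(m - 1 := 0)) i) \<le> s\<^sup>2"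
          using xs by (auto simp: config0_def)
        moreover have "(\<Prod>i<m-1. indicator {-pi..<pi} (s * y i) :: ennreal) = 1"
          using True by (intro prod.neutral) auto
        ultimately show ?thesis unfolding kprod x_def[symmetric] local_integrand_def
          by (simp add: indicator_def)
      qed
    qed
    also have "\<dots> = ennreal (s ^ (m - 1)) * (\<integral>\<^sup>+y. local_integrand R s a y \<partial>Leb)"
      by (rule nn_integral_cmult[OF measurable_local_integrand1])
    finally show "(\<integral>\<^sup>+x. indicator ?E (x(m - 1 := a)) \<partial>PiM {..<m-1} (\<lambda>_. \<mu>)) = \<dots>" .
  qed
  also have "\<dots> = ennreal (s ^ (m - 1)) * (\<integral>\<^sup>+a. \<integral>\<^sup>+y. local_integrand R s a y \<partial>Leb \<partial>\<mu>)"
    using measurable_local_integrand2 by (intro nn_integral_cmult) (simp add: cong: measurable_cong_sets)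
  finally show ?thesis .
qed

lemma quad_form_scale: "quad_form k A (\<lambda>i. c * x i) = c\<^sup>2 * quad_form k A x"
  by (simp add: quad_form_def sum_distrib_left power2_eq_square mult_ac)

lemma sets_boxed [measurable]:
  "{y\<in>space Leb. Q y \<le> u \<and> (\<forall>i\<in>{..<m-1}. \<bar>y i\<bar> \<le> v)} \<in> sets (PiM {..<m-1} (\<lambda>_. borel))"
proof -
  have qm [measurable]: "Q \<in> borel_measurable (PiM {..<m-1} (\<lambda>_. borel))" by measurable
  have "{y\<in>space (PiM {..<m-1} (\<lambda>_. borel)). Q y \<le> u \<and> (\<forall>i\<in>{..<m-1}. \<bar>y i\<bar> \<le> v)} \<in> sets (PiM {..<m-1} (\<lambda>_. borel))"
    by measurable
  then show ?thesis by (simp add: sets_eq_imp_space_eq[OF sets_PiM_lborel])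
qed

lemma emeasure_box:
  assumes "R \<ge> 0"
  shows "{y\<in>space Leb. \<forall>i\<in>{..<m-1}. \<bar>y i\<bar> \<le> R} \<in> sets Leb"
    and "emeasure Leb {y\<in>space Leb. \<forall>i\<in>{..<m-1}. \<bar>y i\<bar> \<le> R} = ennreal ((2 * R) ^ (m - 1))"
proof -
  interpret L: product_sigma_finite "\<lambda>_::nat. lborel :: real measure" by standard
  have eq: "{y\<in>space Leb. \<forall>i\<in>{..<m-1}. \<bar>y i\<bar> \<le> R} = PiE {..<m-1} (\<lambda>_. {-R..R})"
  proof -
    have "\<bar>u\<bar> \<le> R \<longleftrightarrow> u \<in> {-R..R}" for u :: real by auto
    then show ?thesis by (auto simp: space_PiM PiE_def Pi_def)
  qed
  show "{y\<in>space Leb. \<forall>i\<in>{..<m-1}. \<bar>y i\<bar> \<le> R} \<in> sets Leb"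
    unfolding eq by (rule sets_PiM_I_finite) auto
  show "emeasure Leb {y\<in>space Leb. \<forall>i\<in>{..<m-1}. \<bar>y i\<bar> \<le> R} = ennreal ((2 * R) ^ (m - 1))"
    unfolding eq using assms by (subst L.emeasure_PiM) (auto simp: ennreal_power)
qed

lemma Vol_finite: "R \<ge> 0 \<Longrightarrow> Vol R < \<infinity>"
proof -
  assume R: "R \<ge> 0"
  have "Vol R \<le> ennreal ((2 * R) ^ (m - 1))"
    unfolding Vol_def emeasure_box(2)[OF R, symmetric] boxed_ellipsoid_def
    by (rule emeasure_mono[OF _ emeasure_box(1)[OF R]]) auto
  then show ?thesis by (metis ennreal_less_top infinity_ennreal_def le_less_trans)
qed

text \<open>Homogeneity under dilation; it serves to show that the level set \<open>Q y = 2\<close>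
  inside the box is null.\<close>

lemma emeasure_boxed_scaled:
  assumes c: "c > 0"
  shows "emeasure Leb {y\<in>space Leb.
      Q y \<le> 2 * c\<^sup>2 \<and> (\<forall>i\<in>{..<m-1}. \<bar>y i\<bar> \<le> R * c)} = ennreal (c ^ (m - 1)) * Vol R"
proof -
  let ?S = "{y\<in>space Leb. Q y \<le> 2 * c\<^sup>2 \<and> (\<forall>i\<in>{..<m-1}. \<bar>y i\<bar> \<le> R * c)}"
  have S: "?S \<in> sets Leb" using sets_boxed by (simp add: sets_PiM_lborel)
  have "emeasure Leb ?S = (\<integral>\<^sup>+x. indicator ?S x \<partial>Leb)" using S by simp
  also have "\<dots> = (\<integral>\<^sup>+y. indicator ?S (\<lambda>i\<in>{..<m-1}. c * y i) * (\<Prod>i\<in>{..<m-1}. ennreal c) \<partial>Leb)"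
  proof (rule nn_integral_PiM_substitution)
    show "(\<integral>\<^sup>+x. f x \<partial>lborel) = (\<integral>\<^sup>+y. f (c * y) * ennreal c \<partial>lborel)" if "f \<in> borel_measurable borel" for f :: "real \<Rightarrow> ennreal"
      using nn_integral_lborel_scale[OF that c, of 0] by simp
    show "indicator ?S \<in> borel_measurable (PiM {..<m-1} (\<lambda>_. borel :: real measure))" using sets_boxed by measurable
  qed (auto intro: lborel.sigma_finite_measure_axioms)
  also have "\<dots> = (\<integral>\<^sup>+y. ennreal (c ^ (m - 1)) * indicator (boxed_ellipsoid R) y \<partial>Leb)"
  proof (rule nn_integral_cong)
    fix y assume y: "y \<in> space Leb"
    have "Q (\<lambda>i\<in>{..<m-1}. c * y i) = Q (\<lambda>i. c * y i)"
      by (rule quad_form_cong) simp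
    also have "\<dots> = c\<^sup>2 * Q y" by (rule quad_form_scale)
    finally have q: "Q (\<lambda>i\<in>{..<m-1}. c * y i) \<le> 2 * c\<^sup>2 \<longleftrightarrow> Q y \<le> 2"
      using c by (simp add: mult.commute[of _ "c\<^sup>2"])
    have b: "\<bar>c * y i\<bar> \<le> R * c \<longleftrightarrow> \<bar>y i\<bar> \<le> R" for i using c by (simp add: abs_mult mult.commute[of R])
    have "(\<lambda>i\<in>{..<m-1}. c * y i) \<in> ?S \<longleftrightarrow> y \<in> boxed_ellipsoid R"
      using y q b by (simp add: boxed_ellipsoid_def space_PiM)
    then show "indicator ?S (\<lambda>i\<in>{..<m-1}. c * y i) * (\<Prod>i\<in>{..<m-1}. ennreal c) = ennreal (c ^ (m - 1)) * indicator (boxed_ellipsoid R) y"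
      using c by (simp add: indicator_def ennreal_power)
  qed
  also have "\<dots> = ennreal (c ^ (m - 1)) * Vol R"
    unfolding Vol_def boxed_ellipsoid_def using sets_boxed
    by (intro nn_integral_cmult_indicator) (simp add: sets_PiM_lborel)
  finally show ?thesis .
qed

text \<open>The boundary of the region lies outside all its contractions by factors \<open>c < 1\<close>.\<close>
lemma boundary_null:
  assumes R: "R \<ge> 0"
  shows "{y\<in>space Leb. Q y = 2 \<and> (\<forall>i\<in>{..<m-1}. \<bar>y i\<bar> \<le> R)}
    \<in> null_sets Leb"
proof -
  let ?N = "{y\<in>space Leb. Q y = 2 \<and> (\<forall>i\<in>{..<m-1}. \<bar>y i\<bar> \<le> R)}"
  let ?S = "\<lambda>c. {y\<in>space Leb. Q y \<le> 2 * c\<^sup>2 \<and> (\<forall>i\<in>{..<m-1}. \<bar>y i\<bar> \<le> R * c)}"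
  have N: "?N \<in> sets Leb"
  proof -
    have qm [measurable]: "Q \<in> borel_measurable (PiM {..<m-1} (\<lambda>_. borel))" by measurable
    have "{y\<in>space (PiM {..<m-1} (\<lambda>_. borel)). Q y = 2 \<and> (\<forall>i\<in>{..<m-1}. \<bar>y i\<bar> \<le> R)} \<in> sets (PiM {..<m-1} (\<lambda>_. borel))"
      by measurable
    then show ?thesis by (simp add: sets_eq_imp_space_eq[OF sets_PiM_lborel] sets_PiM_lborel)
  qed
  have S: "?S c \<in> sets Leb" for c using sets_boxed by (simp add: sets_PiM_lborel)
  obtain v where v: "Vol R = ennreal v" "v \<ge> 0" using Vol_finite[OF R] by (cases "Vol R") auto
  \<comment> \<open>The level set and the contracted region are disjoint parts of the full one, so
    the level set has measure at most \<open>(1 - c ^ (m - 1)) * Vol R\<close>; then c tends to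
    1.\<close>
  have le: "emeasure Leb ?N + ennreal (c ^ (m - 1)) * Vol R \<le> Vol R" if c: "0 < c" "c < 1" for c
  proof -
    have "emeasure Leb ?N + ennreal (c ^ (m - 1)) * Vol R = emeasure Leb ?N + emeasure Leb (?S c)"
      using emeasure_boxed_scaled[OF c(1), of R] by simp
    also have "\<dots> = emeasure Leb (?N \<union> ?S c)"
    proof (rule plus_emeasure[OF N S])
      have "c\<^sup>2 < 1" using c by (simp add: power_less_one_iff)
      then show "?N \<inter> ?S c = {}" by auto
    qed
    also have "\<dots> \<le> Vol R"
      unfolding Vol_def boxed_ellipsoid_def
    proof (rule emeasure_mono)
      have "c\<^sup>2 \<le> 1" "R * c \<le> R" using c R by (simp_all add: power_le_one mult_left_le)
      then show "?N \<union> ?S c \<subseteq> {y\<in>space Leb. Q y \<le> 2 \<and> (\<forall>i\<in>{..<m-1}. \<bar>y i\<bar> \<le> R)}"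
        by (auto intro: order_trans)
    qed (use sets_boxed in \<open>simp add: sets_PiM_lborel\<close>)
    finally show ?thesis .
  qed
  have "emeasure Leb ?N \<le> Vol R" using order_trans[OF _ le[of "1/2"], of "emeasure Leb ?N"] by simp
  then obtain e where e: "emeasure Leb ?N = ennreal e" "e \<ge> 0" using v(1) by (cases "emeasure Leb ?N") (auto simp: top_unique)
  have "e + c ^ (m - 1) * v \<le> v" if c: "0 < c" "c < 1" for c
    using le[OF c] c v e by (simp add: ennreal_mult[symmetric] ennreal_plus[symmetric] del: ennreal_plus)
  then have "eventually (\<lambda>c. e + c ^ (m - 1) * v \<le> v) (at_left 1)"
    by (intro eventually_at_leftI[of 0]) auto
  moreover have "((\<lambda>c. e + c ^ (m - 1) * v) \<longlongrightarrow> e + 1 ^ (m - 1) * v) (at_left 1)"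
    by (intro tendsto_intros)
  ultimately have "e + 1 ^ (m - 1) * v \<le> v"
    by (intro tendsto_le[OF _ tendsto_const, of "at_left 1" "\<lambda>c. e + c ^ (m - 1) * v"]) auto
  then show ?thesis using N e by (auto intro!: null_setsI)
qed

lemma local_integrand_bound:
  assumes B: "\<And>x. p x \<le> B" and y: "y \<in> space Leb"
  shows "local_integrand R s a y \<le> ennreal (B ^ (m - 1)) * indicator {y\<in>space Leb. \<forall>i\<in>{..<m-1}. \<bar>y i\<bar> \<le> R} y"
proof -
  have B0: "B \<ge> 0" using p_nonneg B order_trans by blast
  have "(\<Prod>i<m-1. ennreal (p (a + vertex i + s * y i))) = ennreal (\<Prod>i<m-1. p (a + vertex i + s * y i))"
    by (rule prod_ennreal) (rule p_nonneg)
  also have "\<dots> \<le> ennreal (\<Prod>i<m-1. B)"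
    using p_nonneg B by (intro ennreal_leI prod_mono) auto
  also have "\<dots> = ennreal (B ^ (m - 1))" by simp
  finally show ?thesis using y by (auto simp: local_integrand_def indicator_def)
qed

text \<open>Dominated convergence. The box gives a majorant independent of n, and since the scaled
  deficit tends to \<open>Q y / 2\<close>, the indicator of the deficit condition converges wherever
  \<open>Q y \<noteq> 2\<close>; the exceptional set is null by
  \<open>boundary_null\<close>.\<close>

lemma local_limit:
  assumes s: "\<And>n. s n > 0" "s \<longlonglongrightarrow> 0" and R: "R \<ge> 0"
  shows "(\<lambda>n. \<integral>\<^sup>+y. local_integrand R (s n) a y \<partial>Leb) \<longlonglongrightarrow>
    ennreal (\<Prod>i<m-1. p (a + vertex i)) * Vol R"
proof -
  let ?box = "{y\<in>space Leb. \<forall>i\<in>{..<m-1}. \<bar>y i\<bar> \<le> R}"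
  let ?N = "{y\<in>space Leb. Q y = 2 \<and> (\<forall>i\<in>{..<m-1}. \<bar>y i\<bar> \<le> R)}"
  let ?lim = "\<lambda>y. ennreal (\<Prod>i<m-1. p (a + vertex i)) * indicator (boxed_ellipsoid R) y"
  obtain B where B: "B > 0" "\<And>x. p x \<le> B" by (rule p_bounded) blast
  have box [measurable]: "?box \<in> sets Leb" by (rule emeasure_box(1)[OF R])
  have be [measurable]: "boxed_ellipsoid R \<in> sets Leb"
    unfolding boxed_ellipsoid_def using sets_boxed by (simp add: sets_PiM_lborel)
  have "(\<lambda>n. \<integral>\<^sup>+y. local_integrand R (s n) a y \<partial>Leb) \<longlonglongrightarrow> (\<integral>\<^sup>+y. ?lim y \<partial>Leb)"
  proof (rule nn_integral_dominated_convergence[where w = "\<lambda>y. ennreal (B ^ (m - 1)) * indicator ?box y"])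
    show "AE y in Leb. local_integrand R (s n) a y \<le> ennreal (B ^ (m - 1)) * indicator ?box y" for n
      by (rule AE_I2) (rule local_integrand_bound[OF B(2)])
    have "(\<integral>\<^sup>+y. ennreal (B ^ (m - 1)) * indicator ?box y \<partial>Leb) = ennreal (B ^ (m - 1)) * ennreal ((2 * R) ^ (m - 1))"
      by (simp only: nn_integral_cmult_indicator[OF box] emeasure_box(2)[OF R])
    also have "\<dots> < \<infinity>" by (simp add: ennreal_mult_less_top)
    finally show "(\<integral>\<^sup>+y. ennreal (B ^ (m - 1)) * indicator ?box y \<partial>Leb) < \<infinity>" .
    have "AE y in Leb. y \<notin> ?N" by (rule AE_not_in[OF boundary_null[OF R]])
    then show "AE y in Leb. (\<lambda>n. local_integrand R (s n) a y) \<longlonglongrightarrow> ?lim y"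
    proof (rule AE_mp, intro AE_I2 impI)
      fix y assume y: "y \<in> space Leb" and nb: "y \<notin> ?N"
      let ?Q = "Q y"
      let ?D = "\<lambda>s. deficit (\<lambda>i. vertex i + s * (y(m - 1 := 0)) i)"
      have "Q (y(m - 1 := 0)) = ?Q" by (rule quad_form_cong) auto
      then have "((\<lambda>s. ?D s / s\<^sup>2) \<longlongrightarrow> ?Q / 2) (at_right 0)"
        using deficit_near_vertices[of "y(m - 1 := 0)"] by simp
      moreover have "filterlim s (at_right 0) sequentially"
        using s(2) less_imp_neq[OF s(1)] s(1) by (auto simp: filterlim_at intro!: always_eventually)
      ultimately have D: "(\<lambda>n. ?D (s n) / (s n)\<^sup>2) \<longlonglongrightarrow> ?Q / 2"
        by (rule filterlim_compose)
      have iff: "?D (s n) \<le> (s n)\<^sup>2 \<longleftrightarrow> ?D (s n) / (s n)\<^sup>2 \<le> 1" for n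
        using s(1)[of n] by (simp add: field_simps)
      have prod: "(\<Prod>i<m-1. ennreal (p (a + vertex i + s n * y i))) = ennreal (\<Prod>i<m-1. p (a + vertex i + s n * y i))" for n
        by (rule prod_ennreal) (rule p_nonneg)
      have "(\<lambda>n. \<Prod>i<m-1. p (a + vertex i + s n * y i)) \<longlonglongrightarrow> (\<Prod>i<m-1. p (a + vertex i + 0 * y i))"
        by (intro tendsto_prod isCont_tendsto_compose[OF p_isCont] tendsto_intros s)
      then have plim: "(\<lambda>n. ennreal (\<Prod>i<m-1. p (a + vertex i + s n * y i))) \<longlonglongrightarrow> ennreal (\<Prod>i<m-1. p (a + vertex i))"
        by (intro tendsto_ennrealI) simp
      consider "\<not> (\<forall>i\<in>{..<m-1}. \<bar>y i\<bar> \<le> R)" | "\<forall>i\<in>{..<m-1}. \<bar>y i\<bar> \<le> R" "?Q < 2" | "\<forall>i\<in>{..<m-1}. \<bar>y i\<bar> \<le> R" "?Q > 2"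
        using nb y by fastforce
      then show "(\<lambda>n. local_integrand R (s n) a y) \<longlonglongrightarrow> ?lim y"
      proof cases
        case 1
        then have "local_integrand R (s n) a y = 0" "?lim y = 0" for n
          by (auto simp: local_integrand_def boxed_ellipsoid_def indicator_def)
        then show ?thesis by (simp only: tendsto_const)
      next
        case 2
        have "eventually (\<lambda>n. ?D (s n) / (s n)\<^sup>2 < 1) sequentially"
          using 2 by (intro order_tendstoD(2)[OF D]) simp
        then have ev: "eventually (\<lambda>n. local_integrand R (s n) a y = ennreal (\<Prod>i<m-1. p (a + vertex i + s n * y i))) sequentially"
        proof eventually_elim
          case (elim n)
          then have "?D (s n) \<le> (s n)\<^sup>2" unfolding iff by simp
          then show ?case unfolding local_integrand_def prod using 2 by simp
        qed
        have "?lim y = ennreal (\<Prod>i<m-1. p (a + vertex i))"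
          using 2 y by (simp add: boxed_ellipsoid_def)
        then show ?thesis using plim by (simp only: tendsto_cong[OF ev])
      next
        case 3
        have "eventually (\<lambda>n. ?D (s n) / (s n)\<^sup>2 > 1) sequentially"
          using 3 by (intro order_tendstoD(1)[OF D]) simp
        then have ev: "eventually (\<lambda>n. local_integrand R (s n) a y = 0) sequentially"
        proof eventually_elim
          case (elim n)
          then have "\<not> ?D (s n) \<le> (s n)\<^sup>2" unfolding iff by simp
          then show ?case unfolding local_integrand_def by simp
        qed
        have "?lim y = 0" using 3 by (simp add: boxed_ellipsoid_def)
        then show ?thesis by (simp only: tendsto_cong[OF ev] tendsto_const)
      qed
    qed
  qed (use measurable_local_integrand1 in measurable)
  also have "(\<integral>\<^sup>+y. ?lim y \<partial>Leb) = ennreal (\<Prod>i<m-1. p (a + vertex i)) * Vol R"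
    unfolding Vol_def by (rule nn_integral_cmult_indicator[OF be])
  finally show ?thesis .
qed

text \<open>The density of the base point supplies the factor l = 0, and vertex i supplies the
  factor l = i + 1.\<close>

lemma nn_integral_density_product:
  "(\<integral>\<^sup>+a. ennreal (\<Prod>i<m-1. p (a + vertex i)) \<partial>\<mu>) = ennreal (polygon_density_integral p m)"
proof -
  have pc: "continuous_on A (\<lambda>a. p (a + c))" for c A
    by (intro continuous_on_compose2[OF p_cont]) (auto intro!: continuous_intros)
  have eq: "p a * (\<Prod>i<m-1. p (a + vertex i)) = (\<Prod>l=0..m-1. p (a + 2 * pi * real l / real m))" for a
  proof -
    have "{0..m-1} = {..<Suc (m - 1)}" by auto
    then show ?thesis
      by (simp only: prod.lessThan_Suc_shift) (simp add: vertex_def add.commute)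
  qed
  have [measurable]: "(\<lambda>a. p (a + c)) \<in> borel_measurable borel" for c by measurable
  have "(\<integral>\<^sup>+a. ennreal (\<Prod>i<m-1. p (a + vertex i)) \<partial>\<mu>) =
    (\<integral>\<^sup>+a. ennreal (p a * indicator {0..<2*pi} a) * ennreal (\<Prod>i<m-1. p (a + vertex i)) \<partial>lborel)"
    unfolding circ_measure_def by (rule nn_integral_density) measurable
  also have "\<dots> = (\<integral>\<^sup>+a. ennreal (\<Prod>l=0..m-1. p (a + 2 * pi * real l / real m)) * indicator {0..<2*pi} a \<partial>lborel)"
    unfolding eq[symmetric] using p_nonneg by (intro nn_integral_cong) (auto simp: indicator_def ennreal_mult prod_nonneg)
  also have "\<dots> = ennreal (integral {0..2*pi} (\<lambda>a. \<Prod>l=0..m-1. p (a + 2 * pi * real l / real m)))"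
    using pc p_nonneg by (intro nn_integral_period_eq continuous_on_prod) (auto intro!: prod_nonneg)
  finally show ?thesis by (simp add: polygon_density_integral_def)
qed

text \<open>A second dominated convergence, now over the base angle. The factorial counts the
  assignments of points to vertices, which are exclusive once
  \<open>R * s n < pi / m\<close>.\<close>

lemma config_asymptotics:
  assumes s: "\<And>n. s n > 0" "s \<longlonglongrightarrow> 0" and R: "R \<ge> 0" and I: "polygon_density_integral p m \<ge> 0"
  shows "(\<lambda>n. measure (PiM {..<m} (\<lambda>_. \<mu>)) (config ((s n)\<^sup>2) (R * s n)) / s n ^ (m - 1)) \<longlonglongrightarrow>
    fact (m - 1) * (polygon_density_integral p m * enn2real (Vol R))"
proof -
  define J where "J n = (\<integral>\<^sup>+a. \<integral>\<^sup>+y. local_integrand R (s n) a y \<partial>Leb \<partial>\<mu>)" for n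
  obtain B where B: "B > 0" "\<And>x. p x \<le> B" by (rule p_bounded) blast
  have "J \<longlonglongrightarrow> (\<integral>\<^sup>+a. ennreal (\<Prod>i<m-1. p (a + vertex i)) * Vol R \<partial>\<mu>)"
    unfolding J_def
  proof (rule nn_integral_dominated_convergence[where w = "\<lambda>_. ennreal (B ^ (m - 1)) * ennreal ((2 * R) ^ (m - 1))"])
    show "AE a in \<mu>. (\<integral>\<^sup>+y. local_integrand R (s n) a y \<partial>Leb) \<le> ennreal (B ^ (m - 1)) * ennreal ((2 * R) ^ (m - 1))" for n
    proof (rule AE_I2)
      fix a
      have "(\<integral>\<^sup>+y. local_integrand R (s n) a y \<partial>Leb) \<le> (\<integral>\<^sup>+y. ennreal (B ^ (m - 1)) * indicator {y\<in>space Leb. \<forall>i\<in>{..<m-1}. \<bar>y i\<bar> \<le> R} y \<partial>Leb)"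
        by (intro nn_integral_mono local_integrand_bound[OF B(2)])
      also have "\<dots> = ennreal (B ^ (m - 1)) * ennreal ((2 * R) ^ (m - 1))"
        by (simp only: nn_integral_cmult_indicator[OF emeasure_box(1)[OF R]] emeasure_box(2)[OF R])
      finally show "(\<integral>\<^sup>+y. local_integrand R (s n) a y \<partial>Leb) \<le> ennreal (B ^ (m - 1)) * ennreal ((2 * R) ^ (m - 1))" .
    qed
    show "(\<integral>\<^sup>+a. ennreal (B ^ (m - 1)) * ennreal ((2 * R) ^ (m - 1)) \<partial>\<mu>) < \<infinity>"
      by (simp add: mu.emeasure_space_1 ennreal_mult_less_top)
    show "AE a in \<mu>. (\<lambda>n. \<integral>\<^sup>+y. local_integrand R (s n) a y \<partial>Leb) \<longlonglongrightarrow> ennreal (\<Prod>i<m-1. p (a + vertex i)) * Vol R"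
      by (intro AE_I2 local_limit s R)
    show "(\<lambda>a. \<integral>\<^sup>+y. local_integrand R (s n) a y \<partial>Leb) \<in> borel_measurable \<mu>" for n
      using measurable_local_integrand2 by (simp cong: measurable_cong_sets)
  qed measurable
  also have "(\<integral>\<^sup>+a. ennreal (\<Prod>i<m-1. p (a + vertex i)) * Vol R \<partial>\<mu>) = ennreal (polygon_density_integral p m) * Vol R"
  proof -
    have "(\<lambda>a. ennreal (\<Prod>i<m-1. p (a + vertex i))) \<in> borel_measurable \<mu>" by measurable
    then show ?thesis by (simp only: nn_integral_multc nn_integral_density_product)
  qed
  finally have "J \<longlonglongrightarrow> ennreal (polygon_density_integral p m) * Vol R" .
  moreover obtain v where v: "Vol R = ennreal v" "v \<ge> 0" using Vol_finite[OF R] by (cases "Vol R") auto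
  ultimately have "J \<longlonglongrightarrow> ennreal (polygon_density_integral p m * v)" using I by (simp add: ennreal_mult)
  then have "(\<lambda>n. enn2real (J n)) \<longlonglongrightarrow> polygon_density_integral p m * v"
    using I v by (intro tendsto_enn2real) auto
  then have lim: "(\<lambda>n. fact (m - 1) * enn2real (J n)) \<longlonglongrightarrow> fact (m - 1) * (polygon_density_integral p m * enn2real (Vol R))"
    using v by (intro tendsto_mult_left) simp
  have "(\<lambda>n. R * s n) \<longlonglongrightarrow> R * 0" by (intro tendsto_intros s)
  then have "eventually (\<lambda>n. R * s n < pi / m) sequentially"
    using m2 by (intro order_tendstoD(2)) auto
  then have "eventually (\<lambda>n. measure (PiM {..<m} (\<lambda>_. \<mu>)) (config ((s n)\<^sup>2) (R * s n)) / s n ^ (m - 1) = fact (m - 1) * enn2real (J n)) sequentially"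
  proof eventually_elim
    case (elim n)
    have "pi / m \<le> pi / 1" using m2 by (intro divide_left_mono) auto
    then have "R * s n < pi" using elim by simp
    then have "emeasure (PiM {..<m} (\<lambda>_. \<mu>)) (config ((s n)\<^sup>2) (R * s n)) = ennreal (fact (m - 1)) * (ennreal (s n ^ (m - 1)) * J n)"
      unfolding emeasure_config[OF elim] J_def by (simp add: emeasure_config0[OF s(1)])
    then have "measure (PiM {..<m} (\<lambda>_. \<mu>)) (config ((s n)\<^sup>2) (R * s n)) = fact (m - 1) * (s n ^ (m - 1) * enn2real (J n))"
      using s(1)[of n] by (simp add: measure_def enn2real_mult)
    then show ?case using s(1)[of n] by simp
  qed
  then show ?thesis using lim by (simp only: tendsto_cong)
qed

lemma Vol_limit:
  "(\<lambda>j. Vol (real j)) \<longlonglongrightarrow> emeasure Leb {y\<in>space Leb. Q y \<le> 2}"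
proof -
  have "(\<lambda>j. emeasure Leb (boxed_ellipsoid (real j))) \<longlonglongrightarrow> emeasure Leb (\<Union>j. boxed_ellipsoid (real j))"
  proof (rule Lim_emeasure_incseq)
    show "range (\<lambda>j. boxed_ellipsoid (real j)) \<subseteq> sets Leb"
      unfolding boxed_ellipsoid_def using sets_boxed by (auto simp: sets_PiM_lborel)
    show "incseq (\<lambda>j. boxed_ellipsoid (real j))"
      by (auto simp: incseq_def boxed_ellipsoid_def intro: order_trans)
  qed
  also have "(\<Union>j. boxed_ellipsoid (real j)) = {y\<in>space Leb. Q y \<le> 2}"
  proof -
    have "\<exists>j. \<forall>i\<in>{..<m-1}. \<bar>y i\<bar> \<le> real j" for y :: "nat \<Rightarrow> real"
    proof -
      obtain j where j: "(\<Sum>i<m-1. \<bar>y i\<bar>) \<le> real j" using real_arch_simple by blast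
      have "\<bar>y i\<bar> \<le> real j" if "i \<in> {..<m-1}" for i
        using member_le_sum[OF that, of "\<lambda>i. \<bar>y i\<bar>"] j by simp
      then show ?thesis by blast
    qed
    then show ?thesis by (auto simp: boxed_ellipsoid_def)
  qed
  finally show ?thesis by (simp add: Vol_def)
qed

end

section \<open>The limit law\<close>

lemma choose_asymptotics: "(\<lambda>n. real (n choose m) / real n ^ m) \<longlonglongrightarrow> 1 / fact m"
proof -
  have "eventually (\<lambda>n. real (n choose m) / real n ^ m = (\<Prod>i=0..<m. 1 - real i / real n) / fact m) sequentially"
    using eventually_gt_at_top[of 0]
  proof eventually_elim
    case (elim n)
    have "real (n choose m) = (\<Prod>i=0..<m. real n - real i) / fact m"
      by (simp add: binomial_gbinomial gbinomial_prod_rev)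
    also have "(\<Prod>i=0..<m. real n - real i) = (\<Prod>i=0..<m. (1 - real i / real n) * real n)"
      using elim by (intro prod.cong refl) (simp add: field_simps)
    also have "\<dots> = (\<Prod>i=0..<m. 1 - real i / real n) * real n ^ m" by (simp add: prod.distrib)
    finally show ?case using elim by simp
  qed
  moreover have "(\<lambda>n. (\<Prod>i=0..<m. 1 - real i / real n) / fact m) \<longlonglongrightarrow> (\<Prod>i=0..<m. 1 - 0) / fact m"
    by (intro tendsto_divide tendsto_prod tendsto_diff tendsto_const tendsto_divide_0[OF tendsto_const]
        filterlim_at_top_imp_at_infinity[OF filterlim_real_sequentially]) auto
  ultimately show ?thesis by (simp add: tendsto_cong)
qed

context concave_kernel_density
begin

section \<open>Poisson limit for the truncated configurations\<close>

text \<open>Pairs that can be approximate vertices of a common regular m-gon; a relation between two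
  single points is what the bound on overlapping tuples needs.\<close>

definition lattice_near :: "real \<Rightarrow> (real \<times> real) set" where
  "lattice_near r = {z. \<exists>l\<in>{..<m}. \<exists>n::int. \<bar>snd z - fst z - 2 * pi * real l / real m - 2 * pi * of_int n\<bar> \<le> r}"

lemma sets_lattice_near: "lattice_near r \<in> sets (borel \<Otimes>\<^sub>M borel)"
proof -
  have "{z\<in>space (borel \<Otimes>\<^sub>M borel). \<exists>l\<in>{..<m}. \<exists>n::int. \<bar>snd z - fst z - 2 * pi * real l / real m - 2 * pi * of_int n\<bar> \<le> r} \<in> sets (borel \<Otimes>\<^sub>M borel)"
    by measurable
  then show ?thesis by (simp add: lattice_near_def space_pair_measure)
qed

lemma measure_lattice_near:
  assumes B: "\<And>x. p x \<le> B" and r: "0 \<le> r" "r < pi"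
  shows "measure \<mu> {b. (a, b) \<in> lattice_near r} \<le> real m * (2 * B * r)"
proof -
  have B0: "B \<ge> 0" using p_nonneg B order_trans by blast
  let ?S = "\<lambda>l. {b. \<exists>n::int. \<bar>b - (a + 2 * pi * real l / real m) - 2 * pi * of_int n\<bar> \<le> r}"
  have eq: "{b. (a, b) \<in> lattice_near r} = (\<Union>l\<in>{..<m}. ?S l)"
    by (auto simp: lattice_near_def algebra_simps)
  have S: "?S l \<in> sets \<mu>" for l by simp measurable
  have "measure \<mu> (\<Union>l\<in>{..<m}. ?S l) \<le> (\<Sum>l<m. measure \<mu> (?S l))"
    using S by (intro mu.finite_measure_subadditive_finite) auto
  also have "\<dots> \<le> (\<Sum>l<m. 2 * B * r)"
  proof (rule sum_mono)
    fix l
    show "measure \<mu> (?S l) \<le> 2 * B * r"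
      using emeasure_mu_near[OF B r, of "a + 2 * pi * real l / real m"] B0 r
      by (simp add: mu.emeasure_eq_measure)
  qed
  finally show ?thesis unfolding eq by simp
qed

text \<open>Both points lie within r of vertices of the regular polygon through the base point, and
  the two errors add up.\<close>

lemma config_lattice_near:
  assumes x: "x \<in> config z r" and r: "r \<ge> 0" and ij: "i < m" "j < m"
  shows "(x i, x j) \<in> lattice_near (2 * r)"
proof -
  obtain \<sigma> where \<sigma>: "\<sigma> permutes {..<m-1}"
    "\<And>i. i < m - 1 \<Longrightarrow> \<exists>n::int. \<bar>x (\<sigma> i) - x (m - 1) - vertex i - 2 * pi * of_int n\<bar> \<le> r"
    using x by (auto simp: config_def)
  have ex: "\<exists>i'. \<exists>n::int. \<bar>x i - x (m - 1) - vertex i' - 2 * pi * of_int n\<bar> \<le> r" if "i < m" for i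
  proof (cases "i = m - 1")
    case True
    then show ?thesis using vertex_last r by (intro exI[of _ "m - 1"] exI[of _ "-1"]) simp
  next
    case False
    then have "i < m - 1" using that by auto
    then have "inv_into UNIV \<sigma> i < m - 1" "\<sigma> (inv_into UNIV \<sigma> i) = i"
      using permutes_in_image[OF permutes_inv[OF \<sigma>(1)], of i] permutes_inverses(1)[OF \<sigma>(1)] by auto
    then show ?thesis using \<sigma>(2)[of "inv_into UNIV \<sigma> i"] by auto
  qed
  obtain i' and a :: int where a: "\<bar>x i - x (m - 1) - vertex i' - 2 * pi * of_int a\<bar> \<le> r" using ex[OF ij(1)] by auto
  obtain j' and b :: int where b: "\<bar>x j - x (m - 1) - vertex j' - 2 * pi * of_int b\<bar> \<le> r" using ex[OF ij(2)] by auto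
  \<comment> \<open>The difference of the vertex indices may be negative or exceed m - 1; division
    by m splits off full turns.\<close>
  define d where "d = int j' - int i'"
  have dm: "d = d div int m * int m + d mod int m" by simp
  have l: "nat (d mod int m) < m" "real (nat (d mod int m)) = of_int (d mod int m)" using m2 by (auto simp: nat_less_iff)
  have "vertex j' - vertex i' = 2 * pi * of_int d / real m"
    unfolding vertex_def d_def diff_divide_distrib[symmetric] by (simp add: algebra_simps)
  also have "(of_int d :: real) = of_int (d div int m) * real m + of_int (d mod int m)"
    by (subst dm) (simp only: of_int_add of_int_mult of_int_of_nat_eq)
  also have "2 * pi * \<dots> / real m = 2 * pi * of_int (d mod int m) / real m + 2 * pi * of_int (d div int m)"
    using m2 by (simp add: field_simps)
  finally have "x j - x i - 2 * pi * of_int (d mod int m) / real m - 2 * pi * of_int (b - a + d div int m) =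
    (x j - x (m - 1) - vertex j' - 2 * pi * of_int b) - (x i - x (m - 1) - vertex i' - 2 * pi * of_int a)"
    by (simp add: algebra_simps)
  then have "\<bar>x j - x i - 2 * pi * of_int (d mod int m) / real m - 2 * pi * of_int (b - a + d div int m)\<bar> \<le> 2 * r"
    using a b by linarith
  then have "\<bar>x j - x i - 2 * pi * real (nat (d mod int m)) / real m - 2 * pi * of_int (b - a + d div int m)\<bar> \<le> 2 * r"
    unfolding l(2) .
  then show ?thesis using l(1) unfolding lattice_near_def mem_Collect_eq fst_conv snd_conv by blast
qed

text \<open>At this scale the expected number of configurations converges while
  \<open>n * s n\<close> tends to 0, so both error terms of \<open>no_close_tuple_approx\<close>
  vanish. The maximum with 1 keeps \<open>s 0\<close> positive.\<close>

lemma prob_config_limit: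
  fixes M :: "'a measure" and X :: "nat \<Rightarrow> 'a \<Rightarrow> real" and t R :: real
  assumes M: "prob_space M" and X: "prob_space.indep_vars M (\<lambda>_. borel) X {1..}"
    and distr: "\<And>i. i \<ge> 1 \<Longrightarrow> distr M borel (X i) = \<mu>"
    and t: "t > 0" and R: "R \<ge> 0" and I: "polygon_density_integral p m \<ge> 0"
  defines "s \<equiv> \<lambda>n::nat. sqrt t * real (max 1 n) powr (- (real m / real (m - 1)))"
  shows "(\<lambda>n. measure M (\<Union>S\<in>{S. S \<subseteq> {1..n} \<and> card S = m}.
      {\<omega>\<in>space M. (\<lambda>i\<in>{..<m}. X (sorted_list_of_set S ! i) \<omega>) \<in> config ((s n)\<^sup>2) (R * s n)}))
    \<longlonglongrightarrow> 1 - exp (- (t powr ((real m - 1) / 2) * polygon_density_integral p m * enn2real (Vol R) / real m))"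
proof -
  interpret M: prob_space M by fact
  define q where "q n = measure (PiM {..<m} (\<lambda>_. \<mu>)) (config ((s n)\<^sup>2) (R * s n))" for n
  define A where "A n S = {\<omega>\<in>space M. (\<lambda>i\<in>{..<m}. X (sorted_list_of_set S ! i) \<omega>) \<in> config ((s n)\<^sup>2) (R * s n)}" for n S
  define Is where "Is n = {S. S \<subseteq> {1..n} \<and> card S = m}" for n :: nat
  define \<Lambda> where "\<Lambda> = t powr ((real m - 1) / 2) * polygon_density_integral p m * enn2real (Vol R) / real m"
  obtain B where B: "B > 0" "\<And>x. p x \<le> B" by (rule p_bounded) blast
  have s_pos: "s n > 0" for n using t by (simp add: s_def)
  have k0: "real (m - 1) > 0" "real (m - 1) = real m - 1" using m2 by auto
  have maxlim: "filterlim (\<lambda>n. real (max 1 n)) at_top sequentially"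
    by (rule filterlim_at_top_mono[OF filterlim_real_sequentially]) auto
  have powr0: "(\<lambda>n. real (max 1 n) powr (- c)) \<longlonglongrightarrow> 0" if "c > 0" for c
    using that by (intro tendsto_neg_powr maxlim) auto
  have s_lim: "s \<longlonglongrightarrow> 0"
    using tendsto_mult_left[OF powr0[of "real m / real (m - 1)"], of "sqrt t"] m2 k0 by (simp add: s_def[abs_def])
  have ns: "real n * s n = sqrt t * real (max 1 n) powr (- (1 / real (m - 1)))" if "n \<ge> 1" for n
  proof -
    have eq: "- (1 / real (m - 1)) = 1 + (- (real m / real (m - 1)))"
      using k0 by (simp add: field_simps)
    show ?thesis unfolding s_def eq powr_add using that by simp
  qed
  have ns_lim: "(\<lambda>n. real n * s n) \<longlonglongrightarrow> 0"
  proof -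
    have "eventually (\<lambda>n. real n * s n = sqrt t * real (max 1 n) powr (- (1 / real (m - 1)))) sequentially"
      using eventually_ge_at_top[of 1] by eventually_elim (rule ns)
    moreover have "(\<lambda>n. sqrt t * real (max 1 n) powr (- (1 / real (m - 1)))) \<longlonglongrightarrow> 0"
      using tendsto_mult_left[OF powr0[of "1 / real (m - 1)"], of "sqrt t"] k0 by simp
    ultimately show ?thesis by (simp only: tendsto_cong)
  qed
  \<comment> \<open>The exponent m / (m - 1) in s is chosen for this identity.\<close>
  have nms: "real n ^ m * s n ^ (m - 1) = t powr ((real m - 1) / 2)" if "n \<ge> 1" for n
  proof -
    have "(real n powr (- (real m / real (m - 1)))) ^ (m - 1) = real n powr (- real m)"
      using that k0 by (simp add: powr_power)
    also have "real n ^ m * \<dots> = 1"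
      using that by (simp add: powr_minus powr_realpow)
    finally have 1: "real n ^ m * (real n powr (- (real m / real (m - 1)))) ^ (m - 1) = 1" .
    have "sqrt t ^ (m - 1) = t powr ((real m - 1) / 2)"
      using t k0 by (simp add: powr_half_sqrt[symmetric] powr_power)
    then show ?thesis using 1 that by (simp add: s_def power_mult_distrib mult.left_commute[of _ "sqrt t ^ _"])
  qed
  have Cq: "(\<lambda>n. real (n choose m) * q n) \<longlonglongrightarrow> \<Lambda>"
  proof -
    have "eventually (\<lambda>n. real (n choose m) * q n = real (n choose m) / real n ^ m * (q n / s n ^ (m - 1)) * t powr ((real m - 1) / 2)) sequentially"
      using eventually_ge_at_top[of 1]
    proof eventually_elim
      case (elim n)
      have "s n \<noteq> 0" using s_pos[of n] by simp
      then show ?case unfolding nms[OF elim, symmetric] using elim by simp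
    qed
    moreover have "(\<lambda>n. real (n choose m) / real n ^ m * (q n / s n ^ (m - 1)) * t powr ((real m - 1) / 2)) \<longlonglongrightarrow>
      1 / fact m * (fact (m - 1) * (polygon_density_integral p m * enn2real (Vol R))) * t powr ((real m - 1) / 2)"
      unfolding q_def by (intro tendsto_mult tendsto_const choose_asymptotics config_asymptotics s_pos s_lim R I)
    \<comment> \<open>Here 1 / m arises as \<open>fact (m - 1) / fact m\<close>.\<close>
    moreover have "1 / fact m * (fact (m - 1) * (polygon_density_integral p m * enn2real (Vol R))) * t powr ((real m - 1) / 2) = \<Lambda>"
      using m2 fact_reduce[of m, where 'a = real] by (simp add: \<Lambda>_def field_simps)
    ultimately show ?thesis by (simp only: tendsto_cong)
  qed
  \<comment> \<open>As \<open>(n choose m) * q n\<close> stays bounded, the first summand is O(n s)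
    and the second O(1 / n).\<close>
  define \<epsilon> where "\<epsilon> n = real (n choose m) * q n * (real m * real n * (real m * (2 * B * (2 * (R * s n))))) +
    real (n choose m) * q n * (real m * real ((n - 1) choose (m - 1)) * q n)" for n
  have "\<epsilon> \<longlonglongrightarrow> 0"
  proof -
    have eq: "real ((n - 1) choose (m - 1)) * q n = real m * (real (n choose m) * q n) / real n" if "n \<ge> 1" for n
    proof -
      have "real n * real ((n - 1) choose (m - 1)) = real m * real (n choose m)"
        using times_binomial_minus1_eq[of m n] m2 by (metis of_nat_mult not_gr_zero not_numeral_le_zero)
      then show ?thesis using that by (simp add: field_simps)
    qed
    have "eventually (\<lambda>n. \<epsilon> n = real (n choose m) * q n * (real m * real m * 4 * B * R * (real n * s n)) +
      real (n choose m) * q n * (real m * (real m * (real (n choose m) * q n) / real n))) sequentially"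
      using eventually_ge_at_top[of 1]
    proof eventually_elim
      case (elim n)
      show ?case unfolding \<epsilon>_def mult.assoc[of "real m" _ "q n"] eq[OF elim] by (simp add: mult_ac)
    qed
    moreover have "(\<lambda>n. real (n choose m) * q n * (real m * real m * 4 * B * R * (real n * s n)) +
      real (n choose m) * q n * (real m * (real m * (real (n choose m) * q n) / real n))) \<longlonglongrightarrow>
      \<Lambda> * (real m * real m * 4 * B * R * 0) + \<Lambda> * (real m * 0)"
      by (intro tendsto_add tendsto_mult Cq ns_lim tendsto_const
          tendsto_divide_0[OF tendsto_mult[OF tendsto_const Cq] filterlim_at_top_imp_at_infinity[OF filterlim_real_sequentially]])
    ultimately show ?thesis by (simp add: tendsto_cong)
  qed
  have "(\<lambda>n. 2 * (R * s n)) \<longlonglongrightarrow> 2 * (R * 0)" by (intro tendsto_intros s_lim)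
  then have small: "eventually (\<lambda>n. 2 * (R * s n) < pi) sequentially"
    by (rule order_tendstoD(2)) simp
  have "eventually (\<lambda>n. \<bar>M.prob (space M - (\<Union>S\<in>Is n. A n S)) - exp (- (real (n choose m) * q n))\<bar> \<le> \<epsilon> n) sequentially"
    using small
  proof eventually_elim
    case (elim n)
    have r: "0 \<le> R * s n" using R s_pos[of n] by simp
    show ?case
      unfolding \<epsilon>_def Is_def A_def q_def
    proof (rule M.no_close_tuple_approx[where N = "lattice_near (2 * (R * s n))"])
      show "M.indep_vars (\<lambda>_. borel) X {1..n}" by (rule M.indep_vars_subset[OF X]) auto
      show "distr M borel (X i) = \<mu>" if "i \<in> {1..n}" for i using that by (intro distr) auto
      show "(x i, x j) \<in> lattice_near (2 * (R * s n))"
        if "x \<in> config ((s n)\<^sup>2) (R * s n)" "i < m" "j < m" for x i j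
        by (rule config_lattice_near[OF that(1) r that(2,3)])
      show "measure \<mu> {b. (a, b) \<in> lattice_near (2 * (R * s n))} \<le> real m * (2 * B * (2 * (R * s n)))" for a
        by (rule measure_lattice_near[OF B(2)]) (use r elim in auto)
    qed (use m2 sets_config sets_lattice_near in auto)
  qed
  then have "(\<lambda>n. M.prob (space M - (\<Union>S\<in>Is n. A n S)) - exp (- (real (n choose m) * q n))) \<longlonglongrightarrow> 0"
    by (intro Lim_null_comparison[OF _ \<open>\<epsilon> \<longlonglongrightarrow> 0\<close>]) (simp only: real_norm_def)
  moreover have "(\<lambda>n. exp (- (real (n choose m) * q n))) \<longlonglongrightarrow> exp (- \<Lambda>)"
    by (rule tendsto_exp[OF tendsto_minus[OF Cq]])
  ultimately have "(\<lambda>n. (M.prob (space M - (\<Union>S\<in>Is n. A n S)) - exp (- (real (n choose m) * q n))) + exp (- (real (n choose m) * q n))) \<longlonglongrightarrow> 0 + exp (- \<Lambda>)"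
    by (rule tendsto_add)
  then have "(\<lambda>n. M.prob (space M - (\<Union>S\<in>Is n. A n S))) \<longlonglongrightarrow> exp (- \<Lambda>)" by simp
  then have "(\<lambda>n. 1 - M.prob (space M - (\<Union>S\<in>Is n. A n S))) \<longlonglongrightarrow> 1 - exp (- \<Lambda>)"
    by (rule tendsto_diff[OF tendsto_const])
  moreover have "1 - M.prob (space M - (\<Union>S\<in>Is n. A n S)) = M.prob (\<Union>S\<in>Is n. A n S)" for n
  proof -
    have "A n S \<in> M.events" if S: "S \<in> Is n" for S
    proof -
      have fin: "finite S" "length (sorted_list_of_set S) = m"
        using S finite_subset[of S "{1..n}"] by (auto simp: Is_def)
      have nth: "sorted_list_of_set S ! i \<ge> 1" if "i < m" for i
        using that fin S nth_mem[of i "sorted_list_of_set S"] by (auto simp: Is_def)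
      have "(\<lambda>\<omega>. \<lambda>i\<in>{..<m}. X (sorted_list_of_set S ! i) \<omega>) \<in> M \<rightarrow>\<^sub>M PiM {..<m} (\<lambda>_. borel)"
        using X nth by (intro measurable_restrict) (auto simp: M.indep_vars_def)
      from measurable_sets[OF this sets_config] show ?thesis
        by (simp add: A_def vimage_def Int_def conj_commute)
    qed
    then have "(\<Union>S\<in>Is n. A n S) \<in> M.events" by (intro sets.finite_UN) (auto simp: Is_def)
    then show ?thesis by (simp add: M.prob_compl)
  qed
  ultimately show ?thesis by (simp add: A_def Is_def \<Lambda>_def)
qed

section \<open>The constant K as a volume\<close>

text \<open>The Gamma factors agree because (m - 1) / 2 + 1 = (m + 1) / 2. For a vanishing
  determinant both sides are infinite, the volume by degeneracy and K by division by zero;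
  positivity of the integral excludes 0 times infinity.\<close>

lemma K_const_eq:
  assumes I: "polygon_density_integral p m > 0"
  shows "K_const g p m = ennreal (polygon_density_integral p m) *
    emeasure Leb {y\<in>space Leb. Q y \<le> 2}"
    and "Determinant.det (- G_mat g m) = 0 \<Longrightarrow> K_const g p m = \<infinity>"
proof -
  let ?d = "Determinant.det (- G_mat g m)" and ?I = "polygon_density_integral p m"
  let ?a = "(2 * pi) powr ((real m - 1) / 2)" and ?\<Gamma> = "Gamma ((real m + 1) / 2)"
  have d: "?d \<ge> 0"
    unfolding minus_G_mat by (rule emeasure_ellipsoid_psd(1)[OF Amat_sym quad_form_Amat_nonneg])
  have k: "real (m - 1) = real m - 1" "(real m - 1) / 2 + 1 = (real m + 1) / 2" using m2 by (auto simp: field_simps)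
  have V: "emeasure Leb {y\<in>space Leb. Q y \<le> 2} =
    ennreal (?a / ?\<Gamma>) / ennreal (sqrt ?d)"
    unfolding minus_G_mat emeasure_ellipsoid_psd(2)[OF Amat_sym quad_form_Amat_nonneg] k ..
  have \<Gamma>: "?\<Gamma> > 0" using m2 by (intro Gamma_real_pos) auto
  have a: "?a > 0" by simp
  have a\<Gamma>: "?a / ?\<Gamma> > 0" using \<Gamma> by (intro divide_pos_pos) auto
  have "K_const g p m = ennreal ?I * (ennreal (?a / ?\<Gamma>) / ennreal (sqrt ?d)) \<and> (?d = 0 \<longrightarrow> K_const g p m = \<infinity>)"
  proof (cases "?d = 0")
    case True
    have "?a * ?I > 0" using a I by (rule mult_pos_pos)
    then have "K_const g p m = \<infinity>" unfolding K_const_def using True I less_imp_neq[OF I] by simp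
    moreover have "ennreal (?a / ?\<Gamma>) / ennreal (sqrt ?d) = \<infinity>"
    proof -
      have "ennreal r / 0 = \<infinity>" if "r > 0" for r using that by simp
      from this[OF a\<Gamma>] show ?thesis unfolding True real_sqrt_zero ennreal_0 .
    qed
    ultimately show ?thesis using I True by (simp add: ennreal_mult_top)
  next
    case False
    then have sd: "sqrt ?d > 0" using d by simp
    have "K_const g p m = ennreal (?a * ?I / (sqrt ?d * ?\<Gamma>))"
      unfolding K_const_def using sd \<Gamma> a I by (intro divide_ennreal mult_pos_pos mult_nonneg_nonneg) auto
    moreover have "ennreal (?a / ?\<Gamma>) / ennreal (sqrt ?d) = ennreal (?a / ?\<Gamma> / sqrt ?d)"
      using sd a\<Gamma> by (intro divide_ennreal) auto
    moreover have "ennreal ?I * ennreal (?a / ?\<Gamma> / sqrt ?d) = ennreal (?I * (?a / ?\<Gamma> / sqrt ?d))"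
      by (rule ennreal_mult'[symmetric]) (use I in simp)
    moreover have "?a * ?I / (sqrt ?d * ?\<Gamma>) = ?I * (?a / ?\<Gamma> / sqrt ?d)" by (simp add: mult_ac)
    ultimately show ?thesis using False by (simp only: simp_thms)
  qed
  then show "K_const g p m = ennreal ?I * emeasure Leb {y\<in>space Leb. Q y \<le> 2}"
    "?d = 0 \<Longrightarrow> K_const g p m = \<infinity>"
    unfolding V by auto
qed

end

section \<open>From points on the circle to the limit law\<close>

text \<open>The function is continuous off the nonnegative real axis and vanishes on it, so it
  equals its restriction to an open set, extended by 0.\<close>

lemma measurable_Arg2pi: "Arg2pi \<in> borel_measurable borel"
proof -
  have "continuous_on (- \<real>\<^sub>\<ge>\<^sub>0) Arg2pi"
    by (intro continuous_at_imp_continuous_on ballI continuous_at_Arg2pi) auto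
  then have 1: "(\<lambda>z. indicator (- \<real>\<^sub>\<ge>\<^sub>0) z *\<^sub>R Arg2pi z) \<in> borel_measurable borel"
    by (intro borel_measurable_continuous_on_indicator) auto
  have "Arg2pi z = indicator (- \<real>\<^sub>\<ge>\<^sub>0) z *\<^sub>R Arg2pi z" for z
    by (cases "z \<in> \<real>\<^sub>\<ge>\<^sub>0") (auto simp: indicator_def Arg2pi_eq_0 complex_nonneg_Reals_iff complex_is_Real_iff)
  then have "Arg2pi = (\<lambda>z. indicator (- \<real>\<^sub>\<ge>\<^sub>0) z *\<^sub>R Arg2pi z)" by blast
  then show ?thesis using 1 by simp
qed

context concave_kernel
begin

text \<open>A finite maximum reaches a level iff one of its members does, and increasing index lists
  correspond to index sets. The condition \<open>n \<ge> m\<close> makes the set of values nonempty,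
  so that \<open>Max\<close> is meaningful.\<close>

lemma deficit_event_iff:
  fixes u :: "nat \<Rightarrow> complex"
  assumes n: "n \<ge> m" and u: "\<And>i. i \<ge> 1 \<Longrightarrow> u i \<in> sphere 0 1" and c: "c > 0"
  shows "c * (1/2 * (\<Sum>s=1..m-1. real m * g (2 * pi * real s / real m)) - U_max g m n u) \<le> t \<longleftrightarrow>
    (\<exists>S\<in>{S. S \<subseteq> {1..n} \<and> card S = m}. deficit (\<lambda>i. Arg2pi (u (sorted_list_of_set S ! i))) \<le> t / c)"
proof -
  let ?M0 = "1/2 * (\<Sum>s=1..m-1. real m * g (2 * pi * real s / real m))"
  let ?J = "{js. length js = m \<and> sorted_wrt (<) js \<and> set js \<subseteq> {1..n}}"
  let ?V = "{angle_kernel g (map u js) | js. length js = m \<and> sorted_wrt (<) js \<and> set js \<subseteq> {1..n}}"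
  have V: "?V = (\<lambda>js. angle_kernel g (map u js)) ` ?J" by auto
  have "finite {js. set js \<subseteq> {1..n} \<and> length js = m}" by (rule finite_lists_length_eq) simp
  then have "finite ?J" by (rule rev_finite_subset) auto
  then have fin: "finite ?V" unfolding V by (rule finite_imageI)
  have "[1..<Suc m] \<in> ?J" using n by (auto simp: strict_sorted_iff simp del: upt_Suc)
  then have ne: "?V \<noteq> {}" unfolding V by blast
  have kernel: "angle_kernel g (map u js) = ?M0 - deficit (\<lambda>i. Arg2pi (u (js ! i)))" if "js \<in> ?J" for js
  proof -
    have "angle_kernel g (map u js) = (\<Sum>j<m. \<Sum>i<j. ghat (Arg2pi (map u js ! j) - Arg2pi (map u js ! i)))"
      using that u by (intro angle_kernel_eq) auto
    also have "\<dots> = (\<Sum>j<m. \<Sum>i<j. ghat (Arg2pi (u (js ! j)) - Arg2pi (u (js ! i))))"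
      using that by (intro sum.cong refl) auto
    finally show ?thesis by (simp add: deficit_def)
  qed
  have "c * (?M0 - U_max g m n u) \<le> t \<longleftrightarrow> ?M0 - t / c \<le> Max ?V"
    using c unfolding U_max_def by (simp add: field_simps)
  also have "\<dots> \<longleftrightarrow> (\<exists>v\<in>?V. ?M0 - t / c \<le> v)" by (rule Max_ge_iff[OF fin ne])
  also have "\<dots> \<longleftrightarrow> (\<exists>js\<in>?J. ?M0 - t / c \<le> angle_kernel g (map u js))" unfolding V by blast
  also have "\<dots> \<longleftrightarrow> (\<exists>js\<in>?J. deficit (\<lambda>i. Arg2pi (u (js ! i))) \<le> t / c)"
    by (intro bex_cong refl) (subst kernel, auto)
  also have "\<dots> \<longleftrightarrow> (\<exists>S\<in>{S. S \<subseteq> {1..n} \<and> card S = m}. deficit (\<lambda>i. Arg2pi (u (sorted_list_of_set S ! i))) \<le> t / c)"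
  proof
    assume "\<exists>js\<in>?J. deficit (\<lambda>i. Arg2pi (u (js ! i))) \<le> t / c"
    then obtain js where js: "length js = m" "sorted_wrt (<) js" "set js \<subseteq> {1..n}" "deficit (\<lambda>i. Arg2pi (u (js ! i))) \<le> t / c"
      by blast
    have "sorted_list_of_set (set js) = js" "card (set js) = length js"
      using js(2) by (auto simp: strict_sorted_iff sorted_list_of_set.idem_if_sorted_distinct distinct_card)
    then show "\<exists>S\<in>{S. S \<subseteq> {1..n} \<and> card S = m}. deficit (\<lambda>i. Arg2pi (u (sorted_list_of_set S ! i))) \<le> t / c"
      using js by (intro bexI[of _ "set js"]) auto
  next
    assume "\<exists>S\<in>{S. S \<subseteq> {1..n} \<and> card S = m}. deficit (\<lambda>i. Arg2pi (u (sorted_list_of_set S ! i))) \<le> t / c"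
    then obtain S where S: "S \<subseteq> {1..n}" "card S = m" "deficit (\<lambda>i. Arg2pi (u (sorted_list_of_set S ! i))) \<le> t / c"
      by blast
    have "finite S" using S(1) finite_subset by auto
    then have "sorted_list_of_set S \<in> ?J" using S by auto
    then show "\<exists>js\<in>?J. deficit (\<lambda>i. Arg2pi (u (js ! i))) \<le> t / c"
      using S(3) by blast
  qed
  finally show ?thesis .
qed

end

theorem corollary6p1:
  fixes M :: "'a measure" and U :: "nat \<Rightarrow> 'a \<Rightarrow> complex"
    and g p :: "real \<Rightarrow> real" and m :: nat and t :: real
  assumes "m \<ge> 2"
    and "continuous_on {0..2*pi} g"
    and "strictly_concave_on {0..2*pi} g"
    and "\<And>s. s \<in> {1..m-1} \<Longrightarrow> C3_near g (2 * pi * real s / real m)"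
    and "\<And>x. x \<in> {0..2*pi} \<Longrightarrow> g x = g (2 * pi - x)"
    and "continuous_on UNIV p"
    and "\<And>x. p (x + 2 * pi) = p x"
    and "\<And>x. p x \<ge> 0"
    and "integral {0..2*pi} p = 1"
    and "polygon_density_integral p m > 0"
    and "prob_space M"
    and "prob_space.indep_vars M (\<lambda>_. borel) U {1..}"
    and "\<And>i. i \<ge> 1 \<Longrightarrow> circle_distributed M (U i) p"
    and "t > 0"
  shows "(\<lambda>n. measure M {\<omega> \<in> space M.
            real n powr (2 * real m / (real m - 1)) *
              (1/2 * (\<Sum>s=1..m-1. real m * g (2 * pi * real s / real m))
                 - U_max g m n (\<lambda>i. U i \<omega>)) \<le> t})
         \<longlonglongrightarrow> 1 - exp_minus (ennreal (t powr ((real m - 1) / 2)) * K_const g p m / of_nat m)"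
proof -
  interpret concave_kernel_density g m p
    by (intro concave_kernel_density.intro concave_kernel.intro concave_kernel_density_axioms.intro) (fact assms)+
  interpret M: prob_space M by fact
  define X where "X i \<omega> = Arg2pi (U i \<omega>)" for i \<omega>
  have X: "M.indep_vars (\<lambda>_. borel) X {1..}"
    unfolding X_def[abs_def] by (rule M.indep_vars_compose2[OF assms(12)]) (rule measurable_Arg2pi)
  have distr: "distr M borel (X i) = circ_measure p" if "i \<ge> 1" for i
  proof -
    have "distributed M lborel (X i) (\<lambda>x. ennreal (p x * indicator {0..<2*pi} x))"
      using assms(13)[OF that] by (simp add: circle_distributed_def X_def[abs_def])
    then have "distr M lborel (X i) = circ_measure p"
      by (simp add: distributed_def circ_measure_def)
    moreover have "distr M lborel (X i) = distr M borel (X i)" by (rule distr_cong) simp_all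
    ultimately show ?thesis by simp
  qed
  have Xm: "X i \<in> borel_measurable M" if "i \<ge> 1" for i
    using X that by (auto simp: M.indep_vars_def)
  let ?I = "polygon_density_integral p m" and ?tp = "t powr ((real m - 1) / 2)"
  define s where "s n = sqrt t * real (max 1 n) powr (- (real m / real (m - 1)))" for n :: nat
  define Is where "Is n = {S. S \<subseteq> {1..n} \<and> card S = m}" for n :: nat
  \<comment> \<open>\<open>F R n\<close> requires deviations of at most \<open>R * s n\<close> in
    addition, so it is contained in \<open>Ev n\<close>; its limit is known for each fixed
    R.\<close>
  define F where "F R n = (\<Union>S\<in>Is n. {\<omega>\<in>space M. (\<lambda>i\<in>{..<m}. X (sorted_list_of_set S ! i) \<omega>) \<in> config ((s n)\<^sup>2) (R * s n)})" for R n
  define Ev where "Ev n = (\<Union>S\<in>Is n. {\<omega>\<in>space M. deficit (\<lambda>i. X (sorted_list_of_set S ! i) \<omega>) \<le> (s n)\<^sup>2})" for n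
  have s_pos: "s n > 0" for n using \<open>t > 0\<close> by (simp add: s_def)
  have F_lim: "(\<lambda>n. M.prob (F R n)) \<longlonglongrightarrow> 1 - exp (- (?tp * ?I * enn2real (Vol R) / real m))" if "R \<ge> 0" for R
    unfolding F_def Is_def s_def using assms(10,11,14) X distr that
    by (intro prob_config_limit) auto
  have Ev_eq: "{\<omega> \<in> space M. real n powr (2 * real m / (real m - 1)) *
      (1/2 * (\<Sum>s=1..m-1. real m * g (2 * pi * real s / real m)) - U_max g m n (\<lambda>i. U i \<omega>)) \<le> t} = Ev n"
    if n: "n \<ge> m" for n
  proof -
    have npos: "real n powr (2 * real m / (real m - 1)) > 0" using n m2 by simp
    have "(s n)\<^sup>2 = t * (real n powr (- (real m / (real m - 1))))\<^sup>2"
      using n m2 \<open>t > 0\<close> by (simp add: s_def power_mult_distrib of_nat_diff)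
    also have "\<dots> = t * real n powr (- (2 * real m / (real m - 1)))"
      using n m2 by (simp add: powr_power)
    finally have z: "t / real n powr (2 * real m / (real m - 1)) = (s n)\<^sup>2"
      by (simp add: powr_minus_divide)
    have sph: "U i \<omega> \<in> sphere 0 1" if "i \<ge> 1" "\<omega> \<in> space M" for i \<omega>
      using assms(13)[OF that(1)] that(2) by (simp add: circle_distributed_def)
    have iff: "real n powr (2 * real m / (real m - 1)) *
      (1/2 * (\<Sum>s=1..m-1. real m * g (2 * pi * real s / real m)) - U_max g m n (\<lambda>i. U i \<omega>)) \<le> t \<longleftrightarrow>
      (\<exists>S\<in>Is n. deficit (\<lambda>i. X (sorted_list_of_set S ! i) \<omega>) \<le> (s n)\<^sup>2)" if "\<omega> \<in> space M" for \<omega>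
      unfolding Is_def X_def z[symmetric]
      by (rule deficit_event_iff[OF n _ npos]) (rule sph[OF _ that])
    have "Ev n = {\<omega>\<in>space M. \<exists>S\<in>Is n. deficit (\<lambda>i. X (sorted_list_of_set S ! i) \<omega>) \<le> (s n)\<^sup>2}"
      by (auto simp: Ev_def)
    also have "\<dots> = {\<omega> \<in> space M. real n powr (2 * real m / (real m - 1)) *
      (1/2 * (\<Sum>s=1..m-1. real m * g (2 * pi * real s / real m)) - U_max g m n (\<lambda>i. U i \<omega>)) \<le> t}"
      by (rule Collect_cong) (simp only: iff cong: conj_cong)
    finally show ?thesis ..
  qed
  have sub: "F R n \<subseteq> Ev n" for R n
    unfolding F_def Ev_def config_def by (auto simp: deficit_restrict)
  have nth: "sorted_list_of_set S ! i \<ge> 1" if "S \<in> Is n" "i < m" for S i n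
  proof -
    have "finite S" "length (sorted_list_of_set S) = m"
      using that finite_subset[of S "{1..n}"] by (auto simp: Is_def)
    then show ?thesis using that nth_mem[of i "sorted_list_of_set S"] by (auto simp: Is_def)
  qed
  have Ev_sets: "Ev n \<in> M.events" for n
    unfolding Ev_def
  proof (rule sets.finite_UN)
    show "finite (Is n)" by (simp add: Is_def)
    fix S assume S: "S \<in> Is n"
    have "(\<lambda>\<omega>. \<lambda>i\<in>{..<m}. X (sorted_list_of_set S ! i) \<omega>) \<in> M \<rightarrow>\<^sub>M PiM {..<m} (\<lambda>_. borel)"
      using nth[OF S] Xm by (intro measurable_restrict) auto
    from measurable_compose[OF this measurable_deficit]
    have [measurable]: "(\<lambda>\<omega>. deficit (\<lambda>i. X (sorted_list_of_set S ! i) \<omega>)) \<in> borel_measurable M"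
      unfolding deficit_restrict .
    show "{\<omega>\<in>space M. deficit (\<lambda>i. X (sorted_list_of_set S ! i) \<omega>) \<le> (s n)\<^sup>2} \<in> M.events" by measurable
  qed
  have s_lim: "s \<longlonglongrightarrow> 0"
  proof -
    have "filterlim (\<lambda>n. real (max 1 n)) at_top sequentially"
      by (rule filterlim_at_top_mono[OF filterlim_real_sequentially]) auto
    then have "(\<lambda>n. real (max 1 n) powr (- (real m / real (m - 1)))) \<longlonglongrightarrow> 0"
      using m2 by (intro tendsto_neg_powr) auto
    from tendsto_mult_left[OF this, of "sqrt t"] show ?thesis by (simp add: s_def[abs_def])
  qed
  have "(\<lambda>n. M.prob (Ev n)) \<longlonglongrightarrow> 1 - exp_minus (ennreal ?tp * K_const g p m / of_nat m)"
  proof (cases "Determinant.det (- G_mat g m) = 0")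
    \<comment> \<open>Nondegenerate case: for one fixed R a small deficit already enforces the
      truncation, so both events coincide once \<open>(s n)^2 < z0\<close>.\<close>
    case False
    obtain R z0 where R: "R > 0" "z0 > 0"
      and near: "\<And>z x. deficit x \<le> z \<Longrightarrow> z \<le> z0 \<Longrightarrow>
       \<exists>\<sigma>. \<sigma> permutes {..<m-1} \<and> (\<forall>i<m-1. \<exists>n::int. \<bar>x (\<sigma> i) - x (m - 1) - vertex i - 2 * pi * of_int n\<bar> \<le> R * sqrt z)"
      and bnd: "\<And>x i. i < m - 1 \<Longrightarrow> Q x \<le> 2 \<Longrightarrow> \<bar>x i\<bar> \<le> R"
      by (rule small_deficit_near_regular[OF False]) blast
    have "boxed_ellipsoid R = {y\<in>space Leb. Q y \<le> 2}"
      using bnd by (auto simp: boxed_ellipsoid_def)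
    then have K: "K_const g p m = ennreal ?I * Vol R"
      using K_const_eq(1)[OF assms(10)] by (simp add: Vol_def)
    obtain v where v: "Vol R = ennreal v" "v \<ge> 0" using Vol_finite[of R] R by (cases "Vol R") auto
    have lim_eq: "exp_minus (ennreal ?tp * K_const g p m / of_nat m) = exp (- (?tp * ?I * enn2real (Vol R) / real m))"
    proof -
      have "ennreal ?tp * K_const g p m / of_nat m = ennreal (?tp * (?I * v)) / ennreal (real m)"
        using v assms(10) by (simp add: K ennreal_mult' ennreal_mult ennreal_of_nat_eq_real_of_nat)
      also have "\<dots> = ennreal (?tp * (?I * v) / real m)"
        using v assms(10) m2 by (intro divide_ennreal mult_nonneg_nonneg) auto
      finally show ?thesis using v assms(10) m2 by (simp add: exp_minus_def mult.assoc)
    qed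
    have "(\<lambda>n. (s n)\<^sup>2) \<longlonglongrightarrow> 0\<^sup>2" by (intro tendsto_intros s_lim)
    then have "eventually (\<lambda>n. (s n)\<^sup>2 < z0) sequentially" using R by (intro order_tendstoD(2)) auto
    then have "eventually (\<lambda>n. M.prob (Ev n) = M.prob (F R n)) sequentially"
    proof eventually_elim
      case (elim n)
      have "Ev n \<subseteq> F R n"
      proof
        fix \<omega> assume "\<omega> \<in> Ev n"
        then obtain S where S: "S \<in> Is n" "\<omega> \<in> space M" "deficit (\<lambda>i. X (sorted_list_of_set S ! i) \<omega>) \<le> (s n)\<^sup>2"
          by (auto simp: Ev_def)
        define x where "x = (\<lambda>i\<in>{..<m}. X (sorted_list_of_set S ! i) \<omega>)"
        have "deficit x \<le> (s n)\<^sup>2" unfolding x_def deficit_restrict by (rule S(3))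
        moreover from near[OF this less_imp_le[OF elim]]
        have "\<exists>\<sigma>. \<sigma> permutes {..<m-1} \<and> (\<forall>i<m-1. \<exists>n'::int. \<bar>x (\<sigma> i) - x (m - 1) - vertex i - 2 * pi * of_int n'\<bar> \<le> R * s n)"
          using s_pos[of n] by simp
        moreover have "x \<in> space (PiM {..<m} (\<lambda>_. borel))" by (simp add: x_def space_PiM)
        ultimately have "x \<in> config ((s n)\<^sup>2) (R * s n)" by (simp add: config_def)
        then show "\<omega> \<in> F R n" using S by (auto simp: F_def x_def)
      qed
      then have "Ev n = F R n" using sub by blast
      then show ?case by simp
    qed
    then show ?thesis using F_lim[of R] R unfolding lim_eq by (simp add: tendsto_cong)
  next
    \<comment> \<open>Degenerate case: the truncated events bound the probability only from below,
      but their limits tend to 1 as R grows, because \<open>Vol R\<close> tends to infinity.\<close>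
    case True
    have top: "K_const g p m = \<infinity>" by (rule K_const_eq(2)[OF assms(10) True])
    have "emeasure Leb {y\<in>space Leb. Q y \<le> 2} = \<infinity>"
      using top K_const_eq(1)[OF assms(10)] by (auto simp: ennreal_mult_eq_top_iff)
    then have Vol_top: "(\<lambda>j. Vol (real j)) \<longlonglongrightarrow> \<infinity>" using Vol_limit by simp
    have "ennreal ?tp * K_const g p m / of_nat m = \<infinity>"
      using \<open>t > 0\<close> m2 by (simp add: top ennreal_mult_top ennreal_top_divide ennreal_of_nat_eq_real_of_nat)
    then have lim_eq: "1 - exp_minus (ennreal ?tp * K_const g p m / of_nat m) = 1" by (simp add: exp_minus_def)
    show ?thesis
      unfolding lim_eq
    proof (rule order_tendstoI)
      fix a :: real assume "1 < a"
      then show "eventually (\<lambda>n. M.prob (Ev n) < a) sequentially"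
        by (intro always_eventually allI le_less_trans[OF M.prob_le_1])
    next
      fix a :: real assume a: "a < 1"
      define b where "b = (max a 0 + 1) / 2"
      have b: "a < b" "0 < b" "b < 1" using a by (auto simp: b_def)
      \<comment> \<open>w is the volume at which \<open>1 - exp (- (?tp * ?I * w / m))\<close>
        equals b; any larger volume therefore brings the limit above a.\<close>
      define w where "w = - ln (1 - b) * real m / (?tp * ?I)"
      have tpI: "?tp * ?I > 0" using \<open>t > 0\<close> assms(10) by (intro mult_pos_pos) auto
      have "eventually (\<lambda>j. Vol (real j) > ennreal w) sequentially"
        by (rule order_tendstoD(1)[OF Vol_top]) simp
      then obtain j where j: "Vol (real j) > ennreal w" by (auto simp: eventually_sequentially)
      obtain v where v: "Vol (real j) = ennreal v" "v \<ge> 0" using Vol_finite[of "real j"] by (cases "Vol (real j)") auto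
      have "w < v" using j v(1) ennreal_leI[of v w] by (metis not_le)
      then have "w * (?tp * ?I) < v * (?tp * ?I)" using tpI by (intro mult_strict_right_mono)
      moreover have "w * (?tp * ?I) = - ln (1 - b) * real m"
      proof -
        have "x / y * y = x" if "y > 0" for x y :: real using that by simp
        from this[OF tpI] show ?thesis by (simp only: w_def)
      qed
      ultimately have "- ln (1 - b) * real m < ?tp * ?I * v" by (simp only: mult.commute[of v])
      then have "- ln (1 - b) < ?tp * ?I * v / real m" using m2 by (simp add: pos_less_divide_eq)
      then have "exp (- (?tp * ?I * v / real m)) < exp (ln (1 - b))" by simp
      then have "a < 1 - exp (- (?tp * ?I * enn2real (Vol (real j)) / real m))" using b v by simp
      from order_tendstoD(1)[OF F_lim[of "real j"] this]
      have "eventually (\<lambda>n. a < M.prob (F (real j) n)) sequentially" by simp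
      then show "eventually (\<lambda>n. a < M.prob (Ev n)) sequentially"
        by eventually_elim (rule less_le_trans[OF _ M.finite_measure_mono[OF sub Ev_sets]])
    qed
  qed
  moreover have "eventually (\<lambda>n. measure M {\<omega> \<in> space M. real n powr (2 * real m / (real m - 1)) *
      (1/2 * (\<Sum>s=1..m-1. real m * g (2 * pi * real s / real m)) - U_max g m n (\<lambda>i. U i \<omega>)) \<le> t} = M.prob (Ev n)) sequentially"
    using eventually_ge_at_top[of m] by eventually_elim (simp only: Ev_eq)
  ultimately show ?thesis by (simp only: tendsto_cong)
qed

end
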